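(* Let $S_0$ and $S_1$ be closed sectors in $\mathbb{C}$ satisfying $S_0\cap S_1=\{0\}$. For $j\in\{0,1\}$ let $\theta_j$ denote the opening angle of $S_j$, and suppose that $$\min\{\theta_0,\theta_1\}<\frac{\pi}{2}\quad\text{and}\quad \max\{\theta_0,\theta_1\}<\pi.$$ Then there is no transcendental entire function $f$ of finite order for which all but finitely many zeros of $f$ are in $S_0$ while all but finitely many $1$-points of $f$ are in $S_1$.
   Context: A closed sector in $\mathbb{C}$ has its vertex at the origin, i.e. it is a set of the form $\{re^{it}\colon r\ge 0,\ \alpha\le t\le\beta\}$ with real $\alpha<\beta$, $\beta-\alpha<2\pi$; its opening angle is $\beta-\alpha$. A $1$-point of $f$ is a point $z$ with $f(z)=1$. An entire function is transcendental if it is not a polynomial. The order of an entire function $f$ is $\rho=\limsup_{r\to\infty}\frac{\log\log M(r)}{\log r}$, where $M(r)=\max_{|z|=r}|f(z)|$. The phrase "all but finitely many zeros (or $1$-points) are in a set" includes the case that there are only finitely many, or no, such points. *)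

theory Defs
  imports "HOL-Complex_Analysis.Complex_Analysis"
    "HOL-Computational_Algebra.Polynomial"
    "HOL-Library.Extended_Real"
begin

text \<open>The set \<open>S\<close> is a closed sector with vertex at the origin and opening angle \<open>\<theta>\<close>.
  Since \<open>\<beta> - \<alpha> < 2 * pi\<close>, the angle is determined by the set.\<close>

definition closed_sector :: "complex set \<Rightarrow> real \<Rightarrow> bool" where
  "closed_sector S \<theta> \<longleftrightarrow>
     (\<exists>\<alpha> \<beta>. \<alpha> < \<beta> \<and> \<beta> - \<alpha> < 2 * pi \<and>
        S = {complex_of_real r * cis t | r t. 0 \<le> r \<and> \<alpha> \<le> t \<and> t \<le> \<beta>} \<and>
        \<theta> = \<beta> - \<alpha>)"

definition transcendental_entire :: "(complex \<Rightarrow> complex) \<Rightarrow> bool" where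
  "transcendental_entire f \<longleftrightarrow> f holomorphic_on UNIV \<and> \<not> (\<exists>p :: complex poly. f = poly p)"

text \<open>For continuous \<open>f\<close> and \<open>r \<ge> 0\<close> the supremum is attained, the circle being compact
  and nonempty.\<close>

definition max_modulus :: "(complex \<Rightarrow> complex) \<Rightarrow> real \<Rightarrow> real" where
  "max_modulus f r = (SUP z\<in>sphere 0 r. norm (f z))"

text \<open>The order is extended-real valued, so that infinite order is representable. For
  nonconstant entire \<open>f\<close> one has \<open>max_modulus f r \<rightarrow> \<infinity>\<close>, so the values of \<open>ln\<close> outside its
  natural domain do not influence the upper limit.\<close>

definition entire_order :: "(complex \<Rightarrow> complex) \<Rightarrow> ereal" where
  "entire_order f = Limsup at_top (\<lambda>r :: real. ereal (ln (ln (max_modulus f r)) / ln r))"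

end

theory Submission
  imports Defs
begin

text \<open>
  In the coordinate \<open>\<zeta> = log z\<close> sectors are horizontal strips. The complements of \<open>S\<^sub>0\<close> and \<open>S\<^sub>1\<close>
  are the strips \<open>p0 < Im \<zeta> < q0\<close> and \<open>p1 < Im \<zeta> < q1\<close>; modulo \<open>2\<pi>\<i>\<close> they overlap in the two
  transition sectors \<open>p0 < Im \<zeta> < q1\<close> and \<open>p1 + 2\<pi> < Im \<zeta> < q0\<close>. Let \<open>A k = log M (exp (x k))\<close> at
  one-sided Polya peaks \<open>x k \<rightarrow> \<infinity>\<close>. By Montel and Hurwitz, subsequences of \<open>|f|\<close> and \<open>|f - 1|\<close> at
  \<open>exp (\<zeta> + x k)\<close>, raised to the power \<open>1 / A k\<close>, converge on these strips to \<open>|E0|\<close> and \<open>|E1|\<close>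
  with \<open>E0\<close>, \<open>E1\<close> holomorphic and free of zeros. On each transition sector either
  \<open>|E0| = |E1| \<ge> 1\<close>, or \<open>|E0| = 1\<close>, or \<open>|E1| = 1\<close>.

  Suppose that \<open>|E0| = 1\<close>. Then \<open>f - 1\<close> is not exponentially large on a half plane whose edges lie in
  the transition sectors, and a Poisson kernel barrier gives \<open>log |E1| \<ge> - C |z|\<close> on both edges.
  Two applications of the Phragmen-Lindelof principle in the complementary half plane, which contains
  \<open>S\<^sub>0\<close>, contradict the normalisation of \<open>E1\<close>. The case \<open>|E1| = 1\<close> is symmetric.

  Otherwise the derivatives of \<open>log E0\<close> and \<open>log E1\<close> glue to a function near \<open>\<infinity>\<close> of polynomial
  growth, with leading term \<open>c z ^ d\<close>. The case \<open>d \<ge> 1\<close> is excluded by counting sign changes of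
  \<open>Re (c z ^ d)\<close>, using the bounds on the angles. In the remaining case \<open>|f|\<close> is large on a sequence
  of circles \<open>|z| = R \<rightarrow> \<infinity>\<close>. There \<open>z (f' / f - f' / (f - 1))\<close> has bounded integral, so the sum of
  the zeros and the sum of the 1-points in \<open>|z| < R\<close> have bounded difference. Since a line separates
  the two sectors, there are only finitely many zeros and 1-points, contradicting Picard's theorem.
\<close>

section \<open>Harnack's inequality\<close>

text \<open>In general, limits of \<open>log |f|\<close> divided by \<open>A k\<close> are only
  subharmonic. Here each complement is free of the relevant points, so roots of \<open>f\<close> and
  \<open>f - 1\<close> are holomorphic there; the price is a pair of limits that must be compared on
  the overlaps. The order of \<open>f\<close> is finite but arbitrary, so \<open>log |E1|\<close>
  may grow like a high power of \<open>|z|\<close>, beyond what Phragmen-Lindelof admits in a half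
  plane. In the flat case Harnack's inequality passes to the derivative of \<open>log E1\<close>,
  which has polynomial growth, and the linear bound on the edges is carried inside. Openings below
  \<open>pi\<close> make both complements wider than a half plane: this yields the separating line,
  the half plane of the flat case and the evenness of \<open>d\<close>. An opening below
  \<open>pi / 2\<close> then removes the even \<open>d \<ge> 2\<close>; it is sharp for this count,
  since for \<open>d = 2\<close> three half periods of the cosine fill an angle of exactly
  \<open>3 * pi / 2\<close>. The remaining case cannot be excluded by signs, because
  \<open>|f|\<close> is large in all directions. There the first moments of zeros and 1-points,
  unlike their numbers, detect in which directions the points lie.\<close>

lemma Harnack_unit_disc_strict:
  assumes hol: "h holomorphic_on ball 0 1" and neg: "\<And>z. norm z < 1 \<Longrightarrow> Re (h z) < 0"
    and z: "norm z < 1"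
  shows "(1 + norm z) / (1 - norm z) * Re (h 0) \<le> Re (h z)"
    and "Re (h z) \<le> (1 - norm z) / (1 + norm z) * Re (h 0)"
    and "norm (deriv h 0) \<le> - 2 * Re (h 0)"
proof -
  define a where "a = h 0"
  have a: "Re a < 0" using neg[of 0] by (simp add: a_def)
  \<comment> \<open>This Moebius transformation maps the left half plane to the unit disc and
    \<open>a\<close> to 0. Schwarz's lemma gives \<open>norm (m z) \<le> norm z\<close>, and solving
    for \<open>h z\<close> turns this into both Harnack bounds.\<close>
  define m where "m = (\<lambda>z. (h z - a) / (h z + cnj a))"
  have nz: "h z + cnj a \<noteq> 0" if "norm z < 1" for z
  proof
    assume "h z + cnj a = 0"
    hence "Re (h z + cnj a) = 0" by simp
    thus False using neg[OF that] a by simp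
  qed
  have holm: "m holomorphic_on ball 0 1"
    unfolding m_def using nz by (intro holomorphic_intros hol) auto
  have id: "(norm (w + cnj a))^2 - (norm (w - a))^2 = 4 * Re w * Re a" for w
    unfolding cmod_power2 by (simp add: algebra_simps power2_eq_square)
  have m1: "norm (m z) < 1" if "norm z < 1" for z
  proof -
    have "(norm (h z - a))^2 < (norm (h z + cnj a))^2"
      using id[of "h z"] mult_neg_neg[OF neg[OF that] a] by simp
    hence "norm (h z - a) < norm (h z + cnj a)" by (simp add: power2_less_imp_less)
    thus ?thesis using nz[OF that] by (simp add: m_def norm_divide)
  qed
  have m0: "m 0 = 0" by (simp add: m_def a_def)
  have mz: "norm (m z) \<le> norm z" using Schwarz_Lemma(1)[OF holm m0 m1 z] .
  have m'0: "norm (deriv m 0) \<le> 1" using Schwarz_Lemma(2)[OF holm m0 m1 z] .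
  define w where "w = m z"
  have w1: "norm w < 1" using mz z by (simp add: w_def)
  have "w * (h z + cnj a) = h z - a" using nz[OF z] by (simp add: w_def m_def)
  hence "h z * (1 - w) = a + w * cnj a" by (simp add: algebra_simps)
  moreover have w1': "1 - w \<noteq> 0" using w1 by auto
  ultimately have hz: "h z = (a + w * cnj a) / (1 - w)" by (simp add: field_simps)
  have nn: "(norm (1-w))^2 > 0" using w1' by simp
  have Rehz: "Re (h z) = Re a * ((1 - (norm w)^2) / (norm (1-w))^2)"
  proof -
    have "Re (h z) = Re ((a + w * cnj a) * cnj (1 - w)) / (norm (1-w))^2"
      unfolding hz by (simp add: complex_div_cnj[of _ "1-w"])
    also have "Re ((a + w * cnj a) * cnj (1 - w)) = Re a * (1 - (norm w)^2)"
      unfolding cmod_power2 by (simp add: algebra_simps power2_eq_square)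
    finally show ?thesis by simp
  qed
  define t where "t = norm z"
  have t: "0 \<le> t" "t < 1" "norm w \<le> t" using z mz by (auto simp: t_def w_def)
  define s where "s = norm w"
  have s: "0 \<le> s" "s < 1" "s \<le> t" using w1 t by (auto simp: s_def)
  have lo: "1 - s \<le> norm (1-w)" using norm_triangle_ineq2[of 1 w] by (simp add: s_def)
  have up: "norm (1-w) \<le> 1 + s" using norm_triangle_ineq4[of 1 w] by (simp add: s_def)
  have "(1 - s^2) / (norm (1-w))^2 \<le> (1 - s^2) / (1-s)^2"
    using s lo by (intro divide_left_mono power_mono mult_pos_pos) (use nn w1' in \<open>auto simp: power_le_one\<close>)
  also have "\<dots> = (1+s) * (1-s) / (1-s)^2" by (simp add: algebra_simps power2_eq_square)
  also have "\<dots> = (1+s)/(1-s)" using s by (simp add: power2_eq_square)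
  also have "\<dots> \<le> (1+t)/(1-t)" using s t by (intro frac_le) auto
  finally have A: "(1 - s^2) / (norm (1-w))^2 \<le> (1+t)/(1-t)" .
  have "(1-t)/(1+t) \<le> (1-s)/(1+s)" using s t by (intro frac_le) auto
  also have "\<dots> = (1-s) * (1+s) / (1+s)^2" using s by (simp add: power2_eq_square)
  also have "\<dots> = (1 - s^2) / (1+s)^2" by (simp add: algebra_simps power2_eq_square)
  also have "\<dots> \<le> (1 - s^2) / (norm (1-w))^2"
    using s up by (intro divide_left_mono power_mono mult_pos_pos) (use nn w1' in \<open>auto simp: power_le_one\<close>)
  finally have B: "(1-t)/(1+t) \<le> (1 - s^2) / (norm (1-w))^2" .
  show "(1 + norm z) / (1 - norm z) * Re (h 0) \<le> Re (h z)"
    using mult_left_mono_neg[OF A, of "Re a"] a Rehz by (simp add: t_def s_def a_def mult.commute)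
  show "Re (h z) \<le> (1 - norm z) / (1 + norm z) * Re (h 0)"
    using mult_left_mono_neg[OF B, of "Re a"] a Rehz by (simp add: t_def s_def a_def mult.commute)
  have dh: "(h has_field_derivative deriv h 0) (at 0)"
    using holomorphic_derivI[OF hol] by simp
  have n0: "h 0 + cnj a \<noteq> 0" using nz[of 0] by simp
  have "(m has_field_derivative (deriv h 0 / (a + cnj a))) (at 0)"
    unfolding m_def
    by (rule derivative_eq_intros dh n0 refl)+ (use n0 in \<open>simp add: a_def\<close>)
  hence "deriv m 0 = deriv h 0 / (a + cnj a)" by (rule DERIV_imp_deriv)
  moreover have "norm (a + cnj a) = - 2 * Re a" using a by (simp add: complex_add_cnj norm_mult)
  ultimately have "norm (deriv h 0) / (- 2 * Re a) \<le> 1" using m'0 by (simp add: norm_divide)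
  thus "norm (deriv h 0) \<le> - 2 * Re (h 0)" using a by (simp add: field_simps a_def)
qed

text \<open>Subtracting \<open>e > 0\<close> makes the real part strictly negative, and all three
  bounds survive \<open>e -> 0\<close>. The weak form matters because the real parts met later are
  only known to be at most 0.\<close>

lemma Harnack_unit_disc:
  assumes hol: "h holomorphic_on ball 0 1" and neg: "\<And>z. norm z < 1 \<Longrightarrow> Re (h z) \<le> 0"
    and z: "norm z < 1"
  shows "(1 + norm z) / (1 - norm z) * Re (h 0) \<le> Re (h z)"
    and "Re (h z) \<le> (1 - norm z) / (1 + norm z) * Re (h 0)"
    and "norm (deriv h 0) \<le> - 2 * Re (h 0)"
proof -
  define c1 c2 where "c1 = (1 + norm z) / (1 - norm z)" and "c2 = (1 - norm z) / (1 + norm z)"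
  have *: "c1 * (Re (h 0) - e) \<le> Re (h z) - e \<and> Re (h z) - e \<le> c2 * (Re (h 0) - e)
     \<and> norm (deriv h 0) \<le> - 2 * (Re (h 0) - e)" if e: "e > 0" for e::real
  proof -
    have holh: "(\<lambda>z. h z - of_real e) holomorphic_on ball 0 1"
      by (intro holomorphic_intros hol)
    have ng: "Re (h z - of_real e) < 0" if "norm z < 1" for z
      using neg[OF that] e by simp
    have d: "deriv (\<lambda>z. h z - of_real e) 0 = deriv h 0"
      using hol by (intro DERIV_imp_deriv)
        (auto intro!: derivative_eq_intros holomorphic_derivI[OF hol])
    show ?thesis
      using Harnack_unit_disc_strict[OF holh ng z] unfolding d c1_def c2_def by simp
  qed
  have lim: "a * (b - 0) \<le> c * (d - 0)" if "\<And>e. e > 0 \<Longrightarrow> a * (b - e) \<le> c * (d - e)" for a b c d :: real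
  proof (rule tendsto_le)
    show "((\<lambda>e. a * (b - e)) \<longlongrightarrow> a * (b - 0)) (at_right 0)" "((\<lambda>e. c * (d - e)) \<longlongrightarrow> c * (d - 0)) (at_right 0)"
      by (intro tendsto_intros)+
    show "eventually (\<lambda>e. a * (b - e) \<le> c * (d - e)) (at_right 0)"
      using that by (simp add: eventually_at_right_less eventually_at_filter)
  qed simp
  show "(1 + norm z) / (1 - norm z) * Re (h 0) \<le> Re (h z)"
    using lim[of c1 "Re (h 0)" 1 "Re (h z)"] * by (simp add: c1_def)
  show "Re (h z) \<le> (1 - norm z) / (1 + norm z) * Re (h 0)"
    using lim[of 1 "Re (h z)" c2 "Re (h 0)"] * by (simp add: c2_def)
  show "norm (deriv h 0) \<le> - 2 * Re (h 0)"
  proof (rule field_le_epsilon)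
    fix e :: real assume "e > 0"
    with *[of "e/2"] show "norm (deriv h 0) \<le> - 2 * Re (h 0) + e" by simp
  qed
qed

text \<open>At relative radius at most 1/2 the Harnack factor \<open>(1 - t) / (1 + t)\<close> is at
  least 1/3, so a very negative value at the centre is felt on the whole disc of half the
  radius.\<close>

lemma Harnack_disc:
  assumes hol: "V holomorphic_on ball c d" and neg: "\<And>z. z \<in> ball c d \<Longrightarrow> Re (V z) \<le> 0"
    and d: "d > 0"
  shows "norm (z - c) \<le> d / 2 \<Longrightarrow> Re (V z) \<le> Re (V c) / 3"
    and "norm (deriv V c) \<le> - (2 / d) * Re (V c)"
proof -
  define h where "h = (\<lambda>s. V (c + of_real d * s))"
  have im: "c + of_real d * s \<in> ball c d" if "norm s < 1" for s :: complex
    using that d by (simp add: dist_norm norm_mult)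
  have holh: "h holomorphic_on ball 0 1" unfolding h_def
    by (rule holomorphic_on_compose_gen[of "\<lambda>s. c + of_real d * s" _ V "ball c d", unfolded o_def])
       (use im in \<open>auto intro!: holomorphic_intros hol\<close>)
  have ng: "Re (h s) \<le> 0" if "norm s < 1" for s using neg[OF im[OF that]] by (simp add: h_def)
  have "(V has_field_derivative deriv V c) (at c)"
    using holomorphic_derivI[OF hol] d by simp
  hence "(h has_field_derivative deriv V c * of_real d) (at 0)"
    unfolding h_def by (intro DERIV_chain'[where f = "\<lambda>s. c + of_real d * s" and g = V])
      (auto intro!: derivative_eq_intros)
  hence "deriv h 0 = deriv V c * of_real d" by (rule DERIV_imp_deriv)
  moreover have "norm (deriv h 0) \<le> - 2 * Re (h 0)"
    using Harnack_unit_disc(3)[OF holh ng, of 0] by simp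
  ultimately show "norm (deriv V c) \<le> - (2 / d) * Re (V c)"
    using d by (simp add: h_def norm_mult field_simps)
  assume z: "norm (z - c) \<le> d / 2"
  define s where "s = (z - c) / of_real d"
  have ns: "norm s \<le> 1/2" using z d by (simp add: s_def norm_divide field_simps)
  have "Re (h s) \<le> (1 - norm s) / (1 + norm s) * Re (h 0)"
    using Harnack_unit_disc(2)[OF holh ng, of s] ns by simp
  also have "\<dots> \<le> 1/3 * Re (h 0)"
  proof (rule mult_right_mono_neg)
    show "1/3 \<le> (1 - norm s) / (1 + norm s)" using ns by (simp add: field_simps add_pos_nonneg)
    show "Re (h 0) \<le> 0" using ng[of 0] by simp
  qed
  also have "h s = V z" using d by (simp add: h_def s_def)
  finally show "Re (V z) \<le> Re (V c) / 3" by (simp add: h_def)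
qed

text \<open>\<open>C\<close> is fixed before \<open>V\<close>: this uniformity lets the bound serve
  all translates of a function along a strip. A Riemann map reduces the comparison of
  \<open>p\<close> with \<open>K\<close> to Harnack's inequality through the centre of the unit
  disc, and discs of radius \<open>d\<close> around the points of \<open>K\<close> convert values
  into derivatives.\<close>

lemma Harnack_derivative_bound:
  assumes W: "open W" "simply_connected W" "W \<noteq> UNIV" and p: "p \<in> W" and K: "compact K" "K \<subseteq> W"
  obtains C where "C > 0"
    "\<And>V z. \<lbrakk>V holomorphic_on W; \<And>w. w \<in> W \<Longrightarrow> Re (V w) \<le> 0; z \<in> K\<rbrakk> \<Longrightarrow> norm (deriv V z) \<le> - C * Re (V p)"
proof -
  have "W \<noteq> {}" using p by auto
  then obtain f g where f: "f holomorphic_on W" and g: "g holomorphic_on ball 0 1"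
    and fg: "\<And>z. z \<in> W \<Longrightarrow> f z \<in> ball 0 1 \<and> g (f z) = z"
    and gf: "\<And>z. z \<in> ball 0 1 \<Longrightarrow> g z \<in> W \<and> f (g z) = z"
    using Riemann_mapping_theorem[of W] W by metis
  obtain d where d: "d > 0" "\<And>x. x \<in> K \<Longrightarrow> ball x d \<subseteq> W"
    using compact_subset_open_imp_ball_epsilon_subset[OF K(1) W(1) K(2)] by (metis UN_subset_iff)
  have "\<exists>s. 0 \<le> s \<and> s < 1 \<and> (\<forall>z\<in>K. norm (f z) \<le> s)"
  proof (cases "K = {}")
    case False
    obtain x where x: "x \<in> K" "\<And>y. y \<in> K \<Longrightarrow> norm (f y) \<le> norm (f x)"
      using continuous_attains_sup[OF K(1) False, of "\<lambda>z. norm (f z)"]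
        holomorphic_on_imp_continuous_on[OF holomorphic_on_subset[OF f K(2)]]
      by (auto intro: continuous_on_norm)
    thus ?thesis using fg[of x] K(2) by (intro exI[of _ "norm (f x)"]) auto
  qed auto
  then obtain s where s: "0 \<le> s" "s < 1" "\<And>z. z \<in> K \<Longrightarrow> norm (f z) \<le> s" by auto
  define t where "t = norm (f p)"
  have t: "0 \<le> t" "t < 1" using fg[OF p] by (auto simp: t_def)
  define C where "C = 2 / d * ((1 + s) / (1 - s) * ((1 + t) / (1 - t)))"
  show ?thesis
  proof (rule that[of C])
    show "C > 0" using s t d by (auto simp: C_def intro!: mult_pos_pos divide_pos_pos)
    fix V z assume V: "V holomorphic_on W" and neg: "\<And>w. w \<in> W \<Longrightarrow> Re (V w) \<le> 0" and z: "z \<in> K"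
    define h where "h = V \<circ> g"
    have holh: "h holomorphic_on ball 0 1" unfolding h_def
      by (rule holomorphic_on_compose_gen[OF g V]) (use gf in auto)
    have ng: "Re (h w) \<le> 0" if "norm w < 1" for w using neg gf that by (simp add: h_def)
    have hz: "h (f z) = V z" "h (f p) = V p" using fg z K(2) p by (auto simp: h_def)
    have fz: "norm (f z) < 1" using fg z K(2) by auto
    have 1: "(1 + norm (f z)) / (1 - norm (f z)) * Re (h 0) \<le> Re (V z)"
      using Harnack_unit_disc(1)[OF holh ng fz] hz by simp
    have "(1 + norm (f z)) / (1 - norm (f z)) \<le> (1 + s) / (1 - s)"
      using s z by (intro frac_le) auto
    from mult_right_mono_neg[OF this ng[of 0]] 1
    have 2: "(1 + s) / (1 - s) * Re (h 0) \<le> Re (V z)" by simp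
    have 3: "Re (V p) \<le> (1 - t) / (1 + t) * Re (h 0)"
      using Harnack_unit_disc(2)[OF holh ng, of "f p"] t hz by (simp add: t_def)
    have "(1 + t) / (1 - t) * Re (V p) \<le> Re (h 0)"
    proof -
      have "(1 + t) / (1 - t) * ((1 - t) / (1 + t)) = 1" using t by simp
      hence "(1 + t) / (1 - t) * ((1 - t) / (1 + t) * Re (h 0)) = Re (h 0)"
        by (metis mult.assoc mult_1)
      thus ?thesis using mult_left_mono[OF 3, of "(1 + t) / (1 - t)"] t by simp
    qed
    from mult_left_mono[OF this, of "(1 + s) / (1 - s)"] s
    have 4: "(1 + s) / (1 - s) * ((1 + t) / (1 - t) * Re (V p)) \<le> Re (V z)" using 2 by simp
    have "norm (deriv V z) \<le> - (2 / d) * Re (V z)"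
      by (rule Harnack_disc(2)[OF _ _ d(1)]) (use d(2)[OF z] neg in \<open>auto intro: holomorphic_on_subset[OF V]\<close>)
    also have "\<dots> \<le> - (2 / d) * ((1 + s) / (1 - s) * ((1 + t) / (1 - t) * Re (V p)))"
      by (rule mult_left_mono_neg[OF 4]) (use d in auto)
    also have "\<dots> = - C * Re (V p)" by (simp add: C_def)
    finally show "norm (deriv V z) \<le> - C * Re (V p)" .
  qed
qed

section \<open>Boundary estimates in half strips and half planes\<close>

text \<open>The auxiliary factor has modulus at most \<open>exp (- e * k * exp (s * Re z))\<close>,
  since \<open>s * (b - a) / 2 < pi / 2\<close> keeps the cosine above \<open>k > 0\<close>. This
  beats the growth because \<open>m < s\<close>; then \<open>e\<close> tends to 0.\<close>

lemma Phragmen_Lindelof_half_strip: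
  fixes Y :: "complex \<Rightarrow> complex"
  assumes hol: "Y holomorphic_on U" and U: "open U" "{z. x0 \<le> Re z \<and> a \<le> Im z \<and> Im z \<le> b} \<subseteq> U"
    and s: "0 < s" "s * (b - a) < pi" and m: "0 < m" "m < s" and B: "B > 0"
    and growth: "\<And>z. \<lbrakk>x0 \<le> Re z; a \<le> Im z; Im z \<le> b\<rbrakk> \<Longrightarrow> norm (Y z) \<le> exp (C * exp (m * Re z))"
    and bdry: "\<And>z. \<lbrakk>x0 \<le> Re z; a \<le> Im z; Im z \<le> b; Re z = x0 \<or> Im z = a \<or> Im z = b\<rbrakk> \<Longrightarrow> norm (Y z) \<le> B"
    and z: "x0 \<le> Re z" "a \<le> Im z" "Im z \<le> b"
  shows "norm (Y z) \<le> B"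
proof -
  define c where "c = (a + b) / 2"
  define k where "k = cos (s * (b - a) / 2)"
  have sab: "0 \<le> s * (b - a) / 2" "s * (b - a) / 2 < pi / 2" using s z by auto
  have k: "k > 0" unfolding k_def using sab by (intro cos_gt_zero_pi) auto
  have cosk: "k \<le> cos (s * (y - c))" if "a \<le> y" "y \<le> b" for y
  proof -
    have "\<bar>y - c\<bar> \<le> (b - a) / 2" using that by (auto simp: c_def abs_le_iff field_simps)
    hence "\<bar>s * (y - c)\<bar> \<le> s * (b - a) / 2" using s(1) by (simp add: abs_mult)
    hence "cos (s * (b - a) / 2) \<le> cos \<bar>s * (y - c)\<bar>"
      using sab by (intro cos_monotone_0_pi_le) auto
    thus ?thesis by (simp add: k_def)
  qed
  have key: "norm (Y z) * exp (- e * (exp (s * Re z) * cos (s * (Im z - c)))) \<le> B" if e: "e > 0" for e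
  proof -
    define G where "G = (\<lambda>w. Y w * exp (- of_real e * exp (of_real s * (w - \<i> * of_real c))))"
    have nG: "norm (G w) = norm (Y w) * exp (- e * (exp (s * Re w) * cos (s * (Im w - c))))" for w
      by (simp add: G_def norm_mult Re_exp)
    \<comment> \<open>\<open>N\<close> absorbs \<open>ln B\<close> when \<open>B < 1\<close>, so
      that on the far side \<open>Re w = X\<close> the product is at most \<open>B\<close> and not
      merely bounded.\<close>
    define N where "N = max 0 (- ln B)"
    have "eventually (\<lambda>x. e * k * exp ((s - m) * x) \<ge> \<bar>C\<bar> + N) at_top"
    proof -
      have "filterlim (\<lambda>x. (s - m) * x) at_top at_top"
        using m by (intro filterlim_tendsto_pos_mult_at_top[OF tendsto_const _ filterlim_ident]) auto
      hence "filterlim (\<lambda>x. exp ((s - m) * x)) at_top at_top"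
        by (rule filterlim_compose[OF exp_at_top])
      hence "filterlim (\<lambda>x. (e * k) * exp ((s - m) * x)) at_top at_top"
        by (rule filterlim_tendsto_pos_mult_at_top[OF tendsto_const mult_pos_pos[OF e k]])
      thus ?thesis by (simp add: filterlim_at_top)
    qed
    hence "eventually (\<lambda>x. e * k * exp ((s - m) * x) \<ge> \<bar>C\<bar> + N \<and> x > Re z \<and> x \<ge> 0) at_top"
      by (intro eventually_conj eventually_gt_at_top eventually_ge_at_top)
    from eventually_happens'[OF trivial_limit_at_top_linorder this]
    obtain X where X: "e * k * exp ((s - m) * X) \<ge> \<bar>C\<bar> + N" "X > Re z" "X \<ge> 0"
      by blast
    define S where "S = cbox (Complex x0 a) (Complex X b)"
    have SU: "S \<subseteq> U" using U(2) by (auto simp: S_def in_cbox_complex_iff)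
    have "norm (G z) \<le> B"
    proof (rule maximum_modulus_frontier[of G S])
      have holG: "G holomorphic_on S" unfolding G_def
        by (intro holomorphic_intros holomorphic_on_subset[OF hol SU])
      show "G holomorphic_on interior S"
        using holG interior_subset by (rule holomorphic_on_subset)
      show "continuous_on (closure S) G"
        using holomorphic_on_imp_continuous_on[OF holG] by (simp add: S_def)
      show "bounded S" by (simp add: S_def)
      show "z \<in> S" using z X by (simp add: S_def in_cbox_complex_iff)
      fix w assume "w \<in> frontier S"
      hence w: "x0 \<le> Re w" "a \<le> Im w" "Im w \<le> b" "Re w \<le> X"
          "Re w = x0 \<or> Im w = a \<or> Im w = b \<or> Re w = X"
        by (auto simp: S_def frontier_def in_cbox_complex_iff in_box_complex_iff)
      have pos: "0 \<le> e * (exp (s * Re w) * cos (s * (Im w - c)))"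
        using cosk[OF w(2,3)] k e by simp
      show "norm (G w) \<le> B"
      proof (cases "Re w = X")
        case False
        hence "norm (Y w) \<le> B" using bdry w by blast
        moreover have "exp (- e * (exp (s * Re w) * cos (s * (Im w - c)))) \<le> 1" using pos by simp
        ultimately show ?thesis unfolding nG using B
          by (metis mult.right_neutral mult_mono exp_ge_zero less_imp_le)
      next
        case True
        have "C * exp (m * X) - e * (exp (s * X) * cos (s * (Im w - c))) \<le> ln B"
        proof -
          have "C * exp (m * X) \<le> \<bar>C\<bar> * exp (m * X)" by (intro mult_right_mono) auto
          moreover have "e * (exp (s * X) * k) \<le> e * (exp (s * X) * cos (s * (Im w - c)))"
            using cosk[OF w(2,3)] e by simp
          moreover have "e * (exp (s * X) * k) = (e * k * exp ((s - m) * X)) * exp (m * X)"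
            by (simp add: exp_add[symmetric] algebra_simps)
          moreover have "(e * k * exp ((s - m) * X)) * exp (m * X) \<ge> (\<bar>C\<bar> + N) * exp (m * X)"
            using X(1) by (rule mult_right_mono) auto
          moreover have "N * 1 \<le> N * exp (m * X)"
            using m X(3) by (intro mult_left_mono) (auto simp: N_def)
          moreover have "- N \<le> ln B" by (simp add: N_def)
          ultimately show ?thesis unfolding distrib_right mult_1_right by linarith
        qed
        have "norm (G w) \<le> exp (C * exp (m * X)) * exp (- e * (exp (s * X) * cos (s * (Im w - c))))"
          unfolding nG using growth[OF w(1-3)] True by (intro mult_mono) auto
        also have "\<dots> = exp (C * exp (m * X) - e * (exp (s * X) * cos (s * (Im w - c))))"
          by (simp add: exp_diff exp_minus field_simps)
        also have "\<dots> \<le> exp (ln B)" using \<open>_ \<le> ln B\<close> by simp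
        finally show ?thesis using B by simp
      qed
    qed
    thus ?thesis by (simp add: nG)
  qed
  define D where "D = exp (s * Re z) * cos (s * (Im z - c))"
  have "((\<lambda>e. norm (Y z) * exp (- e * D)) \<longlongrightarrow> norm (Y z) * exp (- 0 * D)) (at_right 0)"
    by (intro tendsto_intros)
  moreover have "eventually (\<lambda>e. norm (Y z) * exp (- e * D) \<le> B) (at_right 0)"
    using key by (auto simp: D_def eventually_at_filter)
  ultimately have "norm (Y z) * exp (- 0 * D) \<le> B"
    by (rule tendsto_upperbound) simp
  thus ?thesis by simp
qed

text \<open>The barrier \<open>q\<close> is a multiple of the Poisson kernel of the upper half plane with pole \<open>t\<close>: it
  vanishes on the real axis and is at most 1 on the circle around \<open>t\<close>.\<close>

lemma Poisson_barrier_half_plane: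
  fixes G :: "complex \<Rightarrow> complex" and r R t d :: real
  defines "S \<equiv> {z. 0 \<le> Im z \<and> r \<le> norm z \<and> norm z \<le> R \<and> d \<le> norm (z - of_real t)}"
    and "q \<equiv> \<lambda>z. d * Im z / (norm (z - of_real t))\<^sup>2"
  assumes hol: "G holomorphic_on UNIV" and d: "d > 0" and L: "L \<ge> 0"
    and bound: "\<And>z. z \<in> S \<Longrightarrow> norm (G z) \<le> exp B"
    and small: "\<And>z. z \<in> S \<Longrightarrow> norm (z - of_real t) = d \<Longrightarrow> norm (G z) \<le> exp (B - L)"
    and m: "0 \<le> m" "\<And>z. z \<in> S \<Longrightarrow> norm z = r \<or> norm z = R \<Longrightarrow> q z \<le> m"
    and p: "p \<in> S"
  shows "norm (G p) \<le> exp (B + L * (m - q p))"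
proof -
  \<comment> \<open>\<open>L * q\<close> is the real part of a function holomorphic off
    \<open>t\<close>. Comparing the logarithm of \<open>norm (G z)\<close> with the barrier is
    therefore the maximum modulus principle for \<open>H\<close>, and zeros of \<open>G\<close> do
    no harm.\<close>
  define H where "H = (\<lambda>z. G z * exp (of_real (L * d) * \<i> / (z - of_real t)))"
  have nH: "norm (H z) = norm (G z) * exp (L * q z)" for z
  proof -
    have "Re (of_real (L * d) * \<i> / (z - of_real t)) = L * q z"
      by (simp add: q_def Re_divide cmod_power2)
    thus ?thesis unfolding H_def norm_mult norm_exp_eq_Re by simp
  qed
  have cS: "closed S" unfolding S_def by (intro closed_Collect_conj closed_Collect_le continuous_intros)
  have int: "{z. 0 < Im z \<and> r < norm z \<and> norm z < R \<and> d < norm (z - of_real t)} \<subseteq> interior S"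
    by (rule interior_maximal) (auto simp: S_def intro!: open_Collect_conj open_Collect_less continuous_intros)
  have "norm (H p) \<le> exp (B + L * m)"
  proof (rule maximum_modulus_frontier[of H S])
    have holH: "H holomorphic_on S" unfolding H_def
      by (intro holomorphic_intros holomorphic_on_subset[OF hol]) (use d in \<open>auto simp: S_def\<close>)
    show "H holomorphic_on interior S"
      using holH interior_subset by (rule holomorphic_on_subset)
    show "continuous_on (closure S) H"
      using holomorphic_on_imp_continuous_on[OF holH] cS by (simp add: closure_closed)
    show "bounded S" by (rule bounded_subset[of "cball 0 R"]) (auto simp: S_def)
    show "p \<in> S" by fact
    fix z assume z: "z \<in> frontier S"
    hence zS: "z \<in> S" and "z \<notin> interior S" using cS by (auto simp: frontier_def)
    hence "Im z = 0 \<or> norm z = r \<or> norm z = R \<or> norm (z - of_real t) = d"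
      using int by (force simp: S_def)
    then consider "norm (z - of_real t) = d" | "Im z = 0" | "norm z = r \<or> norm z = R" by blast
    thus "norm (H z) \<le> exp (B + L * m)"
    proof cases
      case 1
      have "Im z \<le> d" using 1 abs_Im_le_cmod[of "z - of_real t"] by simp
      hence "q z \<le> 1" using 1 d by (simp add: q_def power2_eq_square field_simps)
      hence "L * q z \<le> L" using L by (simp add: mult_left_le)
      have "norm (H z) \<le> exp (B - L) * exp (L * q z)"
        unfolding nH using small[OF zS 1] by (intro mult_right_mono) auto
      also have "\<dots> = exp (B - L + L * q z)" by (simp add: exp_add)
      also have "\<dots> \<le> exp (B + L * m)" using \<open>L * q z \<le> L\<close> L m(1) by (simp add: add_increasing2)
      finally show ?thesis .
    next
      case 2
      hence "norm (H z) \<le> exp B" unfolding nH using bound[OF zS] by (simp add: q_def)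
      also have "\<dots> \<le> exp (B + L * m)" using L m by simp
      finally show ?thesis .
    next
      case 3
      have "norm (H z) \<le> exp B * exp (L * q z)"
        unfolding nH using bound[OF zS] by (intro mult_right_mono) auto
      also have "\<dots> = exp (B + L * q z)" by (simp add: exp_add)
      also have "\<dots> \<le> exp (B + L * m)" using m(2)[OF zS 3] L by (simp add: mult_left_mono)
      finally show ?thesis .
    qed
  qed
  hence "norm (G p) * exp (L * q p) \<le> exp (B + L * m)" by (simp add: nH)
  hence "norm (G p) \<le> exp (B + L * m) / exp (L * q p)" by (simp add: field_simps)
  also have "\<dots> = exp (B + L * (m - q p))" by (simp add: exp_diff[symmetric] algebra_simps)
  finally show ?thesis .
qed

section \<open>Trigonometric sign patterns and limits of roots\<close>

lemma cos_minus_int_2pi: "cos (x - 2 * pi * of_int k) = cos x"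
  by (simp add: cos_diff)

text \<open>\<open>2 * pi * k\<close> is the multiple of \<open>2 * pi\<close> nearest to the
  midpoint. If an endpoint left the half period around it, the interval would contain points with
  negative cosine just beyond.\<close>

lemma cos_nonneg_interval:
  fixes l r :: real
  assumes lr: "l < r" and pos: "\<And>\<theta>. l < \<theta> \<Longrightarrow> \<theta> < r \<Longrightarrow> 0 \<le> cos \<theta>"
  obtains k :: int where "2 * pi * k - pi / 2 \<le> l" "r \<le> 2 * pi * k + pi / 2"
proof -
  define m where "m = (l + r) / 2"
  have m: "l < m" "m < r" using lr by (auto simp: m_def)
  define k where "k = \<lfloor>(m + pi) / (2 * pi)\<rfloor>"
  have "of_int k \<le> (m + pi) / (2 * pi)" "(m + pi) / (2 * pi) < of_int k + 1"
    unfolding k_def by linarith+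
  hence k: "2 * pi * k - pi \<le> m" "m < 2 * pi * k + pi"
    by (simp_all add: field_simps)
  have bad: False if "l < \<theta>" "\<theta> < r" "pi / 2 < \<bar>\<theta> - 2 * pi * k\<bar>" "\<bar>\<theta> - 2 * pi * k\<bar> < 3 * pi / 2" for \<theta>
  proof -
    have "cos \<bar>\<theta> - 2 * pi * k\<bar> < 0" using that by (intro cos_lt_zero_pi) auto
    hence "cos \<theta> < 0" by (simp add: cos_minus_int_2pi)
    thus False using pos[OF that(1,2)] by simp
  qed
  have mk: "\<bar>m - 2 * pi * k\<bar> \<le> pi / 2"
  proof (rule ccontr)
    assume *: "\<not> ?thesis"
    have "\<bar>m - 2 * pi * k\<bar> \<le> pi" using k unfolding abs_le_iff by linarith
    hence "\<bar>m - 2 * pi * k\<bar> < 3 * pi / 2" using pi_gt_zero by linarith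
    thus False using bad[of m] m * by linarith
  qed
  have "r \<le> 2 * pi * k + pi / 2"
  proof (rule ccontr)
    assume r: "\<not> ?thesis"
    \<comment> \<open>The cap at \<open>2 * pi * k + pi\<close> keeps \<open>\<theta>\<close> where
      \<open>bad\<close> applies, however long the interval is.\<close>
    define \<theta> where "\<theta> = min ((2 * pi * k + pi / 2 + r) / 2) (2 * pi * k + pi)"
    have "2 * pi * k + pi / 2 < \<theta>" "\<theta> < r" "\<theta> \<le> 2 * pi * k + pi"
      using r pi_gt_zero by (auto simp: \<theta>_def min_def)
    moreover from this have "\<bar>\<theta> - 2 * pi * k\<bar> = \<theta> - 2 * pi * k" using pi_gt_zero by linarith
    moreover have "m \<le> 2 * pi * k + pi / 2" using mk by linarith
    ultimately show False using bad[of \<theta>] m pi_gt_zero by linarith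
  qed
  moreover have "2 * pi * k - pi / 2 \<le> l"
  proof (rule ccontr)
    assume r: "\<not> ?thesis"
    define \<theta> where "\<theta> = max ((2 * pi * k - pi / 2 + l) / 2) (2 * pi * k - pi)"
    have "\<theta> < 2 * pi * k - pi / 2" "l < \<theta>" "2 * pi * k - pi \<le> \<theta>"
      using r pi_gt_zero by (auto simp: \<theta>_def max_def)
    moreover from this have "\<bar>\<theta> - 2 * pi * k\<bar> = - (\<theta> - 2 * pi * k)" using pi_gt_zero by linarith
    moreover have "m \<ge> 2 * pi * k - pi / 2" using mk by linarith
    ultimately show False using bad[of \<theta>] m pi_gt_zero by linarith
  qed
  ultimately show ?thesis using that by blast
qed

text \<open>Widths above \<open>pi\<close> on both sides force \<open>d = 2 * j\<close>, so each of
  the two intervals has at most \<open>2 * j + 1 = d + 1\<close> half periods of length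
  \<open>pi / d\<close>. A width above \<open>3 * pi / 2\<close> then leaves only
  \<open>d < 2\<close>, which no even \<open>d \<ge> 1\<close> satisfies.\<close>

lemma no_trigonometric_sign_pattern:
  fixes p0 q0 p1 q1 \<phi> :: real and d :: nat
  assumes d: "d \<ge> 1"
    and ord: "p0 < q1" "p1 + 2 * pi < q0"
    and wide: "q0 - p0 > pi" "q1 - p1 > pi" "max (q0 - p0) (q1 - p1) > 3 * pi / 2"
    and pos1: "\<And>y::real. p0 < y \<Longrightarrow> y < q1 \<Longrightarrow> 0 \<le> cos (d * y + \<phi>)"
    and pos2: "\<And>y::real. p1 + 2 * pi < y \<Longrightarrow> y < q0 \<Longrightarrow> 0 \<le> cos (d * y + \<phi>)"
  shows False
proof -
  have dd: "real d > 0" using d by simp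
  have interval: "\<exists>k::int. 2 * pi * k - pi / 2 \<le> d * l + \<phi> \<and> d * r + \<phi> \<le> 2 * pi * k + pi / 2"
    if lr: "l < r" and pos: "\<And>y::real. l < y \<Longrightarrow> y < r \<Longrightarrow> 0 \<le> cos (d * y + \<phi>)" for l r :: real
  proof -
    have "0 \<le> cos \<theta>" if "d * l + \<phi> < \<theta>" "\<theta> < d * r + \<phi>" for \<theta>
      using pos[of "(\<theta> - \<phi>) / real d"] that dd by (simp add: field_simps)
    thus ?thesis using cos_nonneg_interval[of "d * l + \<phi>" "d * r + \<phi>"] lr dd by fastforce
  qed
  obtain k :: int where k: "2 * pi * k - pi / 2 \<le> d * p0 + \<phi>" "d * q1 + \<phi> \<le> 2 * pi * k + pi / 2"
    using interval[OF ord(1) pos1] by blast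
  obtain l :: int where l: "2 * pi * l - pi / 2 \<le> d * (p1 + 2 * pi) + \<phi>" "d * q0 + \<phi> \<le> 2 * pi * l + pi / 2"
    using interval[OF ord(2) pos2] by blast
  \<comment> \<open>Between the half periods \<open>k\<close> and \<open>l\<close> there are \<open>2 * j - 1\<close> others on one side of the circle and
    \<open>2 * (d - j) - 1\<close> on the other side.\<close>
  define j where "j = l - k"
  have A: "d * (q0 - p0) \<le> pi * (2 * j + 1)"
    using k(1) l(2) by (simp add: j_def algebra_simps)
  have B: "d * (q1 - p1) \<le> pi * (2 * (int d - j) + 1)"
    using k(2) l(1) by (simp add: j_def algebra_simps)
  have cmp: "c * d < e" if "d * w \<le> pi * e" "w > c * pi" for w c e :: real
  proof -
    have "pi * (c * d) < d * w" using that(2) dd by (simp add: mult.commute)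
    hence "pi * (c * d) < pi * e" using that(1) by linarith
    thus ?thesis using pi_gt_zero by (simp add: mult_less_cancel_left_pos)
  qed
  have 1: "int d \<le> 2 * j" using cmp[of "q0 - p0" "2 * j + 1" 1] A wide(1) by simp
  have 2: "int d \<le> 2 * (int d - j)" using cmp[of "q1 - p1" "2 * (int d - j) + 1" 1] B wide(2) by simp
  have "2 * j \<le> int d" using 2 by simp
  with 1 have dj: "int d = 2 * j" by (rule antisym)
  have C: "2 * (int d - j) + 1 = 2 * j + 1" using dj by simp
  have "d * max (q0 - p0) (q1 - p1) \<le> pi * (2 * j + 1)"
    using A B unfolding C by (simp add: max_def)
  from cmp[OF this, of "3/2"] wide(3) have "3 / 2 * d < real_of_int (2 * j + 1)" by simp
  hence "d < 2" using dj by simp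
  thus False using dj d by presburger
qed

text \<open>The image of a strip under \<open>exp\<close> is a sector with the disc of radius \<open>exp (- 1)\<close> removed.\<close>

definition strip :: "real \<Rightarrow> real \<Rightarrow> complex set" where
  "strip p q = {z. - 1 < Re z \<and> p < Im z \<and> Im z < q}"

lemma strip_basic: "open (strip p q)" "convex (strip p q)" "connected (strip p q)"
proof -
  have eq: "strip p q = {z. Re z > -1} \<inter> {z. Im z > p} \<inter> {z. Im z < q}" by (auto simp: strip_def)
  show "open (strip p q)" unfolding eq by (intro open_Int open_halfspace_Re_gt open_halfspace_Im_gt open_halfspace_Im_lt)
  show "convex (strip p q)" unfolding eq by (intro convex_Int convex_halfspace_Re_gt convex_halfspace_Im_gt convex_halfspace_Im_lt)
  thus "connected (strip p q)" by (rule convex_connected)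
qed

text \<open>A logarithm exists on the convex zero-free set \<open>U\<close>, so the root can be
  taken as the holomorphic function \<open>exp (h / A n)\<close>. Its branches differ by unimodular
  constants, hence the conclusion is about moduli only. The margin 1 in \<open>x n > X + 1\<close>
  matches \<open>- 1 < Re z\<close> in \<open>strip\<close>.\<close>

lemma root_limit:
  fixes \<Phi> :: "complex \<Rightarrow> complex" and x A :: "nat \<Rightarrow> real"
  assumes pq: "p < q" and hol: "\<Phi> holomorphic_on UNIV"
    and nz: "\<And>z. \<lbrakk>Re z > X; p < Im z; Im z < q\<rbrakk> \<Longrightarrow> \<Phi> z \<noteq> 0"
    and x: "\<And>n. x n > X + 1" and A: "\<And>n. A n > 0"
    and bound: "\<And>K. \<lbrakk>compact K; K \<subseteq> strip p q\<rbrakk> \<Longrightarrow>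
       \<exists>B. \<forall>n. \<forall>z\<in>K. norm (\<Phi> (z + of_real (x n))) \<le> exp (A n * B)"
  obtains E r where "strict_mono (r :: nat \<Rightarrow> nat)" "E holomorphic_on strip p q"
    "(\<forall>z\<in>strip p q. E z = 0) \<or> (\<forall>z\<in>strip p q. E z \<noteq> 0)"
    "\<And>K. \<lbrakk>compact K; K \<subseteq> strip p q\<rbrakk> \<Longrightarrow>
       uniform_limit K (\<lambda>n z. norm (\<Phi> (z + of_real (x (r n)))) powr (1 / A (r n))) (\<lambda>z. norm (E z)) sequentially"
proof -
  define U where "U = {z. X < Re z} \<inter> {z. p < Im z} \<inter> {z. Im z < q}"
  have U: "open U" "convex U" unfolding U_def
    by (intro open_Int open_halfspace_Re_gt open_halfspace_Im_gt open_halfspace_Im_lt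
       convex_Int convex_halfspace_Re_gt convex_halfspace_Im_gt convex_halfspace_Im_lt)+
  have mem: "Complex (X + 1) ((p + q) / 2) \<in> U" using pq by (simp add: U_def)
  obtain h where h: "h holomorphic_on U" "\<And>z. z \<in> U \<Longrightarrow> exp (h z) = \<Phi> z"
    using holomorphic_logarithm_exists[OF U(2,1) holomorphic_on_subset[OF hol] _ mem] nz
    by (auto simp: U_def)
  define F where "F = (\<lambda>n z. exp (h (z + of_real (x n)) / of_real (A n)))"
  have sh: "z + of_real (x n) \<in> U" if "z \<in> strip p q" for z n
    using that x[of n] by (auto simp: U_def strip_def)
  have holF: "F n holomorphic_on strip p q" for n
  proof -
    have "(\<lambda>z. h (z + of_real (x n))) holomorphic_on strip p q"
      by (rule holomorphic_on_compose_gen[OF _ h(1), unfolded o_def]) (use sh in \<open>auto intro!: holomorphic_intros\<close>)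
    thus ?thesis unfolding F_def using A[of n] by (intro holomorphic_intros) auto
  qed
  have nF: "norm (F n z) = norm (\<Phi> (z + of_real (x n))) powr (1 / A n)" if "z \<in> strip p q" for n z
  proof -
    have "norm (\<Phi> (z + of_real (x n))) = exp (Re (h (z + of_real (x n))))"
      using h(2)[OF sh[OF that]] by (metis norm_exp_eq_Re)
    thus ?thesis by (simp add: F_def powr_def)
  qed
  define H where "H = range F"
  obtain E r where Er: "E holomorphic_on strip p q" "strict_mono (r :: nat \<Rightarrow> nat)"
     "\<And>K. \<lbrakk>compact K; K \<subseteq> strip p q\<rbrakk> \<Longrightarrow> uniform_limit K (F \<circ> r) E sequentially"
  proof (rule Montel[of "strip p q" H F])
    show "open (strip p q)" by (rule strip_basic)
    show "h holomorphic_on strip p q" if "h \<in> H" for h using that holF by (auto simp: H_def)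
    show "range F \<subseteq> H" by (simp add: H_def)
    fix K assume K: "compact K" "K \<subseteq> strip p q"
    obtain B where B: "\<And>n z. z \<in> K \<Longrightarrow> norm (\<Phi> (z + of_real (x n))) \<le> exp (A n * B)"
      using bound[OF K] by auto
    have "norm (F n z) \<le> exp B" if "z \<in> K" for n z
    proof -
      have "norm (F n z) \<le> exp (A n * B) powr (1 / A n)"
        unfolding nF[OF subsetD[OF K(2) that]] using B[OF that, of n] A[of n] by (intro powr_mono2) auto
      also have "\<dots> = exp B" using A[of n] by (simp add: powr_def)
      finally show ?thesis .
    qed
    thus "\<exists>B. \<forall>h\<in>H. \<forall>z\<in>K. norm (h z) \<le> B" by (auto simp: H_def)
  qed auto
  have "(\<forall>z\<in>strip p q. E z = 0) \<or> (\<forall>z\<in>strip p q. E z \<noteq> 0)"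
  proof (cases "E constant_on strip p q")
    case True thus ?thesis by (auto simp: constant_on_def)
  next
    case False
    have "E z \<noteq> 0" if "z \<in> strip p q" for z
    proof (rule Hurwitz_no_zeros[of "strip p q" "F \<circ> r" E z])
      show "(F \<circ> r) n holomorphic_on strip p q" for n using holF by simp
      show "(F \<circ> r) n z \<noteq> 0" for n z by (simp add: F_def)
      show "uniform_limit K (F \<circ> r) E sequentially" if "compact K" "K \<subseteq> strip p q" for K
        using Er(3)[OF that] .
    qed (use strip_basic Er(1) False that in auto)
    thus ?thesis by blast
  qed
  moreover have "uniform_limit K (\<lambda>n z. norm (\<Phi> (z + of_real (x (r n)))) powr (1 / A (r n))) (\<lambda>z. norm (E z)) sequentially"
    if K: "compact K" "K \<subseteq> strip p q" for K
  proof -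
    have "uniform_limit K (\<lambda>n z. norm ((F \<circ> r) n z)) (\<lambda>z. norm (E z)) sequentially"
      by (rule uniform_limit_norm[OF Er(3)[OF K]])
    thus ?thesis
    proof (rule uniform_limit_cong'[THEN iffD1, rotated -1])
      show "norm ((F \<circ> r) n z) = norm (\<Phi> (z + of_real (x (r n)))) powr (1 / A (r n))" if "z \<in> K" for n z
        using nF[of z "r n"] K that by auto
    qed auto
  qed
  ultimately show ?thesis using that Er by blast
qed

section \<open>Moments of zeros and 1-points\<close>

lemma entire_sum_imp_poly:
  fixes f :: "complex \<Rightarrow> complex"
  assumes "\<And>z. f z = (\<Sum>i\<le>n. a i * z ^ i)"
  shows "\<exists>p. f = poly p"
  by (rule exI[of _ "\<Sum>i\<le>n. monom (a i) i"]) (auto simp: assms poly_sum poly_monom)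

text \<open>Great Picard for \<open>f (inverse z)\<close> at 0 admits one exceptional value, and 0
  and 1 would be two. A finite or infinite limit of \<open>F\<close> at 0 has to be ruled out first:
  it would make \<open>f\<close> constant or a polynomial.\<close>

lemma finite_zeros_ones_imp_poly:
  fixes f :: "complex \<Rightarrow> complex"
  assumes hol: "f holomorphic_on UNIV" and fin: "finite {z. f z = 0}" "finite {z. f z = 1}"
  shows "\<exists>p. f = poly p"
proof (rule ccontr)
  assume np: "\<nexists>p. f = poly p"
  define F where "F = f \<circ> inverse"
  have holF: "F holomorphic_on UNIV - {0}"
    unfolding F_def by (intro holomorphic_on_compose_gen[OF _ hol] holomorphic_intros) auto
  have non1: "\<not> (F \<longlongrightarrow> l) (at 0)" for l
  proof
    assume "(F \<longlongrightarrow> l) (at 0)"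
    hence "(f \<longlongrightarrow> l) at_infinity" by (simp add: F_def lim_at_infinity_0)
    hence "f z = (\<Sum>i\<le>0. l * z ^ i)" for z using Liouville_weak[OF hol] by simp
    thus False using entire_sum_imp_poly[of f "\<lambda>_. l" 0] np by blast
  qed
  have non2: "\<not> ((inverse \<circ> F) \<longlongrightarrow> l) (at 0)" for l
  proof
    assume "((inverse \<circ> F) \<longlongrightarrow> l) (at 0)"
    hence "((inverse \<circ> f) \<longlongrightarrow> l) at_infinity" by (simp add: F_def lim_at_infinity_0 o_assoc)
    then obtain a n where "\<And>z. f z = (\<Sum>i\<le>n. a i * z ^ i)" using pole_at_infinity[OF hol] by metis
    thus False using entire_sum_imp_poly[of f a n] np by blast
  qed
  obtain a where a: "\<And>w. w \<noteq> a \<Longrightarrow> infinite {x. x \<in> UNIV - {0} \<and> F x = w}"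
    using great_Picard_infinite[OF open_UNIV UNIV_I holF non1 non2] by metis
  have "finite {x. x \<in> UNIV - {0} \<and> F x = w}" if "finite {z. f z = w}" for w
    by (rule finite_subset[of _ "inverse ` {z. f z = w}"]) (use that in \<open>auto simp: F_def image_iff intro!: exI[of _ "inverse _"]\<close>)
  hence "finite {x. x \<in> UNIV - {0} \<and> F x = 0}" "finite {x. x \<in> UNIV - {0} \<and> F x = 1}"
    using fin by auto
  thus False using a[of 0] a[of 1] by (cases "a = 0") auto
qed

text \<open>The argument principle with weight \<open>z\<close>: unlike the number of zeros, their
  first moment depends on the directions in which they lie.\<close>

lemma zero_moment:
  fixes f :: "complex \<Rightarrow> complex"
  assumes hol: "f holomorphic_on UNIV" and R: "R > 0" and nz: "\<And>z. norm z = R \<Longrightarrow> f z \<noteq> 0"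
  shows "finite {z. norm z < R \<and> f z = 0}"
    and "contour_integral (circlepath 0 R) (\<lambda>z. deriv f z * z / f z) =
           2 * pi * \<i> * (\<Sum>z | norm z < R \<and> f z = 0. z * of_int (zorder f z))"
proof -
  have nc: "\<exists>w. f w \<noteq> 0" using nz[of "of_real R"] R by (intro exI[of _ "of_real R"]) simp
  have fin: "finite {z\<in>cball 0 (R + 1). f z = 0}"
  proof (cases "f constant_on UNIV")
    case True
    hence "{z\<in>cball 0 (R + 1). f z = 0} = {}" using nc by (auto simp: constant_on_def)
    thus ?thesis by (metis finite.emptyI)
  next
    case False
    thus ?thesis by (intro holomorphic_compact_finite_zeros[OF hol]) auto
  qed
  show "finite {z. norm z < R \<and> f z = 0}" by (rule finite_subset[OF _ fin]) auto
  \<comment> \<open>The argument principle is applied in the larger open disc of radius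
    \<open>R + 1\<close>; zeros outside the circle have winding number 0 and drop out of the
    sum.\<close>
  define P where "P = {w \<in> ball 0 (R + 1). f w = 0 \<or> w \<in> {}}"
  have finP: "finite P" by (rule finite_subset[OF _ fin]) (auto simp: P_def)
  have wn0: "winding_number (circlepath 0 R) z = 0" if "norm z > R" for z
    by (rule winding_number_zero_outside[where s = "cball 0 R"]) (use that R in auto)
  have "contour_integral (circlepath 0 R) (\<lambda>z. deriv f z * z / f z) =
      2 * pi * \<i> * (\<Sum>p\<in>P. winding_number (circlepath 0 R) p * p * zorder f p)"
    unfolding P_def
  proof (rule argument_principle)
    show "f holomorphic_on ball 0 (R + 1) - {}" by (rule holomorphic_on_subset[OF hol]) auto
    show "valid_path (circlepath 0 R)" by simp
    show "pathfinish (circlepath 0 R) = pathstart (circlepath 0 R)" by simp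
    show "finite {w \<in> ball 0 (R + 1). f w = 0 \<or> w \<in> {}}" using finP by (simp add: P_def)
    show "path_image (circlepath 0 R) \<subseteq> ball 0 (R + 1) - {w \<in> ball 0 (R + 1). f w = 0 \<or> w \<in> {}}"
      using R nz by (auto simp: sphere_def)
    show "\<forall>z. z \<notin> ball 0 (R + 1) \<longrightarrow> winding_number (circlepath 0 R) z = 0"
      using wn0 by auto
  qed auto
  also have "(\<Sum>p\<in>P. winding_number (circlepath 0 R) p * p * zorder f p) =
      (\<Sum>z | norm z < R \<and> f z = 0. z * of_int (zorder f z))"
  proof (rule sum.mono_neutral_cong_right[OF finP])
    show "{z. norm z < R \<and> f z = 0} \<subseteq> P" by (auto simp: P_def)
    show "\<forall>i\<in>P - {z. norm z < R \<and> f z = 0}. winding_number (circlepath 0 R) i * i * zorder f i = 0"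
    proof
      fix i assume i: "i \<in> P - {z. norm z < R \<and> f z = 0}"
      hence "norm i > R" using nz by (force simp: P_def)
      thus "winding_number (circlepath 0 R) i * i * zorder f i = 0" by (simp add: wn0)
    qed
    show "winding_number (circlepath 0 R) x * x * zorder f x = x * of_int (zorder f x)"
      if "x \<in> {z. norm z < R \<and> f z = 0}" for x
      using that by (simp add: winding_number_circlepath)
  qed
  finally show "contour_integral (circlepath 0 R) (\<lambda>z. deriv f z * z / f z) =
           2 * pi * \<i> * (\<Sum>z | norm z < R \<and> f z = 0. z * of_int (zorder f z))" .
qed

text \<open>A lower bound of order \<open>R\<close> for \<open>norm (f z)\<close> gives
  \<open>norm (L z) \<le> 2 / (R + 2)\<close>, which compensates the length
  \<open>2 * pi * R\<close> of the circle. The integral is then at most \<open>4 * pi\<close>, and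
  division by \<open>2 * pi\<close> leaves 2, independently of \<open>R\<close>.\<close>

lemma moment_difference_bound:
  fixes f :: "complex \<Rightarrow> complex"
  assumes hol: "f holomorphic_on UNIV" and R: "R > 0" and big: "\<And>z. norm z = R \<Longrightarrow> norm (f z) \<ge> R + 2"
  shows "norm ((\<Sum>z | norm z < R \<and> f z = 0. z * of_int (zorder f z)) -
               (\<Sum>z | norm z < R \<and> f z = 1. z * of_int (zorder (\<lambda>w. f w - 1) z))) \<le> 2"
proof -
  define s0 s1 where "s0 = (\<Sum>z | norm z < R \<and> f z = 0. z * of_int (zorder f z))"
    and "s1 = (\<Sum>z | norm z < R \<and> f z = 1. z * of_int (zorder (\<lambda>w. f w - 1) z))"
  have nz0: "f z \<noteq> 0" and nz1: "f z - 1 \<noteq> 0" if "norm z = R" for z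
    using big[OF that] R by auto
  have hol1: "(\<lambda>w. f w - 1) holomorphic_on UNIV" by (intro holomorphic_intros hol)
  have df: "(f has_field_derivative deriv f z) (at z)" for z
    using holomorphic_derivI[OF hol] by simp
  have d1: "deriv (\<lambda>w. f w - 1) z = deriv f z" for z
    by (intro DERIV_imp_deriv) (auto intro!: derivative_eq_intros df)
  have I0: "contour_integral (circlepath 0 R) (\<lambda>z. deriv f z * z / f z) = 2 * pi * \<i> * s0"
    using zero_moment(2)[OF hol R nz0] by (simp add: s0_def)
  have I1: "contour_integral (circlepath 0 R) (\<lambda>z. deriv f z * z / (f z - 1)) = 2 * pi * \<i> * s1"
    using zero_moment(2)[OF hol1 R nz1] by (simp add: s1_def d1)
  have cont: "continuous_on (sphere 0 R) f" "continuous_on (sphere 0 R) (deriv f)"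
    using holomorphic_on_imp_continuous_on[OF hol] holomorphic_on_imp_continuous_on[OF holomorphic_deriv[OF hol open_UNIV]]
    by (auto intro: continuous_on_subset)
  have int: "(\<lambda>z. deriv f z * z / f z) contour_integrable_on circlepath 0 R"
    "(\<lambda>z. deriv f z * z / (f z - 1)) contour_integrable_on circlepath 0 R"
    using R nz0 nz1 by (auto intro!: contour_integrable_continuous_circlepath continuous_intros cont)
  \<comment> \<open>By parts: \<open>L\<close> is a primitive of \<open>f' / (f - 1) - f' / f\<close>, and it is small on the circle.\<close>
  define L where "L = (\<lambda>z. Ln (1 + (- 1 / f z)))"
  have small: "norm (- 1 / f z) \<le> 1 / (R + 2)" "norm (- 1 / f z) < 1/2" if "norm z = R" for z
  proof -
    show 1: "norm (- 1 / f z) \<le> 1 / (R + 2)"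
      using big[OF that] R by (auto simp: norm_divide intro!: divide_left_mono mult_pos_pos)
    have "1 / (R + 2) < 1/2" using R by simp
    with 1 show "norm (- 1 / f z) < 1/2" by linarith
  qed
  have dL: "((\<lambda>z. z * L z) has_field_derivative L z + (deriv f z * z / (f z - 1) - deriv f z * z / f z)) (at z)"
    if "norm z = R" for z
  proof -
    have "Re (1 + (- 1 / f z)) > 0"
      using small(2)[OF that] abs_Re_le_cmod[of "- 1 / f z"] by simp
    hence "1 + (- 1 / f z) \<notin> \<real>\<^sub>\<le>\<^sub>0" by (auto simp: complex_nonpos_Reals_iff)
    hence "(L has_field_derivative inverse (1 + (- 1 / f z)) * (deriv f z / (f z)^2)) (at z)"
      unfolding L_def using nz0[OF that]
      by (auto intro!: derivative_eq_intros df simp: field_simps power2_eq_square)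
    also have "inverse (1 + (- 1 / f z)) * (deriv f z / (f z)^2) = deriv f z / (f z - 1) - deriv f z / f z"
    proof -
      have "1 + (- 1 / f z) = (f z - 1) / f z" using nz0[OF that] by (simp add: field_simps)
      thus ?thesis using nz0[OF that] nz1[OF that]
        by (simp add: power2_eq_square divide_simps) (simp add: algebra_simps)
    qed
    finally have "((\<lambda>z. z * L z) has_field_derivative 1 * L z + (deriv f z / (f z - 1) - deriv f z / f z) * z) (at z)"
      by (intro DERIV_mult' [THEN DERIV_cong] DERIV_ident) (auto simp: algebra_simps)
    thus ?thesis by (simp add: algebra_simps)
  qed
  have i1: "((\<lambda>z. L z + (deriv f z * z / (f z - 1) - deriv f z * z / f z)) has_contour_integral 0) (circlepath 0 R)"
    by (rule Cauchy_theorem_primitive[where S = "sphere 0 R" and f = "\<lambda>z. z * L z"])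
       (auto intro!: has_field_derivative_at_within dL simp: less_imp_le[OF R])
  have i2: "((\<lambda>z. deriv f z * z / (f z - 1) - deriv f z * z / f z) has_contour_integral (2 * pi * \<i> * s1 - 2 * pi * \<i> * s0)) (circlepath 0 R)"
    using has_contour_integral_diff[OF has_contour_integral_integral[OF int(2)] has_contour_integral_integral[OF int(1)]]
    unfolding I0 I1 .
  from has_contour_integral_diff[OF i1 i2]
  have "((\<lambda>z. L z) has_contour_integral (0 - (2 * pi * \<i> * s1 - 2 * pi * \<i> * s0))) (circlepath 0 R)"
    by simp
  hence "norm (0 - (2 * pi * \<i> * s1 - 2 * pi * \<i> * s0)) \<le> 2 * (1 / (R + 2)) * (2 * pi * R)"
  proof (rule has_contour_integral_bound_circlepath)
    show "norm (L z) \<le> 2 * (1 / (R + 2))" if "norm (z - 0) = R" for z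
      using norm_Ln_le[OF small(2)[of z]] small(1)[of z] that unfolding L_def by simp
  qed (use R in auto)
  also have "\<dots> \<le> 4 * pi" using R by (simp add: field_simps)
  also have "0 - (2 * pi * \<i> * s1 - 2 * pi * \<i> * s0) = 2 * pi * \<i> * (s0 - s1)" by (simp add: algebra_simps)
  finally have "2 * pi * norm (s0 - s1) \<le> 4 * pi" by (simp add: norm_mult)
  thus ?thesis by (simp add: s0_def s1_def)
qed

text \<open>Paired with \<open>w\<close>, zeros in \<open>S0\<close> and 1-points in
  \<open>S1\<close> contribute to the difference of the moments with the same sign, so a bound for
  the difference bounds every single term. The bound \<open>D\<close> does not depend on
  \<open>R\<close>; hence all but finitely many of these points lie in one fixed disc.\<close>

lemma separated_moments_imp_finite:
  fixes f :: "complex \<Rightarrow> complex"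
  assumes hol: "f holomorphic_on UNIV"
    and fin: "finite {z. f z = 0 \<and> z \<notin> S0}" "finite {z. f z = 1 \<and> z \<notin> S1}"
    and c: "c > 0" and S0: "\<And>z. z \<in> S0 \<Longrightarrow> Re (z * w) \<ge> c * norm z"
    and S1: "\<And>z. z \<in> S1 \<Longrightarrow> Re (z * w) \<le> - c * norm z"
    and big: "\<And>N. \<exists>R\<ge>N. \<forall>z. norm z = R \<longrightarrow> norm (f z) \<ge> R + 2"
  shows "finite {z. f z = 0}" "finite {z. f z = 1}"
proof -
  define g where "g = (\<lambda>z. f z - 1)"
  have holg: "g holomorphic_on UNIV" unfolding g_def by (intro holomorphic_intros hol)
  define X0 X1 where "X0 = {z. f z = 0 \<and> z \<notin> S0}" and "X1 = {z. f z = 1 \<and> z \<notin> S1}"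
  have finX: "finite X0" "finite X1" using fin by (auto simp: X0_def X1_def)
  define C where "C = (\<Sum>z\<in>X0. \<bar>Re (z * w) * zorder f z\<bar>) + (\<Sum>z\<in>X1. \<bar>Re (z * w) * zorder g z\<bar>)"
  define D where "D = (2 * norm w + C) / c"
  have nc: "\<exists>z. f z \<noteq> 0" "\<exists>z. g z \<noteq> 0"
  proof -
    obtain R where R: "R \<ge> 1" "\<forall>z. norm z = R \<longrightarrow> norm (f z) \<ge> R + 2" using big by blast
    hence "norm (f (of_real R)) \<ge> R + 2" by auto
    hence "f (of_real R) \<noteq> 0" "g (of_real R) \<noteq> 0" using R(1) by (auto simp: g_def)
    thus "\<exists>z. f z \<noteq> 0" "\<exists>z. g z \<noteq> 0" by blast+
  qed
  have ord: "zorder h z \<ge> 1" if "h holomorphic_on UNIV" "\<exists>z. h z \<noteq> 0" "h z = 0" for h z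
    using zorder_exist_zero[OF that(1) open_UNIV connected_UNIV UNIV_I, of z] that(2,3) by simp
  have nz: "f z \<noteq> 0" "g z \<noteq> 0" if "R > 0" "\<And>z. norm z = R \<Longrightarrow> norm (f z) \<ge> R + 2" "norm z = R" for R z
    using that(1) that(2)[OF that(3)] by (auto simp: g_def)
  have main: "norm a \<le> D" if a: "(f a = 0 \<and> a \<in> S0) \<or> (f a = 1 \<and> a \<in> S1)" for a
  proof -
    obtain R where R: "R \<ge> norm a + 1" and bR: "\<And>z. norm z = R \<Longrightarrow> norm (f z) \<ge> R + 2"
      using big[of "norm a + 1"] by blast
    have R0: "R > 0" using R norm_ge_zero[of a] by linarith
    define Z where "Z = {z. norm z < R \<and> f z = 0}"
    define Q where "Q = {z. norm z < R \<and> f z = 1}"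
    have Q': "Q = {z. norm z < R \<and> g z = 0}" by (auto simp: Q_def g_def)
    have fz: "finite Z" unfolding Z_def
      by (rule zero_moment(1)[OF hol R0 nz(1)[OF R0 bR]])
    have fq: "finite Q" unfolding Q'
      by (rule zero_moment(1)[OF holg R0 nz(2)[OF R0 bR]])
    define s where "s = (\<Sum>z\<in>Z. z * of_int (zorder f z)) - (\<Sum>z\<in>Q. z * of_int (zorder g z))"
    have "norm s \<le> 2" using moment_difference_bound[OF hol R0 bR] by (simp add: s_def Z_def Q_def g_def[abs_def])
    hence "norm s * norm w \<le> 2 * norm w" by (rule mult_right_mono) simp
    hence "Re (s * w) \<le> 2 * norm w"
      using complex_Re_le_cmod[of "s * w"] by (simp add: norm_mult)
    also have "Re (s * w) = (\<Sum>z\<in>Z. Re (z * w) * zorder f z) + (\<Sum>z\<in>Q. - Re (z * w) * zorder g z)"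
    proof -
      have sw: "s * w = (\<Sum>z\<in>Z. z * w * of_real (zorder f z)) - (\<Sum>z\<in>Q. z * w * of_real (zorder g z))"
        by (simp add: s_def left_diff_distrib sum_distrib_right mult.assoc) (simp add: mult_ac)
      have Re: "Re (z * of_real y) = Re z * y" for z y by simp
      show ?thesis unfolding sw minus_complex.sel Re_sum Re by (simp add: sum_negf del: times_complex.sel)
    qed
    finally have le: "(\<Sum>z\<in>Z. Re (z * w) * zorder f z) + (\<Sum>z\<in>Q. - Re (z * w) * zorder g z) \<le> 2 * norm w" .
    have term0: "Re (z * w) * zorder f z \<ge> c * norm z" if "z \<in> Z" "z \<in> S0" for z
    proof -
      have "1 \<le> zorder f z" using ord[OF hol nc(1)] that by (simp add: Z_def)
      hence "1 \<le> real_of_int (zorder f z)" by simp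
      moreover have nn: "0 \<le> Re (z * w)" using S0[OF that(2)] c by (meson mult_nonneg_nonneg less_imp_le norm_ge_zero order_trans)
      ultimately have "Re (z * w) * 1 \<le> Re (z * w) * zorder f z" by (intro mult_left_mono)
      thus ?thesis using S0[OF that(2)] by linarith
    qed
    have term1: "- Re (z * w) * zorder g z \<ge> c * norm z" if "z \<in> Q" "z \<in> S1" for z
    proof -
      have "1 \<le> zorder g z" using ord[OF holg nc(2)] that by (simp add: Q')
      hence "1 \<le> real_of_int (zorder g z)" by simp
      moreover have le: "c * norm z \<le> - Re (z * w)" using S1[OF that(2)] by simp
      moreover have nn: "0 \<le> - Re (z * w)" using le c by (meson mult_nonneg_nonneg less_imp_le norm_ge_zero order_trans)
      ultimately have "- Re (z * w) * 1 \<le> - Re (z * w) * zorder g z" by (intro mult_left_mono)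
      thus ?thesis using le by linarith
    qed
    \<comment> \<open>The exceptional points in \<open>X\<close> cost at most a constant; of the
      remaining nonnegative terms only that of \<open>a\<close> is kept.\<close>
    have low: "(\<Sum>z\<in>T. h z) \<ge> - (\<Sum>z\<in>X. \<bar>h z\<bar>) + (if a \<in> T - X then c * norm a else 0)"
      if "finite T" "finite X" "\<And>z. z \<in> T - X \<Longrightarrow> h z \<ge> c * norm z" for T X and h :: "complex \<Rightarrow> real"
    proof -
      have nn: "0 \<le> h z" if "z \<in> T - X" for z
        using \<open>\<And>z. z \<in> T - X \<Longrightarrow> h z \<ge> c * norm z\<close>[OF that] c by (meson mult_nonneg_nonneg less_imp_le norm_ge_zero order_trans)
      have "(\<Sum>z\<in>T. h z) = (\<Sum>z\<in>T - X. h z) + (\<Sum>z\<in>T \<inter> X. h z)"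
        using that(1) by (metis add.commute sum.Int_Diff)
      moreover have "(\<Sum>z\<in>T \<inter> X. h z) \<ge> - (\<Sum>z\<in>X. \<bar>h z\<bar>)"
      proof -
        have "- (\<Sum>z\<in>T \<inter> X. h z) \<le> (\<Sum>z\<in>T \<inter> X. \<bar>h z\<bar>)"
          unfolding sum_negf[symmetric] by (intro sum_mono) auto
        also have "\<dots> \<le> (\<Sum>z\<in>X. \<bar>h z\<bar>)" using that(2) by (intro sum_mono2) auto
        finally show ?thesis by linarith
      qed
      moreover have "(\<Sum>z\<in>T - X. h z) \<ge> (if a \<in> T - X then c * norm a else 0)"
      proof (cases "a \<in> T - X")
        case True
        have "c * norm a \<le> h a" using that(3)[OF True] .
        also have "\<dots> \<le> (\<Sum>z\<in>T - X. h z)" using that(1) nn True by (intro member_le_sum) auto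
        finally show ?thesis using True by simp
      qed (use nn in \<open>auto intro: sum_nonneg\<close>)
      ultimately show ?thesis by linarith
    qed
    have l0: "(\<Sum>z\<in>Z. Re (z * w) * zorder f z) \<ge>
       - (\<Sum>z\<in>X0. \<bar>Re (z * w) * zorder f z\<bar>) + (if a \<in> Z - X0 then c * norm a else 0)"
      by (rule low[OF fz finX(1)]) (use term0 in \<open>auto simp: X0_def Z_def\<close>)
    have l1: "(\<Sum>z\<in>Q. - Re (z * w) * zorder g z) \<ge>
       - (\<Sum>z\<in>X1. \<bar>- Re (z * w) * zorder g z\<bar>) + (if a \<in> Q - X1 then c * norm a else 0)"
      by (rule low[OF fq finX(2)]) (use term1 in \<open>auto simp: X1_def Q_def\<close>)
    have "a \<in> Z - X0 \<or> a \<in> Q - X1" using a R by (auto simp: Z_def Q_def X0_def X1_def)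
    moreover have "0 \<le> c * norm a" using c by simp
    ultimately have "c * norm a \<le> (if a \<in> Z - X0 then c * norm a else 0) + (if a \<in> Q - X1 then c * norm a else 0)"
      by auto
    moreover have "(\<Sum>z\<in>X1. \<bar>- Re (z * w) * zorder g z\<bar>) = (\<Sum>z\<in>X1. \<bar>Re (z * w) * zorder g z\<bar>)"
      by (simp only: mult_minus_left abs_minus_cancel)
    ultimately have "c * norm a \<le> 2 * norm w + C"
      using le l0 l1 unfolding C_def by linarith
    thus ?thesis using c by (simp add: D_def field_simps)
  qed
  obtain R where R: "R \<ge> max 1 (D + 1)" and bR: "\<And>z. norm z = R \<Longrightarrow> norm (f z) \<ge> R + 2"
    using big by blast
  have R0: "R > 0" using R by simp
  have "finite {z. norm z < R \<and> f z = 0}"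
    by (rule zero_moment(1)[OF hol R0 nz(1)[OF R0 bR]])
  moreover have "{z. f z = 0} \<subseteq> {z. norm z < R \<and> f z = 0} \<union> X0"
    using main R by (force simp: X0_def)
  ultimately show "finite {z. f z = 0}" using finX(1) by (meson finite_UnI finite_subset)
  have "finite {z. norm z < R \<and> g z = 0}"
    by (rule zero_moment(1)[OF holg R0 nz(2)[OF R0 bR]])
  moreover have "{z. f z = 1} \<subseteq> {z. norm z < R \<and> g z = 0} \<union> X1"
    using main R by (force simp: X1_def g_def)
  ultimately show "finite {z. f z = 1}" using finX(2) by (meson finite_UnI finite_subset)
qed

section \<open>Growth faster than every power\<close>

text \<open>By Cauchy's estimates, \<open>M r < r ^ N\<close> for arbitrarily large \<open>r\<close>
  would kill all Taylor coefficients beyond \<open>N\<close>.\<close>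

lemma transcendental_growth:
  fixes f :: "complex \<Rightarrow> complex"
  assumes hol: "f holomorphic_on UNIV" and np: "\<nexists>p. f = poly p"
    and M: "\<And>z. norm (f z) \<le> M (norm z)"
  shows "eventually (\<lambda>r. r ^ N \<le> M r) at_top"
proof (rule ccontr)
  assume "\<not> ?thesis"
  hence fr: "\<exists>\<^sub>F r in at_top. M r < r ^ N" by (simp add: frequently_def not_less)
  have z: "(deriv ^^ n) f 0 = 0" if n: "n > N" for n
  proof (rule ccontr)
    assume d: "(deriv ^^ n) f 0 \<noteq> 0"
    define e where "e = norm ((deriv ^^ n) f 0)"
    have e: "e > 0" using d by (simp add: e_def)
    have "eventually (\<lambda>r::real. r > max 1 (fact n / e)) at_top" by (rule eventually_gt_at_top)
    from frequently_eventually_frequently[OF fr this]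
    obtain r where r: "M r < r ^ N" "r > 1" "r > fact n / e" by (auto dest: frequently_ex)
    have "e \<le> fact n * r ^ N / r ^ n" unfolding e_def
    proof (rule Cauchy_inequality)
      show "f holomorphic_on ball 0 r" "continuous_on (cball 0 r) f"
        using hol holomorphic_on_subset holomorphic_on_imp_continuous_on continuous_on_subset by blast+
      show "norm (f x) \<le> r ^ N" if "norm (0 - x) = r" for x
        using M[of x] that r by simp
    qed (use r in auto)
    also have "\<dots> = fact n / r ^ (n - N)" using n r by (simp add: power_diff)
    also have "\<dots> \<le> fact n / r ^ 1" using n r by (intro divide_left_mono power_increasing mult_pos_pos) auto
    also have "\<dots> < e" using r(2,3) e by (simp add: field_simps)
    finally show False by simp
  qed
  have "f w = (\<Sum>i\<le>N. ((deriv ^^ i) f 0 / fact i) * w ^ i)" for w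
  proof -
    have "((\<lambda>n. (deriv ^^ n) f 0 / fact n * (w - 0) ^ n) sums f w)"
      by (rule holomorphic_power_series[of f 0 "norm w + 1"]) (use hol in \<open>auto intro: holomorphic_on_subset\<close>)
    moreover have "(\<lambda>n. (deriv ^^ n) f 0 / fact n * (w - 0) ^ n) sums (\<Sum>n\<le>N. (deriv ^^ n) f 0 / fact n * (w - 0) ^ n)"
      by (rule sums_finite) (use z in auto)
    ultimately show ?thesis using sums_unique2 by fastforce
  qed
  hence "\<exists>p. f = poly p" by (rule entire_sum_imp_poly)
  thus False using np by blast
qed

section \<open>Gluing in the transition sectors\<close>

lemma constant_norm_imp_constant_on:
  assumes "g holomorphic_on S" "open S" "connected S" "\<And>z. z \<in> S \<Longrightarrow> norm (g z) = c"
  shows "g constant_on S"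
proof (cases "S = {}")
  case True thus ?thesis by (simp add: constant_on_def)
next
  case False
  then obtain w where "w \<in> S" by blast
  thus ?thesis using maximum_modulus_principle[of g S S w] assms by auto
qed

section \<open>Control of the real part through the derivative\<close>

lemma Re_has_vertical_derivative:
  assumes "(U has_field_derivative D) (at (Complex x y))"
  shows "((\<lambda>y. Re (U (Complex x y))) has_real_derivative - Im D) (at y)"
proof -
  have eq: "Complex x t = of_real x + \<i> * of_real t" for t by (simp add: complex_eq_iff)
  have "((\<lambda>t. of_real x + \<i> * of_real t) has_vector_derivative \<i>) (at y)"
    by (auto intro!: derivative_eq_intros)
  hence "((U \<circ> (\<lambda>t. of_real x + \<i> * of_real t)) has_vector_derivative (\<i> * D)) (at y)"
    using assms unfolding eq by (rule field_vector_diff_chain_at)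
  hence "((\<lambda>t. Re ((U \<circ> (\<lambda>t. of_real x + \<i> * of_real t)) t)) has_vector_derivative Re (\<i> * D)) (at y)"
    by (rule bounded_linear.has_vector_derivative[OF bounded_linear_Re])
  thus ?thesis by (simp add: has_real_derivative_iff_has_vector_derivative eq o_def)
qed

lemma Re_has_horizontal_derivative:
  assumes "(U has_field_derivative D) (at (Complex x y))"
  shows "((\<lambda>x. Re (U (Complex x y))) has_real_derivative Re D) (at x)"
proof -
  have eq: "Complex t y = of_real t + \<i> * of_real y" for t by (simp add: complex_eq_iff)
  have "((\<lambda>t. of_real t + \<i> * of_real y) has_vector_derivative 1) (at x)"
    by (auto intro!: derivative_eq_intros)
  hence "((U \<circ> (\<lambda>t. of_real t + \<i> * of_real y)) has_vector_derivative (1 * D)) (at x)"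
    using assms unfolding eq by (rule field_vector_diff_chain_at)
  hence "((\<lambda>t. Re ((U \<circ> (\<lambda>t. of_real t + \<i> * of_real y)) t)) has_vector_derivative Re (1 * D)) (at x)"
    by (rule bounded_linear.has_vector_derivative[OF bounded_linear_Re])
  thus ?thesis by (simp add: has_real_derivative_iff_has_vector_derivative eq o_def)
qed

lemma vertical_oscillation:
  assumes "\<And>y. y \<in> I \<Longrightarrow> (U has_field_derivative D y) (at (Complex x y))"
    and "convex I" and "\<And>y. y \<in> I \<Longrightarrow> \<bar>Im (D y) - c\<bar> \<le> e" and "y \<in> I" "y' \<in> I"
  shows "\<bar>Re (U (Complex x y)) - Re (U (Complex x y')) + c * (y - y')\<bar> \<le> e * \<bar>y - y'\<bar>"
proof -
  have "norm ((\<lambda>t. Re (U (Complex x t)) + c * t) y - (\<lambda>t. Re (U (Complex x t)) + c * t) y') \<le> e * norm (y - y')"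
  proof (rule field_differentiable_bound[of I _ "\<lambda>t. - Im (D t) + c"])
    show "((\<lambda>t. Re (U (Complex x t)) + c * t) has_real_derivative - Im (D t) + c) (at t within I)" if "t \<in> I" for t
      by (rule DERIV_add[OF has_field_derivative_at_within[OF Re_has_vertical_derivative[OF assms(1)[OF that]]]])
        (auto intro!: derivative_eq_intros)
    show "norm (- Im (D t) + c) \<le> e" if "t \<in> I" for t using assms(3)[OF that] by (simp add: abs_minus_commute)
  qed (use assms in auto)
  thus ?thesis by (simp add: algebra_simps)
qed

text \<open>An upper bound on the whole strip and a lower bound on one horizontal line suffice.
  Subtracting \<open>b\<close> makes \<open>V\<close> nonpositive on a translate of the box
  \<open>W\<close>, and Harnack's inequality spreads the value on the line over a vertical segment.
  The constant is independent of \<open>x\<close> because all boxes are translates of one.\<close>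

lemma strip_log_derivative_bound:
  fixes V :: "complex \<Rightarrow> complex"
  assumes hol: "V holomorphic_on strip p q"
    and up: "\<And>z. z \<in> strip p q \<Longrightarrow> Re (V z) \<le> 2 * exp (\<nu> * max 0 (Re z))" and \<nu>: "\<nu> > 0"
    and a: "p < a" "a < q" and x0: "x0 \<ge> 0"
    and lo: "\<And>x. x \<ge> x0 \<Longrightarrow> Re (V (Complex x a)) \<ge> - D * exp (\<nu> * x)"
    and cd: "p < c" "d < q"
  obtains C where "C > 0" "\<And>x y. \<lbrakk>x \<ge> x0; c \<le> y; y \<le> d\<rbrakk> \<Longrightarrow> norm (deriv V (Complex x y)) \<le> C * exp (\<nu> * x)"
proof -
  define W where "W = box (Complex (-1) p) (Complex 1 q)"
  define K where "K = cbox (Complex 0 c) (Complex 0 d)"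
  have W: "open W" "simply_connected W" by (auto simp: W_def convex_imp_simply_connected)
  have "W \<noteq> UNIV" unfolding W_def using bounded_box not_bounded_UNIV by metis
  moreover have p: "Complex 0 a \<in> W" using a by (simp add: W_def in_box_complex_iff)
  moreover have K: "compact K" "K \<subseteq> W" using cd by (auto simp: K_def W_def in_box_complex_iff in_cbox_complex_iff)
  ultimately obtain C where C: "C > 0"
    "\<And>V z. \<lbrakk>V holomorphic_on W; \<And>w. w \<in> W \<Longrightarrow> Re (V w) \<le> 0; z \<in> K\<rbrakk> \<Longrightarrow> norm (deriv V z) \<le> - C * Re (V (Complex 0 a))"
    using Harnack_derivative_bound[OF W] by metis
  show ?thesis
  proof (rule that[of "C * (2 * exp \<nu> + \<bar>D\<bar>)"])
    show "C * (2 * exp \<nu> + \<bar>D\<bar>) > 0" using C(1) by (intro mult_pos_pos add_pos_nonneg) auto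
    fix x y assume x: "x \<ge> x0" and y: "c \<le> y" "y \<le> d"
    define b where "b = 2 * exp (\<nu> * (x + 1))"
    define h where "h = (\<lambda>z. V (z + of_real x) - of_real b)"
    have mem: "z + of_real x \<in> strip p q" if "z \<in> W" for z
      using that x x0 by (auto simp: W_def strip_def in_box_complex_iff)
    have holV: "(\<lambda>z. V (z + of_real x)) holomorphic_on W"
      by (rule holomorphic_on_compose_gen[OF _ hol, unfolded o_def]) (use mem in \<open>auto intro!: holomorphic_intros\<close>)
    have holh: "h holomorphic_on W" unfolding h_def by (intro holomorphic_intros holV)
    have neg: "Re (h z) \<le> 0" if "z \<in> W" for z
    proof -
      have "max 0 (Re (z + of_real x)) \<le> x + 1" using that x x0 by (auto simp: W_def in_box_complex_iff)
      hence "2 * exp (\<nu> * max 0 (Re (z + of_real x))) \<le> b" using \<nu> by (simp add: b_def)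
      thus ?thesis using up[OF mem[OF that]] by (simp add: h_def)
    qed
    have yK: "Complex 0 y \<in> K" using y by (simp add: K_def in_cbox_complex_iff)
    have sum: "Complex 0 t + of_real x = Complex x t" for t by (simp add: complex_eq_iff)
    have "Complex x y \<in> strip p q" using mem[of "Complex 0 y"] yK K(2) sum by auto
    hence dV: "(V has_field_derivative deriv V (Complex x y)) (at (Complex 0 y + of_real x))"
      unfolding sum using holomorphic_derivI[OF hol strip_basic(1)] by blast
    have "(h has_field_derivative deriv V (Complex x y)) (at (Complex 0 y))"
      unfolding h_def using DERIV_diff[OF DERIV_shift[THEN iffD1, OF dV] DERIV_const] by simp
    hence "deriv h (Complex 0 y) = deriv V (Complex x y)" by (rule DERIV_imp_deriv)
    hence "norm (deriv V (Complex x y)) \<le> - C * Re (h (Complex 0 a))"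
      using C(2)[OF holh neg yK] by simp
    also have "h (Complex 0 a) = V (Complex x a) - of_real b" by (simp only: h_def sum)
    also have "- C * Re (V (Complex x a) - of_real b) = C * (b - Re (V (Complex x a)))"
      by (simp add: algebra_simps)
    also have "\<dots> \<le> C * (b + \<bar>D\<bar> * exp (\<nu> * x))"
    proof (rule mult_left_mono)
      have "- D * exp (\<nu> * x) \<ge> - (\<bar>D\<bar> * exp (\<nu> * x))"
        using mult_right_mono[of D "\<bar>D\<bar>" "exp (\<nu> * x)"] by auto
      thus "b - Re (V (Complex x a)) \<le> b + \<bar>D\<bar> * exp (\<nu> * x)" using lo[OF x] by linarith
    qed (use C in auto)
    also have "\<dots> = C * (2 * exp \<nu> + \<bar>D\<bar>) * exp (\<nu> * x)"
      by (simp add: b_def algebra_simps exp_add)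
    finally show "norm (deriv V (Complex x y)) \<le> C * (2 * exp \<nu> + \<bar>D\<bar>) * exp (\<nu> * x)" .
  qed
qed

lemma eventually_negative_slope:
  fixes u u' :: "real \<Rightarrow> real"
  assumes "k > 0" and "\<And>x. x \<ge> X \<Longrightarrow> (u has_real_derivative u' x) (at x)"
    and "\<And>x. x \<ge> X \<Longrightarrow> u' x \<le> - k"
  shows "\<exists>x \<ge> X. u x < 0"
proof -
  define x where "x = X + (\<bar>u X\<bar> + 1) / k"
  have x: "x > X" using assms(1) by (simp add: x_def)
  obtain z where z: "z > X" "u x - u X = (x - X) * u' z"
    using MVT2[OF x, of u u'] assms(2) by auto
  have "(x - X) * u' z \<le> (x - X) * (- k)" using assms(3)[of z] z x by (intro mult_left_mono) auto
  also have "\<dots> = - (\<bar>u X\<bar> + 1)" using assms(1) by (simp add: x_def)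
  finally show ?thesis using z x by (intro exI[of _ x]) auto
qed

lemma exp_eq_shift:
  assumes "exp z = exp (w :: complex)"
  obtains n :: int where "Re z = Re w" "Im z = Im w + 2 * pi * n" "z = w + 2 * pi * of_int n * \<i>"
proof -
  obtain n :: int where "z = w + (of_int (2 * n) * pi) * \<i>" using assms by (auto simp: exp_eq)
  thus ?thesis using that[of n] by (simp add: mult_ac)
qed

text \<open>By the bound, the isolated singularity of \<open>q (1 / w)\<close> at \<open>w = 0\<close> is removable or a pole.\<close>

lemma polynomial_growth_leading_term:
  fixes q :: "complex \<Rightarrow> complex"
  assumes hol: "q holomorphic_on {z. norm z > r}" and r: "r > 0"
    and bound: "\<And>z. norm z \<ge> R \<Longrightarrow> norm (q z) \<le> C * norm z powr \<nu>"
  obtains (lim) a where "((\<lambda>w. q (inverse w)) \<longlongrightarrow> a) (at 0)"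
    | (pole) a d where "a \<noteq> 0" "d \<ge> (1::nat)" "((\<lambda>w. q (inverse w) * w ^ d) \<longlongrightarrow> a) (at 0)"
proof -
  define F where "F = (\<lambda>w. q (inverse w))"
  define N where "N = Suc (nat \<lceil>\<nu>\<rceil>)"
  have N: "real N > \<nu>" by (simp add: N_def) linarith
  have holF: "F holomorphic_on ball 0 (1 / r) - {0}" unfolding F_def
    by (rule holomorphic_on_compose_gen[OF _ hol, unfolded o_def])
       (use r in \<open>auto intro!: holomorphic_intros simp: norm_inverse norm_divide field_simps\<close>)
  have iso: "isolated_singularity_at F 0"
    unfolding isolated_singularity_at_def
    using holF r by (intro exI[of _ "1/r"] conjI) (auto simp: open_Diff analytic_on_open)
  have lim0: "((\<lambda>w. F w * w ^ N) \<longlongrightarrow> 0) (at 0)"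
  proof (rule Lim_null_comparison)
    have "eventually (\<lambda>w::complex. w \<in> ball 0 (1 / max 1 R)) (at 0)"
      by (intro eventually_at_in_open') auto
    moreover have "eventually (\<lambda>w::complex. w \<noteq> 0) (at 0)" by (simp add: eventually_at_filter)
    ultimately show "eventually (\<lambda>w. norm (F w * w ^ N) \<le> \<bar>C\<bar> * norm w powr (N - \<nu>)) (at 0)"
    proof eventually_elim
      case (elim w)
      have w: "norm w > 0" using elim by simp
      have "norm w * max 1 R < 1" using elim(1) by (simp add: pos_less_divide_eq)
      moreover have "norm w * R \<le> norm w * max 1 R" by (intro mult_left_mono) auto
      ultimately have "R * norm w \<le> 1" by (simp add: mult.commute)
      hence "norm (inverse w) \<ge> R" using w by (simp add: norm_inverse norm_divide inverse_eq_divide pos_le_divide_eq)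
      hence "norm (F w) \<le> C * norm (inverse w) powr \<nu>" using bound by (simp add: F_def)
      also have "\<dots> \<le> \<bar>C\<bar> * norm w powr (- \<nu>)"
      proof -
        have "norm (inverse w) powr \<nu> = norm w powr (- \<nu>)" using w by (simp add: powr_def norm_inverse ln_inverse)
        thus ?thesis by (simp add: mult_right_mono)
      qed
      finally have "norm (F w * w ^ N) \<le> \<bar>C\<bar> * norm w powr (- \<nu>) * norm w ^ N"
        by (simp add: norm_mult norm_power mult_right_mono)
      also have "\<dots> = \<bar>C\<bar> * norm w powr (N - \<nu>)"
        using w by (simp add: powr_realpow[symmetric] powr_add[symmetric] del: powr_realpow)
      finally show ?case .
    qed
    have "((\<lambda>w. \<bar>C\<bar> * norm (w::complex) powr (N - \<nu>)) \<longlongrightarrow> \<bar>C\<bar> * (norm (0::complex) powr (N - \<nu>))) (at 0)"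
      using N by (intro tendsto_mult tendsto_const tendsto_powr' tendsto_norm tendsto_ident_at) auto
    thus "((\<lambda>w. \<bar>C\<bar> * norm (w::complex) powr (N - \<nu>)) \<longlongrightarrow> 0) (at 0)" by simp
  qed
  have ness: "not_essential F 0"
  proof -
    have "not_essential (\<lambda>w. F w * w ^ N) 0" unfolding not_essential_def using lim0 by blast
    moreover have "not_essential (\<lambda>w::complex. w ^ N) 0"
      by (intro not_essential_analytic analytic_intros)
    moreover have "isolated_singularity_at (\<lambda>w. F w * w ^ N) 0" "isolated_singularity_at (\<lambda>w::complex. w ^ N) 0"
      by (intro isolated_singularity_at_times[OF iso] isolated_singularity_at_analytic analytic_intros)+
    ultimately have "not_essential (\<lambda>w. (F w * w ^ N) / w ^ N) 0" by (intro not_essential_divide)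
    moreover have "eventually (\<lambda>w. (F w * w ^ N) / w ^ N = F w) (at 0)"
      by (simp add: eventually_at_filter)
    ultimately show ?thesis using not_essential_cong by metis
  qed
  show ?thesis
  proof (cases "is_pole F 0")
    case False
    then obtain a where "(F \<longlongrightarrow> a) (at 0)" using ness by (auto simp: not_essential_def)
    thus ?thesis using lim by (simp add: F_def)
  next
    case True
    define h where "h = zor_poly F 0"
    define n where "n = zorder F 0"
    from zorder_exist_pole[OF holF _ _ True] r
    obtain e where e: "n < 0" "h 0 \<noteq> 0" "e > 0" "h holomorphic_on cball 0 e"
      "\<And>w. w \<in> cball 0 e - {0} \<Longrightarrow> F w = h w / w ^ nat (- n)"
      by (auto simp: h_def n_def)
    have "continuous_on (ball 0 e) h"
      using e(4) by (meson ball_subset_cball continuous_on_subset holomorphic_on_imp_continuous_on)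
    hence "(h \<longlongrightarrow> h 0) (at 0)" using e(3) by (simp add: continuous_on_eq_continuous_at continuous_at)
    moreover have "eventually (\<lambda>w. F w * w ^ nat (- n) = h w) (at 0)"
    proof -
      have "eventually (\<lambda>w::complex. w \<in> ball 0 e) (at 0)" using e(3) by (intro eventually_at_in_open') auto
      moreover have "eventually (\<lambda>w::complex. w \<noteq> 0) (at 0)" by (simp add: eventually_at_filter)
      ultimately show ?thesis by eventually_elim (use e(5) in auto)
    qed
    ultimately have "((\<lambda>w. F w * w ^ nat (- n)) \<longlongrightarrow> h 0) (at 0)"
      by (simp add: filterlim_cong)
    thus ?thesis using pole[of "h 0" "nat (- n)"] e(1,2) by (simp add: F_def)
  qed
qed

lemma circle_cover:
  fixes a b t :: real
  assumes "a < b" "b < a + 2 * pi"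
  obtains n :: int where "a \<le> t + 2 * pi * n" "t + 2 * pi * n \<le> b"
    | n :: int where "b - 2 * pi < t + 2 * pi * n" "t + 2 * pi * n < a"
proof -
  define n where "n = \<lceil>(a - t) / (2 * pi)\<rceil>"
  have "(a - t) / (2 * pi) \<le> n" "n < (a - t) / (2 * pi) + 1" unfolding n_def by linarith+
  hence n: "a \<le> t + 2 * pi * n" "t + 2 * pi * n < a + 2 * pi" by (simp_all add: field_simps)
  show ?thesis
  proof (cases "t + 2 * pi * n \<le> b")
    case True thus ?thesis using that(1) n by blast
  next
    case False
    have "t + 2 * pi * of_int (n - 1) = t + 2 * pi * n - 2 * pi" by (simp add: algebra_simps)
    thus ?thesis using that(2)[of "n - 1"] n False by simp
  qed
qed

text \<open>Rotating by the central angle \<open>m\<close> moves the sector off the branch cut of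
  \<open>Ln\<close>; a width of exactly \<open>2 * pi\<close> is still allowed because the strip is
  open.\<close>

lemma holomorphic_branch_on_sector:
  assumes "p < q" "q \<le> p + 2 * pi"
  obtains L where "L holomorphic_on exp ` strip p q" "\<And>z. z \<in> strip p q \<Longrightarrow> L (exp z) = z"
proof -
  define m where "m = (p + q) / 2"
  define L where "L = (\<lambda>z. Ln (z * exp (- \<i> * of_real m)) + \<i> * of_real m)"
  have eq: "exp z * exp (- \<i> * of_real m) = exp (z - \<i> * of_real m)" for z by (simp add: exp_add[symmetric])
  have Im: "\<bar>Im (z - \<i> * of_real m)\<bar> < pi" if "z \<in> strip p q" for z
    using that assms by (auto simp: strip_def m_def abs_less_iff field_simps)
  have L: "L (exp z) = z" if "z \<in> strip p q" for z
    unfolding L_def eq using Im[OF that] by (subst Ln_exp) (auto simp: abs_less_iff)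
  have "L holomorphic_on exp ` strip p q"
    unfolding L_def
  proof (intro holomorphic_intros)
    fix w assume "w \<in> exp ` strip p q"
    then obtain z where z: "z \<in> strip p q" "w = exp z" by blast
    show "w * exp (- \<i> * of_real m) \<notin> \<real>\<^sub>\<le>\<^sub>0"
    proof
      assume neg: "w * exp (- \<i> * of_real m) \<in> \<real>\<^sub>\<le>\<^sub>0"
      define u where "u = z - \<i> * of_real m"
      have u: "\<bar>Im u\<bar> < pi" using Im[OF z(1)] by (simp add: u_def)
      have "exp u \<in> \<real>\<^sub>\<le>\<^sub>0" using neg unfolding z(2) eq u_def .
      moreover have "\<not> (Re (exp u) = 0 \<and> Im (exp u) = 0)"
        using exp_not_eq_zero[of u] by (simp only: complex_eq_iff zero_complex.sel) simp
      ultimately have "Im (Ln (exp u)) = pi"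
        by (subst Im_Ln_eq_pi) (auto simp: complex_nonpos_Reals_iff less_le)
      moreover have "Ln (exp u) = u" using u by (subst Ln_exp) (auto simp: abs_less_iff)
      ultimately show False using u by simp
    qed
  qed
  thus ?thesis using that L by blast
qed

text \<open>On the overlaps the logarithms \<open>U\<close> and \<open>V\<close> agree only up to
  imaginary constants, which may differ between the two transition sectors; their derivatives agree
  exactly and glue around the circle. Positivity in the transition sectors excludes a pole at
  infinity, and \<open>mx\<close> supplies the size of the real parts when the derivative has a
  limit there.\<close>

lemma positive_transition_sectors:
  fixes E0 E1 :: "complex \<Rightarrow> complex"
  assumes ord: "p0 < q1" "q1 < p1 + 2 * pi" "p1 + 2 * pi < q0" "q0 < p0 + 2 * pi"
    and wide: "q0 - p0 > pi" "q1 - p1 > pi" "max (q0 - p0) (q1 - p1) > 3 * pi / 2"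
    and hol: "E0 holomorphic_on strip p0 q0" "E1 holomorphic_on strip p1 q1"
    and nz: "\<And>z. z \<in> strip p0 q0 \<Longrightarrow> E0 z \<noteq> 0" "\<And>z. z \<in> strip p1 q1 \<Longrightarrow> E1 z \<noteq> 0"
    and T1: "\<And>z. z \<in> strip p0 q1 \<Longrightarrow> norm (E0 z) = norm (E1 z) \<and> norm (E0 z) \<ge> 1"
    and T2: "\<And>z. z \<in> strip (p1 + 2 * pi) q0 \<Longrightarrow> norm (E0 z) = norm (E1 (z - 2 * pi * \<i>)) \<and> norm (E0 z) \<ge> 1"
    and up: "\<And>z. z \<in> strip p0 q0 \<Longrightarrow> norm (E0 z) \<le> exp (2 * exp (\<nu> * max 0 (Re z)))"
      "\<And>z. z \<in> strip p1 q1 \<Longrightarrow> norm (E1 z) \<le> exp (2 * exp (\<nu> * max 0 (Re z)))" and \<nu>: "\<nu> > 0"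
    and mx: "\<And>x. x \<ge> 0 \<Longrightarrow> \<exists>y. (p0 < y \<and> y < q0 \<and> norm (E0 (Complex x y)) \<ge> exp 1) \<or>
                                 (p1 < y \<and> y < q1 \<and> norm (E1 (Complex x y)) \<ge> exp 1)"
  shows "\<exists>x\<ge>0. (\<forall>y. p0 < y \<longrightarrow> y < q0 \<longrightarrow> norm (E0 (Complex x y)) > 1) \<and>
               (\<forall>y. p1 < y \<longrightarrow> y < q1 \<longrightarrow> norm (E1 (Complex x y)) > 1)"
proof -
  \<comment> \<open>Midlines of the two transition sectors: \<open>U\<close> is used for imaginary
    parts from \<open>a\<close> to \<open>b\<close> and \<open>V\<close> from
    \<open>b - 2 * pi\<close> to \<open>a\<close>, both at a positive distance from the edges of
    their strips.\<close>
  define a where "a = (p0 + q1) / 2"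
  define b where "b = (p1 + 2 * pi + q0) / 2"
  have ab: "p0 < a" "a < q1" "p1 + 2 * pi < b" "b < q0" "a < b" "b < a + 2 * pi" "p1 < a" "a < q0"
    using ord by (auto simp: a_def b_def field_simps)
  have p01: "p0 < q0" "p1 < q1" using wide pi_gt_zero by linarith+
  have w0: "q0 \<le> p0 + 2 * pi" "q1 \<le> p1 + 2 * pi" using ord by auto
  have mem0: "Complex 0 a \<in> strip p0 q0" "Complex 0 a \<in> strip p1 q1" using ab by (auto simp: strip_def)
  obtain U where U: "U holomorphic_on strip p0 q0" "\<And>z. z \<in> strip p0 q0 \<Longrightarrow> exp (U z) = E0 z"
    using holomorphic_logarithm_exists[OF strip_basic(2,1) hol(1) nz(1) mem0(1)] by blast
  obtain V where V: "V holomorphic_on strip p1 q1" "\<And>z. z \<in> strip p1 q1 \<Longrightarrow> exp (V z) = E1 z"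
    using holomorphic_logarithm_exists[OF strip_basic(2,1) hol(2) nz(2) mem0(2)] by blast
  have nE0: "norm (E0 z) = exp (Re (U z))" if "z \<in> strip p0 q0" for z using U(2)[OF that] by (metis norm_exp_eq_Re)
  have nE1: "norm (E1 z) = exp (Re (V z))" if "z \<in> strip p1 q1" for z using V(2)[OF that] by (metis norm_exp_eq_Re)
  have sub1: "strip p0 q1 \<subseteq> strip p0 q0" "strip p0 q1 \<subseteq> strip p1 q1" using ord by (auto simp: strip_def)
  have sub2: "strip (p1 + 2 * pi) q0 \<subseteq> strip p0 q0" using ord by (auto simp: strip_def)
  have sub2': "z - 2 * pi * \<i> \<in> strip p1 q1" if "z \<in> strip (p1 + 2 * pi) q0" for z
    using that ord by (auto simp: strip_def)
  have dU: "(U has_field_derivative deriv U z) (at z)" if "z \<in> strip p0 q0" for z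
    using holomorphic_derivI[OF U(1) strip_basic(1) that] .
  have dV: "(V has_field_derivative deriv V z) (at z)" if "z \<in> strip p1 q1" for z
    using holomorphic_derivI[OF V(1) strip_basic(1) that] .
  \<comment> \<open>A vanishing real part makes \<open>exp (h z)\<close> unimodular, hence constant
    on a connected set.\<close>
  have zero_deriv: "D = 0" if S: "open S" "connected S" "h holomorphic_on S" "\<And>z. z \<in> S \<Longrightarrow> Re (h z) = 0"
      and zD: "z \<in> S" "(h has_field_derivative D) (at z)" for h S z D
  proof -
    have "(\<lambda>z. exp (h z)) constant_on S"
      by (rule constant_norm_imp_constant_on[where c = 1]) (use S in \<open>auto intro!: holomorphic_intros\<close>)
    then obtain c where c: "\<And>z. z \<in> S \<Longrightarrow> exp (h z) = c" by (auto simp: constant_on_def)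
    have "((\<lambda>z. exp (h z)) has_field_derivative exp (h z) * D) (at z)"
      using zD(2) by (auto intro!: derivative_eq_intros)
    moreover have "((\<lambda>z. exp (h z)) has_field_derivative 0) (at z)"
      by (rule has_field_derivative_transform_within_open[of "\<lambda>_. c" _ _ S]) (use S zD c in auto)
    ultimately have "exp (h z) * D = 0" by (rule DERIV_unique)
    thus ?thesis by simp
  qed
  have eq1: "deriv U z = deriv V z" if z: "z \<in> strip p0 q1" for z
  proof -
    have "deriv U z - deriv V z = 0"
    proof (rule zero_deriv[of "strip p0 q1" "\<lambda>z. U z - V z" z])
      show "(\<lambda>z. U z - V z) holomorphic_on strip p0 q1"
        using sub1 by (auto intro!: holomorphic_intros intro: holomorphic_on_subset U(1) V(1))
      show "Re (U z - V z) = 0" if "z \<in> strip p0 q1" for z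
        using T1[OF that] nE0[OF subsetD[OF sub1(1) that]] nE1[OF subsetD[OF sub1(2) that]] by simp
      show "((\<lambda>z. U z - V z) has_field_derivative deriv U z - deriv V z) (at z)"
        using z sub1 by (auto intro!: DERIV_diff dU dV)
    qed (use z strip_basic in auto)
    thus ?thesis by simp
  qed
  have eq2: "deriv U z = deriv V (z - 2 * pi * \<i>)" if z: "z \<in> strip (p1 + 2 * pi) q0" for z
  proof -
    have "deriv U z - deriv V (z - 2 * pi * \<i>) = 0"
    proof (rule zero_deriv[of "strip (p1 + 2 * pi) q0" "\<lambda>z. U z - V (z - 2 * pi * \<i>)" z])
      have "(\<lambda>z. V (z - 2 * pi * \<i>)) holomorphic_on strip (p1 + 2 * pi) q0"
        by (rule holomorphic_on_compose_gen[OF _ V(1), unfolded o_def]) (use sub2' in \<open>auto intro!: holomorphic_intros\<close>)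
      thus "(\<lambda>z. U z - V (z - 2 * pi * \<i>)) holomorphic_on strip (p1 + 2 * pi) q0"
        using sub2 by (auto intro!: holomorphic_on_diff intro: holomorphic_on_subset U(1))
      show "Re (U z - V (z - 2 * pi * \<i>)) = 0" if "z \<in> strip (p1 + 2 * pi) q0" for z
        using T2[OF that] nE0[OF subsetD[OF sub2 that]] nE1[OF sub2'[OF that]] by simp
      have "(V has_field_derivative deriv V (z - 2 * pi * \<i>)) (at (z + - (2 * pi * \<i>)))"
        using dV[OF sub2'[OF z]] by simp
      hence "((\<lambda>z. V (z - 2 * pi * \<i>)) has_field_derivative deriv V (z - 2 * pi * \<i>)) (at z)"
        by (subst (asm) DERIV_shift) simp
      thus "((\<lambda>z. U z - V (z - 2 * pi * \<i>)) has_field_derivative deriv U z - deriv V (z - 2 * pi * \<i>)) (at z)"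
        using dU[of z] z sub2 by (auto intro!: DERIV_diff)
    qed (use z strip_basic in auto)
    thus ?thesis by simp
  qed
  obtain L0 where L0: "L0 holomorphic_on exp ` strip p0 q0" "\<And>z. z \<in> strip p0 q0 \<Longrightarrow> L0 (exp z) = z"
    using holomorphic_branch_on_sector[OF p01(1) w0(1)] by blast
  obtain L1 where L1: "L1 holomorphic_on exp ` strip p1 q1" "\<And>z. z \<in> strip p1 q1 \<Longrightarrow> L1 (exp z) = z"
    using holomorphic_branch_on_sector[OF p01(2) w0(2)] by blast
  \<comment> \<open>\<open>q\<close> is the derivative with respect to \<open>log z\<close>, viewed
    as a function of \<open>z\<close> itself; it is single-valued although \<open>log z\<close> is
    not.\<close>
  define q where "q = (\<lambda>z. if z \<in> exp ` strip p0 q0 then deriv U (L0 z) else deriv V (L1 z))"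
  have q0: "q (exp z) = deriv U z" if "z \<in> strip p0 q0" for z
    using that L0(2) by (auto simp: q_def)
  have q1: "q (exp z) = deriv V z" if z: "z \<in> strip p1 q1" for z
  proof (cases "exp z \<in> exp ` strip p0 q0")
    case False thus ?thesis using L1(2)[OF z] by (simp add: q_def)
  next
    case True
    then obtain w where w: "w \<in> strip p0 q0" "exp w = exp z" by force
    obtain n :: int where n: "Re w = Re z" "Im w = Im z + 2 * pi * n" "w = z + 2 * pi * of_int n * \<i>"
      using exp_eq_shift[OF w(2)] .
    have r: "p0 < Im w" "Im w < q0" "p1 < Im z" "Im z < q1" using w z by (auto simp: strip_def)
    \<comment> \<open>By the order of the edges the two strips meet modulo
      \<open>2 * pi * \<i>\<close> only for \<open>n = 0\<close> and \<open>n = 1\<close>; these are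
      the two transition sectors.\<close>
    have "2 * pi * n > - 2 * pi" using n(2) r ord by linarith
    hence "n > - 1" by (simp add: mult_less_cancel_left_pos[of "2*pi" "-1" n, simplified])
    moreover have "2 * pi * n < 2 * pi * 2" using n(2) r ord by linarith
    hence "n < 2" by simp
    ultimately consider "n = 0" | "n = 1" by linarith
    thus ?thesis
    proof cases
      case 1
      hence "z \<in> strip p0 q1" using n w z by (auto simp: strip_def)
      thus ?thesis using eq1 q0[of z] sub1 by auto
    next
      case 2
      hence "w \<in> strip (p1 + 2 * pi) q0" using n w z by (auto simp: strip_def)
      moreover have "z = w - 2 * pi * \<i>" using n(3) 2 by simp
      ultimately show ?thesis using eq2[of w] q0[OF w(1)] w(2) by simp
    qed
  qed
  have big: "exp z \<in> exp ` strip p0 q0 \<or> exp z \<in> exp ` strip p1 q1" if z: "Re z > - 1" for z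
  proof -
    have ex: "exp (z + 2 * pi * of_int n * \<i>) = exp z" for n :: int
      by (simp add: exp_eq)
    from circle_cover[OF ab(5,6), of "Im z"] show ?thesis
    proof cases
      case (1 n)
      hence "z + 2 * pi * of_int n * \<i> \<in> strip p0 q0" using z ab by (auto simp: strip_def)
      thus ?thesis using ex[of n] by (metis imageI)
    next
      case (2 n)
      hence "z + 2 * pi * of_int n * \<i> \<in> strip p1 q1" using z ab by (auto simp: strip_def)
      thus ?thesis using ex[of n] by (metis imageI)
    qed
  qed
  have holq: "q holomorphic_on {z. norm z > exp (- 1)}"
  proof -
    have op: "open (exp ` strip p q)" if "p < q" for p q
    proof (rule open_mapping_thm[of exp UNIV])
      show "\<not> exp constant_on (UNIV :: complex set)"
        by (metis UNIV_I constant_on_def exp_zero exp_pi_i one_neq_neg_one)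
    qed (auto intro!: holomorphic_intros strip_basic)
    have dhU: "deriv U holomorphic_on strip p0 q0" "deriv V holomorphic_on strip p1 q1"
      using holomorphic_deriv U(1) V(1) strip_basic(1) by blast+
    have h0: "q holomorphic_on exp ` strip p0 q0"
    proof (rule holomorphic_transform[of "deriv U \<circ> L0"])
      show "deriv U \<circ> L0 holomorphic_on exp ` strip p0 q0"
        by (rule holomorphic_on_compose_gen[OF L0(1) dhU(1)]) (use L0(2) in auto)
    qed (use q0 L0(2) in auto)
    have h1: "q holomorphic_on exp ` strip p1 q1"
    proof (rule holomorphic_transform[of "deriv V \<circ> L1"])
      show "deriv V \<circ> L1 holomorphic_on exp ` strip p1 q1"
        by (rule holomorphic_on_compose_gen[OF L1(1) dhU(2)]) (use L1(2) in auto)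
    qed (use q1 L1(2) in auto)
    have "q holomorphic_on (exp ` strip p0 q0 \<union> exp ` strip p1 q1)"
      using h0 h1 op p01 by (intro holomorphic_on_Un) auto
    moreover have "{z. norm z > exp (- 1)} \<subseteq> exp ` strip p0 q0 \<union> exp ` strip p1 q1"
    proof
      fix w :: complex assume w: "w \<in> {z. norm z > exp (- 1)}"
      hence "w \<noteq> 0" by auto
      moreover from this w have "Re (Ln w) > - 1" by (simp add: exp_less_cancel_iff[of "-1", symmetric])
      ultimately show "w \<in> exp ` strip p0 q0 \<union> exp ` strip p1 q1" using big[of "Ln w"] by auto
    qed
    ultimately show ?thesis by (rule holomorphic_on_subset)
  qed
  have ReU: "Re (U z) \<le> 2 * exp (\<nu> * max 0 (Re z))" if "z \<in> strip p0 q0" for z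
    using up(1)[OF that] nE0[OF that] by simp
  have ReV: "Re (V z) \<le> 2 * exp (\<nu> * max 0 (Re z))" if "z \<in> strip p1 q1" for z
    using up(2)[OF that] nE1[OF that] by simp
  have aT: "Complex x a \<in> strip p0 q1" if "x \<ge> 0" for x using that ab by (simp add: strip_def)
  have bT: "Complex x b \<in> strip (p1 + 2 * pi) q0" if "x \<ge> 0" for x using that ab by (simp add: strip_def)
  have Ua: "Re (U (Complex x a)) \<ge> 0" "Re (U (Complex x a)) = Re (V (Complex x a))" if "x \<ge> 0" for x
    using T1[OF aT[OF that]] nE0[OF subsetD[OF sub1(1) aT[OF that]]] nE1[OF subsetD[OF sub1(2) aT[OF that]]] by simp_all
  \<comment> \<open>On \<open>Im z = a\<close> positivity in the transition sector supplies the
    lower bound that Harnack's inequality needs.\<close>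
  obtain C0 where C0: "C0 > 0" "\<And>x y. \<lbrakk>x \<ge> 0; a \<le> y; y \<le> b\<rbrakk> \<Longrightarrow> norm (deriv U (Complex x y)) \<le> C0 * exp (\<nu> * x)"
    by (rule strip_log_derivative_bound[OF U(1) ReU \<nu> ab(1,8) order_refl, of 0 a b]) (use Ua ab in auto)
  obtain C1 where C1: "C1 > 0" "\<And>x y. \<lbrakk>x \<ge> 0; b - 2 * pi \<le> y; y \<le> a\<rbrakk> \<Longrightarrow> norm (deriv V (Complex x y)) \<le> C1 * exp (\<nu> * x)"
    by (rule strip_log_derivative_bound[OF V(1) ReV \<nu> ab(7,2) order_refl, of 0 "b - 2 * pi" a]) (use Ua ab in auto)
  have qexp: "norm (q (exp z)) \<le> max C0 C1 * exp (\<nu> * Re z)" if z: "Re z \<ge> 0" for z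
  proof -
    have ex: "exp (Complex (Re z) (Im z + 2 * pi * n)) = exp z" for n :: int
      unfolding exp_eq by (rule exI[of _ n]) (simp add: complex_eq_iff)
    from circle_cover[OF ab(5,6), of "Im z"] show ?thesis
    proof cases
      case (1 n)
      define w where "w = Complex (Re z) (Im z + 2 * pi * n)"
      have "w \<in> strip p0 q0" using 1 z ab by (auto simp: w_def strip_def)
      hence "norm (q (exp z)) \<le> C0 * exp (\<nu> * Re z)"
        using q0[of w] C0(2)[OF z 1] ex[of n] by (simp add: w_def)
      also have "\<dots> \<le> max C0 C1 * exp (\<nu> * Re z)" by (intro mult_right_mono) auto
      finally show ?thesis .
    next
      case (2 n)
      define w where "w = Complex (Re z) (Im z + 2 * pi * n)"
      have "w \<in> strip p1 q1" using 2 z ab by (auto simp: w_def strip_def)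
      hence "norm (q (exp z)) \<le> C1 * exp (\<nu> * Re z)"
        using q1[of w] C1(2)[OF z less_imp_le[OF 2(1)] less_imp_le[OF 2(2)]] ex[of n] by (simp add: w_def)
      also have "\<dots> \<le> max C0 C1 * exp (\<nu> * Re z)" by (intro mult_right_mono) auto
      finally show ?thesis .
    qed
  qed
  have bound: "norm (q z) \<le> max C0 C1 * norm z powr \<nu>" if "norm z \<ge> 1" for z
  proof -
    have "z \<noteq> 0" using that by auto
    thus ?thesis using qexp[of "Ln z"] that by (simp add: powr_def)
  qed
  \<comment> \<open>The substitution \<open>w = exp (- z)\<close> turns a punctured neighbourhood of
    0 into a half plane \<open>Re z \<ge> X\<close>, so the estimates become uniform in
    \<open>Im z\<close>.\<close>
  have evt: "\<exists>X\<ge>0. \<forall>z. Re z \<ge> X \<longrightarrow> P (exp (- z))" if "eventually P (at (0::complex))" for P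
  proof -
    from that[unfolded eventually_at]
    obtain d where d0: "d > 0" "\<forall>w\<in>UNIV. w \<noteq> 0 \<and> dist w 0 < d \<longrightarrow> P w"
      by (elim exE conjE)
    have d: "d > 0" "\<And>w. w \<noteq> 0 \<Longrightarrow> norm w < d \<Longrightarrow> P w" using d0 by auto
    define X where "X = max 0 (1 - ln d)"
    have "P (exp (- z))" if "Re z \<ge> X" for z
    proof (rule d(2))
      have "norm (exp (- z)) = exp (- Re z)" by simp
      also have "\<dots> < exp (ln d)" using that by (simp add: X_def)
      finally show "norm (exp (- z)) < d" using d(1) by simp
    qed simp
    thus ?thesis by (intro exI[of _ X]) (auto simp: X_def)
  qed
  have inv: "inverse (exp (- z)) = exp z" for z :: complex by (simp add: exp_minus)
  consider (lim) c where "((\<lambda>w. q (inverse w)) \<longlongrightarrow> c) (at 0)"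
    | (pole) c d where "c \<noteq> 0" "d \<ge> (1::nat)" "((\<lambda>w. q (inverse w) * w ^ d) \<longlongrightarrow> c) (at 0)"
    by (rule polynomial_growth_leading_term[OF holq exp_gt_zero, of 1 "max C0 C1" \<nu>]) (use bound in auto)
  thus ?thesis
  proof cases
    case (pole c d)
    define \<phi> where "\<phi> = Arg c"
    have c: "c = norm c * cis \<phi>" using Arg_eq[OF pole(1)] by (simp add: \<phi>_def cis_conv_exp)
    \<comment> \<open>On the ray with argument \<open>y\<close> the derivative of
      \<open>Re U\<close> behaves like \<open>norm c * exp (d * x) * cos (d * y + \<phi>)\<close>; a
      negative cosine would drive \<open>Re U\<close> below 0.\<close>
    have cos_pos: "0 \<le> cos (d * y + \<phi>)" if y: "p0 < y" "y < q0" and pos: "\<And>x. x \<ge> 0 \<Longrightarrow> Re (U (Complex x y)) \<ge> 0" for y :: real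
    proof (rule ccontr)
      assume neg: "\<not> ?thesis"
      \<comment> \<open>Half of the negative leading coefficient in absolute value; the other half
        is reserved for the error \<open>e\<close>.\<close>
      define k where "k = norm c * \<bar>cos (d * y + \<phi>)\<bar> / 2"
      have k: "k > 0" unfolding k_def using pole(1) neg by (intro divide_pos_pos mult_pos_pos) auto
      have ck: "norm c * cos (d * y + \<phi>) = - 2 * k" using neg by (simp add: k_def)
      have "eventually (\<lambda>w. dist (q (inverse w) * w ^ d) c < k) (at 0)"
        using pole(3) k by (rule tendstoD)
      then obtain X where X: "X \<ge> 0" "\<And>z. Re z \<ge> X \<Longrightarrow> norm (q (exp z) * exp (- z) ^ d - c) < k"
        using evt[of "\<lambda>w. dist (q (inverse w) * w ^ d) c < k"] unfolding inv dist_norm by auto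
      have "\<exists>x\<ge>X. Re (U (Complex x y)) < 0"
      proof (rule eventually_negative_slope[OF k])
        fix x assume x: "x \<ge> X"
        have S: "Complex x y \<in> strip p0 q0" using x X(1) y by (simp add: strip_def)
        show "((\<lambda>x. Re (U (Complex x y))) has_real_derivative Re (deriv U (Complex x y))) (at x)"
          by (rule Re_has_horizontal_derivative[OF dU[OF S]])
        define z where "z = Complex x y"
        define e where "e = q (exp z) * exp (- z) ^ d - c"
        have e: "norm e < k" using X(2)[of z] x by (simp add: e_def z_def)
        have "exp (- z) ^ d * exp (of_nat d * z) = 1"
          by (simp add: exp_of_nat_mult exp_minus power_inverse)
        hence "deriv U z = (c + e) * exp (of_nat d * z)"
          using q0[OF S] by (simp add: e_def z_def mult.assoc)
        also have "exp (of_nat d * z) = of_real (exp (d * x)) * cis (d * y)"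
          by (simp add: z_def exp_eq_polar)
        finally have dz: "deriv U z = of_real (exp (d * x)) * ((c + e) * cis (d * y))" by (simp add: mult_ac)
        have "c * cis (d * y) = of_real (norm c) * cis (d * y + \<phi>)"
          by (subst c) (simp add: cis_mult add.commute mult.assoc)
        hence "Re (c * cis (d * y)) = - 2 * k" using ck by simp
        moreover have "Re (e * cis (d * y)) \<le> norm (e * cis (d * y))" by (rule complex_Re_le_cmod)
        hence "Re (e * cis (d * y)) \<le> k" using e by (simp add: norm_mult)
        ultimately have r: "Re ((c + e) * cis (d * y)) \<le> - k" by (simp add: distrib_right)
        have "1 \<le> exp (d * x)" using x X(1) by simp
        have "Re (deriv U z) = exp (d * x) * Re ((c + e) * cis (d * y))" unfolding dz by simp
        also have "\<dots> \<le> exp (d * x) * (- k)" using r by (intro mult_left_mono) auto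
        also have "\<dots> \<le> 1 * (- k)" using \<open>1 \<le> exp (d * x)\<close> k by (intro mult_right_mono_neg) auto
        finally show "Re (deriv U (Complex x y)) \<le> - k" by (simp add: z_def)
      qed
      then obtain x where "x \<ge> X" "Re (U (Complex x y)) < 0" by blast
      thus False using pos[of x] X(1) by auto
    qed
    have False
    proof (rule no_trigonometric_sign_pattern[OF pole(2) ord(1,3) wide])
      fix y :: real assume y: "p0 < y" "y < q1"
      show "0 \<le> cos (real d * y + \<phi>)"
      proof (rule cos_pos)
        fix x :: real assume "x \<ge> 0"
        hence S: "Complex x y \<in> strip p0 q1" using y by (simp add: strip_def)
        thus "0 \<le> Re (U (Complex x y))" using T1[OF S] nE0[OF subsetD[OF sub1(1) S]] by simp
      qed (use y ord in auto)
    next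
      fix y :: real assume y: "p1 + 2 * pi < y" "y < q0"
      show "0 \<le> cos (real d * y + \<phi>)"
      proof (rule cos_pos)
        fix x :: real assume "x \<ge> 0"
        hence S: "Complex x y \<in> strip (p1 + 2 * pi) q0" using y by (simp add: strip_def)
        thus "0 \<le> Re (U (Complex x y))" using T2[OF S] nE0[OF subsetD[OF sub2 S]] by simp
      qed (use y ord in auto)
    qed
    thus ?thesis ..
  next
    case (lim c)
    \<comment> \<open>Since \<open>deriv U\<close> and \<open>deriv V\<close> tend to
      \<open>c\<close>, the real parts vary along a vertical segment like \<open>- Im c * y\<close>,
      up to \<open>e\<close> times the length.\<close>
    have osc: "\<exists>x\<ge>0.
        (\<forall>y\<in>{p0<..<q0}. \<forall>y'\<in>{p0<..<q0}. \<bar>Re (U (Complex x y)) - Re (U (Complex x y')) + Im c * (y - y')\<bar> \<le> e * \<bar>y - y'\<bar>) \<and>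
        (\<forall>y\<in>{p1<..<q1}. \<forall>y'\<in>{p1<..<q1}. \<bar>Re (V (Complex x y)) - Re (V (Complex x y')) + Im c * (y - y')\<bar> \<le> e * \<bar>y - y'\<bar>)"
      if e: "e > 0" for e
    proof -
      have "eventually (\<lambda>w. dist (q (inverse w)) c < e) (at 0)"
        using lim e by (rule tendstoD)
      then obtain X where X: "X \<ge> 0" "\<And>z. Re z \<ge> X \<Longrightarrow> norm (q (exp z) - c) < e"
        using evt[of "\<lambda>w. dist (q (inverse w)) c < e"] unfolding inv dist_norm by auto
      have Im: "\<bar>Im D - Im c\<bar> \<le> e" if "norm (D - c) < e" for D
        using abs_Im_le_cmod[of "D - c"] that by simp
      have u: "\<bar>Re (U (Complex x y)) - Re (U (Complex x y')) + Im c * (y - y')\<bar> \<le> e * \<bar>y - y'\<bar>"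
        if x: "x \<ge> X" and y: "y \<in> {p0<..<q0}" "y' \<in> {p0<..<q0}" for x y y'
      proof (rule vertical_oscillation[OF _ _ _ y, of U "\<lambda>y. deriv U (Complex x y)" x])
        fix t assume t: "t \<in> {p0<..<q0}"
        have S: "Complex x t \<in> strip p0 q0" using x X(1) t by (simp add: strip_def)
        show "(U has_field_derivative deriv U (Complex x t)) (at (Complex x t))" by (rule dU[OF S])
        show "\<bar>Im (deriv U (Complex x t)) - Im c\<bar> \<le> e"
          using Im X(2)[of "Complex x t"] x q0[OF S] by simp
      qed simp
      have v: "\<bar>Re (V (Complex x y)) - Re (V (Complex x y')) + Im c * (y - y')\<bar> \<le> e * \<bar>y - y'\<bar>"
        if x: "x \<ge> X" and y: "y \<in> {p1<..<q1}" "y' \<in> {p1<..<q1}" for x y y'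
      proof (rule vertical_oscillation[OF _ _ _ y, of V "\<lambda>y. deriv V (Complex x y)" x])
        fix t assume t: "t \<in> {p1<..<q1}"
        have S: "Complex x t \<in> strip p1 q1" using x X(1) t by (simp add: strip_def)
        show "(V has_field_derivative deriv V (Complex x t)) (at (Complex x t))" by (rule dV[OF S])
        show "\<bar>Im (deriv V (Complex x t)) - Im c\<bar> \<le> e"
          using Im X(2)[of "Complex x t"] x q1[OF S] by simp
      qed simp
      show ?thesis
        by (intro exI[of _ X] conjI ballI X(1)) (rule u v; simp)+
    qed
    have Ub: "Re (U (Complex x b)) = Re (V (Complex x (b - 2 * pi)))" if "x \<ge> 0" for x
    proof -
      have eq: "Complex x b - 2 * pi * \<i> = Complex x (b - 2 * pi)" by (simp add: complex_eq_iff)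
      show ?thesis
        using T2[OF bT[OF that]] nE0[OF subsetD[OF sub2 bT[OF that]]] nE1[OF sub2'[OF bT[OF that]]]
        unfolding eq by simp
    qed
    \<comment> \<open>Once around the circle, along \<open>U\<close> from \<open>a\<close> to
      \<open>b\<close> and along \<open>V\<close> from \<open>b - 2 * pi\<close> to
      \<open>a\<close>, the real part returns to its initial value. A nonzero \<open>Im c\<close>
      would change it by \<open>- 2 * pi * Im c\<close>, with an error of at most half that
      size.\<close>
    have Imc: "Im c = 0"
    proof (rule ccontr)
      assume "Im c \<noteq> 0"
      hence e: "\<bar>Im c\<bar> / 2 > 0" by simp
      from osc[OF e] obtain X where X0: "X \<ge> 0"
        and XU: "\<forall>y\<in>{p0<..<q0}. \<forall>y'\<in>{p0<..<q0}. \<bar>Re (U (Complex X y)) - Re (U (Complex X y')) + Im c * (y - y')\<bar> \<le> \<bar>Im c\<bar> / 2 * \<bar>y - y'\<bar>"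
        and XV: "\<forall>y\<in>{p1<..<q1}. \<forall>y'\<in>{p1<..<q1}. \<bar>Re (V (Complex X y)) - Re (V (Complex X y')) + Im c * (y - y')\<bar> \<le> \<bar>Im c\<bar> / 2 * \<bar>y - y'\<bar>"
        by (elim exE conjE)
      have X: "X \<ge> 0"
        "\<bar>Re (U (Complex X b)) - Re (U (Complex X a)) + Im c * (b - a)\<bar> \<le> \<bar>Im c\<bar> / 2 * \<bar>b - a\<bar>"
        "\<bar>Re (V (Complex X a)) - Re (V (Complex X (b - 2 * pi))) + Im c * (a - (b - 2 * pi))\<bar> \<le> \<bar>Im c\<bar> / 2 * \<bar>a - (b - 2 * pi)\<bar>"
        using X0 XU[rule_format, of b a] XV[rule_format, of a "b - 2 * pi"] ab by auto
      have "\<bar>Im c * (b - a) + Im c * (a - (b - 2 * pi))\<bar> \<le> \<bar>Im c\<bar> / 2 * (b - a) + \<bar>Im c\<bar> / 2 * (a - (b - 2 * pi))"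
      proof -
        have "\<bar>b - a\<bar> = b - a" "\<bar>a - (b - 2 * pi)\<bar> = a - (b - 2 * pi)" using ab by auto
        thus ?thesis using X(2,3) unfolding Ua(2)[OF X(1)] Ub[OF X(1)] by linarith
      qed
      moreover have "Im c * (b - a) + Im c * (a - (b - 2 * pi)) = Im c * (2 * pi)" by (simp add: algebra_simps)
      moreover have "\<bar>Im c\<bar> / 2 * (b - a) + \<bar>Im c\<bar> / 2 * (a - (b - 2 * pi)) = \<bar>Im c\<bar> / 2 * (2 * pi)"
        by (simp only: distrib_left[symmetric]) simp
      ultimately have "\<bar>Im c * (2 * pi)\<bar> \<le> \<bar>Im c\<bar> / 2 * (2 * pi)" by simp
      thus False using \<open>Im c \<noteq> 0\<close> pi_gt_zero by (simp add: abs_mult)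
    qed
    \<comment> \<open>Over a length of at most \<open>2 * pi\<close> this allows an oscillation of
      1/4. A value of at least 1 somewhere, given by \<open>mx\<close>, then leaves at least 3/4 at
      \<open>a\<close> and at least 1/2 everywhere.\<close>
    define e where "e = 1 / (8 * pi)"
    have e: "e > 0" using pi_gt_zero by (simp add: e_def)
    from osc[OF e] obtain X where X0: "X \<ge> 0"
      and XU: "\<forall>y\<in>{p0<..<q0}. \<forall>y'\<in>{p0<..<q0}. \<bar>Re (U (Complex X y)) - Re (U (Complex X y')) + Im c * (y - y')\<bar> \<le> e * \<bar>y - y'\<bar>"
      and XV: "\<forall>y\<in>{p1<..<q1}. \<forall>y'\<in>{p1<..<q1}. \<bar>Re (V (Complex X y)) - Re (V (Complex X y')) + Im c * (y - y')\<bar> \<le> e * \<bar>y - y'\<bar>"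
      by (elim exE conjE)
    have X: "X \<ge> 0"
      "\<And>y y'. \<lbrakk>p0 < y; y < q0; p0 < y'; y' < q0\<rbrakk> \<Longrightarrow> \<bar>Re (U (Complex X y)) - Re (U (Complex X y'))\<bar> \<le> e * \<bar>y - y'\<bar>"
      "\<And>y y'. \<lbrakk>p1 < y; y < q1; p1 < y'; y' < q1\<rbrakk> \<Longrightarrow> \<bar>Re (V (Complex X y)) - Re (V (Complex X y'))\<bar> \<le> e * \<bar>y - y'\<bar>"
      using X0 XU XV unfolding Imc by simp_all
    have small: "e * \<bar>y - y'\<bar> \<le> 1 / 4" if "\<bar>y - y'\<bar> \<le> 2 * pi" for y y'
    proof -
      have "e * \<bar>y - y'\<bar> \<le> e * (2 * pi)" using that e by (intro mult_left_mono) auto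
      thus ?thesis by (simp add: e_def)
    qed
    have U4: "\<bar>Re (U (Complex X y)) - Re (U (Complex X a))\<bar> \<le> 1 / 4" if "p0 < y" "y < q0" for y
    proof -
      have "\<bar>y - a\<bar> \<le> 2 * pi" using that ab ord unfolding abs_le_iff by linarith
      thus ?thesis using X(2)[OF that ab(1,8)] small by (meson order_trans)
    qed
    have V4: "\<bar>Re (V (Complex X y)) - Re (V (Complex X a))\<bar> \<le> 1 / 4" if "p1 < y" "y < q1" for y
    proof -
      have "\<bar>y - a\<bar> \<le> 2 * pi" using that ab ord unfolding abs_le_iff by linarith
      thus ?thesis using X(3)[OF that ab(7,2)] small by (meson order_trans)
    qed
    have S0: "Complex X y \<in> strip p0 q0" if "p0 < y" "y < q0" for y using that X(1) by (simp add: strip_def)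
    have S1: "Complex X y \<in> strip p1 q1" if "p1 < y" "y < q1" for y using that X(1) by (simp add: strip_def)
    have "Re (U (Complex X a)) \<ge> 3 / 4"
    proof -
      obtain y where "(p0 < y \<and> y < q0 \<and> norm (E0 (Complex X y)) \<ge> exp 1) \<or>
                      (p1 < y \<and> y < q1 \<and> norm (E1 (Complex X y)) \<ge> exp 1)" using mx[OF X(1)] by blast
      hence "(p0 < y \<and> y < q0 \<and> Re (U (Complex X y)) \<ge> 1) \<or> (p1 < y \<and> y < q1 \<and> Re (V (Complex X y)) \<ge> 1)"
        using nE0[OF S0, of y] nE1[OF S1, of y] by auto
      thus ?thesis
      proof (elim disjE conjE)
        assume "p0 < y" "y < q0" "1 \<le> Re (U (Complex X y))"
        thus ?thesis using U4[of y] by linarith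
      next
        assume "p1 < y" "y < q1" "1 \<le> Re (V (Complex X y))"
        thus ?thesis using V4[of y] Ua(2)[OF X(1)] by linarith
      qed
    qed
    note Xa = this
    have "norm (E0 (Complex X y)) > 1" if "p0 < y" "y < q0" for y
    proof -
      have "Re (U (Complex X y)) > 0" using U4[OF that] Xa by linarith
      thus ?thesis using nE0[OF S0[OF that]] by simp
    qed
    moreover have "norm (E1 (Complex X y)) > 1" if "p1 < y" "y < q1" for y
    proof -
      have "Re (V (Complex X y)) > 0" using V4[OF that] Xa Ua(2)[OF X(1)] by linarith
      thus ?thesis using nE1[OF S1[OF that]] by simp
    qed
    ultimately show ?thesis using X(1) by blast
  qed
qed

section \<open>The case of a flat complement\<close>

lemma uniform_limit_normD:
  fixes f :: "nat \<Rightarrow> complex \<Rightarrow> real"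
  assumes "uniform_limit K f h sequentially" "e > 0"
  shows "eventually (\<lambda>n. \<forall>z\<in>K. \<bar>f n z - h z\<bar> < e) sequentially"
  using assms unfolding uniform_limit_iff dist_real_def by auto

text \<open>In the half plane \<open>\<eta> < arg z < \<eta> + pi\<close>, where \<open>g\<close> is not exponentially large, the harmonic
  measure of a disc of radius comparable to \<open>\<bar>t\<bar>\<close> around an edge point \<open>t\<close>, seen from a fixed point, is
  of order \<open>1 / \<bar>t\<bar>\<close>. So a very negative value of \<open>Re V\<close> at \<open>t\<close> would force a very negative value
  \<open>vp\<close> at the fixed point.\<close>

lemma edge_lower_bound:
  fixes g V :: "complex \<Rightarrow> complex" and x A :: "nat \<Rightarrow> real"
  assumes hol: "g holomorphic_on UNIV" and A: "\<And>k. A k > 0"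
    and half: "\<And>e X. e > 0 \<Longrightarrow> eventually (\<lambda>k. \<forall>z. - 1 / 2 \<le> Re z \<longrightarrow> Re z \<le> X \<longrightarrow> \<eta> \<le> Im z \<longrightarrow> Im z \<le> \<eta> + pi
        \<longrightarrow> norm (g (exp (z + of_real (x k)))) \<le> exp (e * A k)) sequentially"
    and ptw: "(\<lambda>k. norm (g (exp (Complex xp (\<eta> + \<tau>) + of_real (x k)))) powr (1 / A k)) \<longlonglongrightarrow> exp vp"
    and \<tau>: "0 < \<tau>" "\<tau> < pi" and xp: "exp xp * sin \<tau> \<ge> 4"
    and V: "V holomorphic_on ball \<zeta> \<delta>" "\<And>z. z \<in> ball \<zeta> \<delta> \<Longrightarrow> Re (V z) \<le> 0" and \<delta>: "0 < \<delta>" "\<delta> \<le> 1"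
    and lim: "uniform_limit (cball \<zeta> (\<delta> / 2)) (\<lambda>k z. norm (g (exp (z + of_real (x k)))) powr (1 / A k))
        (\<lambda>z. exp (Re (V z))) sequentially"
    and t: "exp \<zeta> = of_real t * cis \<eta>" "\<bar>t\<bar> \<ge> 4 * exp xp"
  shows "Re (V \<zeta>) \<ge> 24 / \<delta> * vp * \<bar>t\<bar>"
proof -
  \<comment> \<open>By \<open>norm (Ln (1 + u)) \<le> 2 * norm u\<close>, the circle of radius
    \<open>\<kappa> * R\<close> around \<open>t\<close> corresponds in the logarithmic coordinate to
    points within \<open>\<delta> / 2\<close> of \<open>\<zeta>\<close>. Also
    \<open>\<kappa> \<le> 1 / 8\<close> keeps the circle away from \<open>p\<close>.\<close>
  define \<kappa> where "\<kappa> = \<delta> / 8"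
  have \<kappa>: "0 < \<kappa>" "\<kappa> \<le> 1 / 8" using \<delta> by (auto simp: \<kappa>_def)
  define R where "R = \<bar>t\<bar>"
  define P where "P = exp xp"
  have P4: "P \<ge> 4"
  proof -
    have "exp xp * sin \<tau> \<le> exp xp * 1" by (intro mult_left_mono) auto
    thus ?thesis using xp unfolding P_def by linarith
  qed
  have R: "R \<ge> 4 * P" "R \<ge> 16" "R > 0" using t(2) P4 by (auto simp: R_def P_def)
  define M where "M = - Re (V \<zeta>)"
  have M: "M \<ge> 0" using V(2)[of \<zeta>] \<delta> by (simp add: M_def)
  have Vsmall: "Re (V z) \<le> - M / 3" if "norm (z - \<zeta>) \<le> \<delta> / 2" for z
    using Harnack_disc(1)[OF V \<delta>(1) that] by (simp add: M_def)
  define r where "r = exp (- 1 / 2 :: real)"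
  have r: "0 < r" "r \<le> 1" by (auto simp: r_def)
  \<comment> \<open>With this outer radius \<open>q\<close> is of order \<open>1 / R\<close> on the
    outer arc, as it is on the inner arc \<open>norm z = r\<close>, and \<open>m\<close> bounds it
    on both. The height \<open>Im p \<ge> 4\<close> gives
    \<open>q p \<ge> 64 / 25 * \<kappa> / R\<close>, which exceeds \<open>m\<close> by more than
    \<open>\<kappa> / R\<close>.\<close>
  define R' where "R' = 2 * R\<^sup>2"
  define S where "S = {z. 0 \<le> Im z \<and> r \<le> norm z \<and> norm z \<le> R' \<and> \<kappa> * R \<le> norm (z - of_real t)}"
  define q where "q = (\<lambda>z. \<kappa> * R * Im z / (norm (z - of_real t))\<^sup>2)"
  define m where "m = 6 / 5 * \<kappa> / R"
  define p where "p = exp (Complex xp \<tau>)"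
  have np: "norm p = P" by (simp add: p_def P_def)
  have Imp: "Im p \<ge> 4" using xp by (simp add: p_def Im_exp)
  have dR: "\<kappa> * R > 0" using \<kappa> R by simp
  have pS: "p \<in> S"
  proof -
    have "norm (p - of_real t) \<ge> R - P"
      using norm_triangle_ineq2[of "of_real t" p] by (simp add: np R_def norm_minus_commute)
    moreover have "\<kappa> * R \<le> 1 / 8 * R" using \<kappa> R by (intro mult_right_mono) auto
    ultimately have "\<kappa> * R \<le> norm (p - of_real t)" using R P4 by linarith
    moreover have "P \<le> R'"
    proof -
      have "R * 1 \<le> R * R" using R by (intro mult_left_mono) auto
      thus ?thesis using R P4 unfolding R'_def power2_eq_square mult_1_right by linarith
    qed
    ultimately show ?thesis using Imp r P4 by (simp add: S_def np)
  qed
  have qp: "q p \<ge> 64 / 25 * \<kappa> / R"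
  proof -
    have "norm (p - of_real t) \<le> P + R"
      using norm_triangle_ineq4[of p "of_real t"] by (simp add: np R_def)
    also have "\<dots> \<le> 5 / 4 * R" using R by simp
    finally have "(norm (p - of_real t))\<^sup>2 \<le> (5 / 4 * R)\<^sup>2" by (intro power_mono) auto
    moreover have "(norm (p - of_real t))\<^sup>2 > 0" using pS dR by (auto simp: S_def)
    ultimately have "\<kappa> * R * 4 / (5 / 4 * R)\<^sup>2 \<le> \<kappa> * R * Im p / (norm (p - of_real t))\<^sup>2"
      using Imp dR \<kappa> R by (intro frac_le mult_left_mono mult_nonneg_nonneg) auto
    moreover have "\<kappa> * R * 4 / (5 / 4 * R)\<^sup>2 = 64 / 25 * \<kappa> / R"
      using R by (simp add: power2_eq_square field_simps)
    ultimately show ?thesis by (simp add: q_def)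
  qed
  have m0: "0 \<le> m" using \<kappa> R by (simp add: m_def)
  have qm: "q z \<le> m" if z: "z \<in> S" "norm z = r \<or> norm z = R'" for z
  proof -
    have aux: "q z \<le> m" if "norm z * R\<^sup>2 \<le> 6 / 5 * c\<^sup>2" "c \<le> norm (z - of_real t)" "c > 0" for c
    proof -
      have "Im z \<le> norm z" using abs_Im_le_cmod[of z] by simp
      hence "q z \<le> \<kappa> * R * norm z / c\<^sup>2" unfolding q_def
        using that dR \<kappa> R z(1) by (intro frac_le mult_left_mono power_mono) (auto simp: S_def)
      also have "\<dots> = \<kappa> / R * (norm z * R\<^sup>2 / c\<^sup>2)" using R by (simp add: power2_eq_square field_simps)
      also have "\<dots> \<le> \<kappa> / R * (6 / 5)"
        using that \<kappa> R by (intro mult_left_mono) (auto simp: pos_divide_le_eq)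
      finally show ?thesis by (simp add: m_def)
    qed
    from z(2) show ?thesis
    proof
      assume nz: "norm z = r"
      show ?thesis
      proof (rule aux[of "15 / 16 * R"])
        have "norm z * R\<^sup>2 \<le> 1 * R\<^sup>2" using nz r by (intro mult_right_mono) auto
        also have "\<dots> \<le> 6 / 5 * (15 / 16 * R)\<^sup>2" by (simp add: power_mult_distrib power_divide)
        finally show "norm z * R\<^sup>2 \<le> 6 / 5 * (15 / 16 * R)\<^sup>2" .
        have "norm (z - of_real t) \<ge> R - r"
          using norm_triangle_ineq2[of "of_real t" z] by (simp add: nz R_def norm_minus_commute)
        thus "15 / 16 * R \<le> norm (z - of_real t)" using R r by linarith
      qed (use R in simp)
    next
      assume nz: "norm z = R'"
      show ?thesis
      proof (rule aux[of "31 / 16 * R\<^sup>2"])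
        show "norm z * R\<^sup>2 \<le> 6 / 5 * (31 / 16 * R\<^sup>2)\<^sup>2"
          unfolding nz R'_def using R by (simp add: power_mult_distrib power_divide power2_eq_square zero_le_mult_iff)
        have "16 * R \<le> R\<^sup>2" using R by (simp add: power2_eq_square)
        moreover have "norm (z - of_real t) \<ge> R' - R"
          using norm_triangle_ineq2[of z "of_real t"] by (simp add: nz R_def)
        ultimately show "31 / 16 * R\<^sup>2 \<le> norm (z - of_real t)" unfolding R'_def by linarith
        show "31 / 16 * R\<^sup>2 > 0" using R by simp
      qed
    qed
  qed
  have key: "vp \<le> e + (e + M / 3 * (m - q p))" if e: "e > 0" for e
  proof -
    have ev1: "eventually (\<lambda>k. \<forall>z. - 1 / 2 \<le> Re z \<longrightarrow> Re z \<le> ln R' \<longrightarrow> \<eta> \<le> Im z \<longrightarrow> Im z \<le> \<eta> + pi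
        \<longrightarrow> norm (g (exp (z + of_real (x k)))) \<le> exp (e * A k)) sequentially"
      by (rule half[OF e])
    \<comment> \<open>Chosen so that \<open>exp (- M / 3) + e' = exp (e - M / 3)\<close>: the error
      of the uniform limit becomes an error \<open>e\<close> in the exponent.\<close>
    define e' where "e' = exp (- M / 3) * (exp e - 1)"
    have e': "e' > 0" using e by (simp add: e'_def)
    have ev2: "eventually (\<lambda>k. \<forall>z\<in>cball \<zeta> (\<delta> / 2). \<bar>norm (g (exp (z + of_real (x k)))) powr (1 / A k) - exp (Re (V z))\<bar> < e') sequentially"
      by (rule uniform_limit_normD[OF lim e'])
    have "exp (vp - e) < exp vp" using e by simp
    with ptw have ev3: "eventually (\<lambda>k. norm (g (exp (Complex xp (\<eta> + \<tau>) + of_real (x k)))) powr (1 / A k) > exp (vp - e)) sequentially"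
      by (rule order_tendstoD)
    from eventually_happens'[OF sequentially_bot eventually_conj[OF ev1 eventually_conj[OF ev2 ev3]]]
    obtain k where k0: "\<forall>z. - 1 / 2 \<le> Re z \<longrightarrow> Re z \<le> ln R' \<longrightarrow> \<eta> \<le> Im z \<longrightarrow> Im z \<le> \<eta> + pi
        \<longrightarrow> norm (g (exp (z + of_real (x k)))) \<le> exp (e * A k)"
      "\<forall>z\<in>cball \<zeta> (\<delta> / 2). \<bar>norm (g (exp (z + of_real (x k)))) powr (1 / A k) - exp (Re (V z))\<bar> < e'"
      and k3: "norm (g (exp (Complex xp (\<eta> + \<tau>) + of_real (x k)))) powr (1 / A k) > exp (vp - e)"
      by (elim exE conjE)
    note k1 = k0(1)[rule_format] and k2 = k0(2)[rule_format]
    have Ak: "A k > 0" by (rule A)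
    have root: "b \<le> exp (c * A k)" if "b powr (1 / A k) \<le> exp c" "b \<ge> 0" for b c
    proof (cases "b = 0")
      case False
      hence "ln b / A k \<le> c" using that by (simp add: powr_def)
      hence "ln b \<le> c * A k" using Ak by (simp add: pos_divide_le_eq)
      thus ?thesis using False that(2) by (metis exp_le_cancel_iff exp_ln less_le)
    qed simp
    \<comment> \<open>\<open>G\<close> is \<open>g\<close> rescaled by \<open>exp (x k)\<close> and
      rotated so that the half plane becomes the upper one. Its two edges are the two halves of the
      real axis, so the sign of \<open>t\<close> lets one argument serve both edges.\<close>
    define G where "G = (\<lambda>z. g (exp (of_real (x k)) * cis \<eta> * z))"
    have G_exp: "G (exp z) = g (exp (z + \<i> * of_real \<eta> + of_real (x k)))" for z
      by (simp add: G_def cis_conv_exp exp_add mult_ac)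
    have "norm (G p) \<le> exp (e * A k + A k * (M / 3) * (m - q p))"
      unfolding q_def
    proof (rule Poisson_barrier_half_plane[where r = r and R = R' and t = t and d = "\<kappa> * R"])
      show "G holomorphic_on UNIV" unfolding G_def
        by (rule holomorphic_on_compose_gen[OF _ hol, unfolded o_def]) (auto intro!: holomorphic_intros)
      show "\<kappa> * R > 0" by (rule dR)
      show "A k * (M / 3) \<ge> 0" using Ak M by simp
      show "0 \<le> m" by (rule m0)
      show "p \<in> {z. 0 \<le> Im z \<and> r \<le> cmod z \<and> cmod z \<le> R' \<and> \<kappa> * R \<le> cmod (z - complex_of_real t)}"
        using pS by (simp add: S_def)
    next
      fix z assume "z \<in> {z. 0 \<le> Im z \<and> r \<le> cmod z \<and> cmod z \<le> R' \<and> \<kappa> * R \<le> cmod (z - complex_of_real t)}"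
        and "cmod z = r \<or> cmod z = R'"
      thus "\<kappa> * R * Im z / (cmod (z - complex_of_real t))\<^sup>2 \<le> m"
        using qm[of z] by (simp add: S_def q_def)
    next
      fix z assume "z \<in> {z. 0 \<le> Im z \<and> r \<le> cmod z \<and> cmod z \<le> R' \<and> \<kappa> * R \<le> cmod (z - complex_of_real t)}"
      hence z: "0 \<le> Im z" "r \<le> norm z" "norm z \<le> R'" by auto
      have z0: "z \<noteq> 0" using z r by auto
      have "- 1 / 2 = ln r" by (simp add: r_def)
      also have "\<dots> \<le> ln (norm z)" using z r by (subst ln_le_cancel_iff) auto
      finally have lo: "- 1 / 2 \<le> ln (norm z)" .
      have up: "ln (norm z) \<le> ln R'" using z z0 R by (subst ln_le_cancel_iff) (auto simp: R'_def)
      have "0 \<le> Im (Ln z)" using z(1) z0 Im_Ln_pos_le by auto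
      moreover have "Im (Ln z) \<le> pi" by (rule Im_Ln_le_pi[OF z0])
      ultimately have "norm (g (exp (Ln z + \<i> * of_real \<eta> + of_real (x k)))) \<le> exp (e * A k)"
        using lo up z0 by (intro k1) auto
      thus "norm (G z) \<le> exp (e * A k)" using G_exp[of "Ln z"] z0 by simp
    next
      fix z assume "cmod (z - complex_of_real t) = \<kappa> * R"
      define u where "u = (z - of_real t) / of_real t"
      have t0: "t \<noteq> 0" using R by (auto simp: R_def)
      have nu: "norm u = \<kappa>" using \<open>cmod (z - complex_of_real t) = \<kappa> * R\<close> R t0
        by (simp add: u_def norm_divide R_def)
      have zu: "z = of_real t * (1 + u)" using t0 by (simp add: u_def field_simps)
      have u1: "1 + u \<noteq> 0"
      proof
        assume "1 + u = 0"
        hence "u = - 1" by (simp add: eq_neg_iff_add_eq_0 add.commute)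
        thus False using nu \<kappa> by simp
      qed
      define s where "s = \<zeta> + Ln (1 + u)"
      have "norm (s - \<zeta>) \<le> 2 * \<kappa>" using norm_Ln_le[of u] nu \<kappa> by (simp add: s_def)
      hence ns: "norm (s - \<zeta>) \<le> \<delta> / 2" using \<delta> by (simp add: \<kappa>_def)
      have "exp s = of_real t * cis \<eta> * (1 + u)" using u1 by (simp add: s_def exp_add t(1))
      hence Gz: "G z = g (exp (s + of_real (x k)))" by (simp add: G_def zu exp_add mult_ac)
      have "norm (G z) powr (1 / A k) \<le> exp (Re (V s)) + e'"
        using k2[of s] ns unfolding Gz by (simp add: dist_norm norm_minus_commute)
      also have "\<dots> \<le> exp (- M / 3) + e'" using Vsmall[OF ns] by simp
      also have "\<dots> = exp (e - M / 3)" by (simp add: e'_def right_diff_distrib flip: exp_add)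
      finally have "norm (G z) \<le> exp ((e - M / 3) * A k)" by (intro root) auto
      thus "norm (G z) \<le> exp (e * A k - A k * (M / 3))" by (simp add: algebra_simps)
    qed
    hence "norm (G p) \<le> exp ((e + M / 3 * (m - q p)) * A k)" by (simp add: algebra_simps)
    moreover have Gp: "G p = g (exp (Complex xp (\<eta> + \<tau>) + of_real (x k)))"
    proof -
      have "Complex xp \<tau> + \<i> * of_real \<eta> = Complex xp (\<eta> + \<tau>)" by (simp add: complex_eq_iff)
      thus ?thesis using G_exp[of "Complex xp \<tau>"] by (simp add: p_def)
    qed
    ultimately have "norm (G p) powr (1 / A k) \<le> exp ((e + M / 3 * (m - q p)) * A k) powr (1 / A k)"
      using Ak by (intro powr_mono2) auto
    also have "\<dots> = exp (e + M / 3 * (m - q p))" using Ak by (simp add: powr_def)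
    finally have "norm (G p) powr (1 / A k) \<le> exp (e + M / 3 * (m - q p))" .
    from less_le_trans[OF k3[folded Gp] this] have "vp - e < e + M / 3 * (m - q p)"
      unfolding exp_less_cancel_iff .
    thus ?thesis by linarith
  qed
  have "vp \<le> M / 3 * (m - q p)"
  proof (rule field_le_epsilon)
    fix e :: real assume "e > 0"
    thus "vp \<le> M / 3 * (m - q p) + e" using key[of "e / 2"] by simp
  qed
  also have "\<dots> \<le> M / 3 * (- \<kappa> / R)"
  proof (rule mult_left_mono)
    have "m - q p \<le> 6 / 5 * \<kappa> / R - 64 / 25 * \<kappa> / R" using qp by (simp add: m_def)
    also have "\<dots> = - (34 / 25) * (\<kappa> / R)" by (simp add: field_simps)
    also have "\<dots> \<le> - 1 * (\<kappa> / R)" using \<kappa> R by (intro mult_right_mono) auto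
    finally show "m - q p \<le> - \<kappa> / R" by simp
  qed (use M in simp)
  \<comment> \<open>The factor 3 is Harnack's; with \<open>\<kappa> = \<delta> / 8\<close> this
    gives the constant \<open>24 / \<delta>\<close>.\<close>
  finally have "vp * (3 * R / \<kappa>) \<le> M / 3 * (- \<kappa> / R) * (3 * R / \<kappa>)"
    using \<kappa> R by (intro mult_right_mono) auto
  also have "\<dots> = - M" using \<kappa> R by simp
  finally have "M \<le> - (vp * (3 * R / \<kappa>))" by simp
  also have "vp * (3 * R / \<kappa>) = 24 / \<delta> * vp * R" by (simp add: \<kappa>_def)
  finally show ?thesis by (simp add: M_def R_def)
qed

lemma ball_subset_strip:
  assumes "d - 1 \<le> x" "p + d \<le> y" "y + d \<le> q"
  shows "ball (Complex x y) d \<subseteq> strip p q"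
proof
  fix z assume "z \<in> ball (Complex x y) d"
  hence "norm (z - Complex x y) < d" by (simp add: dist_norm norm_minus_commute)
  hence "\<bar>Re z - x\<bar> < d" "\<bar>Im z - y\<bar> < d"
    using abs_Re_le_cmod[of "z - Complex x y"] abs_Im_le_cmod[of "z - Complex x y"] by auto
  thus "z \<in> strip p q" using assms unfolding strip_def by (auto simp: abs_less_iff)
qed

text \<open>In the applications \<open>g\<close> is \<open>f - 1\<close>, or \<open>f\<close> with
  the strips exchanged. In both transition sectors \<open>flat\<close> gives
  \<open>norm (E z) \<le> 1\<close>, while \<open>mx\<close> places a modulus of at least
  \<open>exp 1\<close> between them. Once Phragmen-Lindelof bounds \<open>E\<close> by
  \<open>exp 1\<close> there, that point is an interior maximum, \<open>E\<close> is constant, and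
  the transition sectors contradict \<open>mx\<close>.\<close>

lemma no_flat_complement:
  fixes g E :: "complex \<Rightarrow> complex" and x A :: "nat \<Rightarrow> real"
  assumes ord: "p0 < q1" "q1 < p1 + 2 * pi" "p1 + 2 * pi < q0" "q0 < p0 + 2 * pi"
    and wide: "q0 - p0 > pi" "q1 - p1 > pi"
    and hol: "g holomorphic_on UNIV" and A: "\<And>k. A k > 0"
    and E: "E holomorphic_on strip p1 q1" "\<And>z. z \<in> strip p1 q1 \<Longrightarrow> E z \<noteq> 0"
    and lim: "\<And>K. \<lbrakk>compact K; K \<subseteq> strip p1 q1\<rbrakk> \<Longrightarrow>
       uniform_limit K (\<lambda>k z. norm (g (exp (z + of_real (x k)))) powr (1 / A k)) (\<lambda>z. norm (E z)) sequentially"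
    and flat: "\<And>K e. \<lbrakk>compact K; K \<subseteq> strip p0 q0; e > 0\<rbrakk> \<Longrightarrow>
       eventually (\<lambda>k. \<forall>z\<in>K. norm (g (exp (z + of_real (x k)))) \<le> exp (e * A k)) sequentially"
    and up: "\<And>z. z \<in> strip p1 q1 \<Longrightarrow> norm (E z) \<le> exp (2 * exp (\<nu> * max 0 (Re z)))" and \<nu>: "\<nu> > 0"
    and up0: "\<And>z. z \<in> strip p1 q1 \<Longrightarrow> Re z \<le> 0 \<Longrightarrow> norm (E z) \<le> exp 1"
    and mx: "p1 < y0" "y0 < q1" "norm (E (Complex 0 y0)) \<ge> exp 1"
  shows False
proof -
  have lim1: "(\<lambda>k. norm (g (exp (z + of_real (x k)))) powr (1 / A k)) \<longlonglongrightarrow> norm (E z)" if "z \<in> strip p1 q1" for z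
    using tendsto_uniform_limitI[OF lim[of "{z}"]] that by auto
  have le1: "norm (E z) \<le> 1"
    if z: "z \<in> strip p1 q1" and w: "w \<in> strip p0 q0" "\<And>k. exp (w + of_real (x k)) = exp (z + of_real (x k))" for z w
  proof (rule field_le_epsilon)
    fix e :: real assume e: "e > 0"
    have l: "ln (1 + e) > 0" using e by simp
    have "eventually (\<lambda>k. norm (g (exp (w + of_real (x k)))) \<le> exp (ln (1 + e) * A k)) sequentially"
      using flat[of "{w}", OF _ _ l] w(1) by simp
    hence "eventually (\<lambda>k. norm (g (exp (z + of_real (x k)))) powr (1 / A k) \<le> 1 + e) sequentially"
    proof eventually_elim
      case (elim k)
      have "norm (g (exp (z + of_real (x k)))) powr (1 / A k) \<le> exp (ln (1 + e) * A k) powr (1 / A k)"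
        using elim A[of k] by (intro powr_mono2) (auto simp: w(2))
      also have "\<dots> = 1 + e" using A[of k] e by (simp add: powr_def)
      finally show ?case .
    qed
    with lim1[OF z] show "norm (E z) \<le> 1 + e" by (rule tendsto_upperbound) simp
  qed
  have T1: "norm (E z) \<le> 1" if "z \<in> strip p0 q1" for z
    by (rule le1[of z z]) (use that ord in \<open>auto simp: strip_def\<close>)
  have T2: "norm (E z) \<le> 1" if "z \<in> strip p1 (q0 - 2 * pi)" for z
  proof (rule le1[of z "z + 2 * pi * \<i>"])
    show "exp (z + 2 * pi * \<i> + of_real (x k)) = exp (z + of_real (x k))" for k
      by (simp add: exp_add)
  qed (use that ord in \<open>auto simp: strip_def\<close>)
  \<comment> \<open>Both \<open>\<eta>\<close> and \<open>\<eta> - pi\<close> must lie in transition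
    sectors, modulo \<open>2 * pi\<close>. The lower and upper constraints are compatible by the
    order of the edges and because both strips are wider than \<open>pi\<close>.\<close>
  define \<eta> where "\<eta> = (max p0 (p1 + pi) + min q1 (q0 - pi)) / 2"
  have \<eta>: "p0 < \<eta>" "\<eta> < q1" "p1 < \<eta> - pi" "\<eta> - pi < q0 - 2 * pi"
    using ord wide by (auto simp: \<eta>_def max_def min_def field_simps)
  have mem0: "Complex 0 \<eta> \<in> strip p1 q1" using \<eta> pi_gt_zero by (auto simp: strip_def intro: less_trans)
  obtain V where V: "V holomorphic_on strip p1 q1" "\<And>z. z \<in> strip p1 q1 \<Longrightarrow> exp (V z) = E z"
    using holomorphic_logarithm_exists[OF strip_basic(2,1) E mem0] by blast
  have nE: "norm (E z) = exp (Re (V z))" if "z \<in> strip p1 q1" for z using V(2)[OF that] by (metis norm_exp_eq_Re)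
  have dV: "(V has_field_derivative deriv V z) (at z)" if "z \<in> strip p1 q1" for z
    using holomorphic_derivI[OF V(1) strip_basic(1) that] .
  have sub1: "strip p0 q1 \<subseteq> strip p1 q1" using ord by (auto simp: strip_def)
  have sub2: "strip p1 (q0 - 2 * pi) \<subseteq> strip p1 q1" using ord by (auto simp: strip_def)
  have V1: "Re (V z) \<le> 0" if "z \<in> strip p0 q1" for z
    using T1[OF that] nE[OF subsetD[OF sub1 that]] by simp
  have V2: "Re (V z) \<le> 0" if "z \<in> strip p1 (q0 - 2 * pi)" for z
    using T2[OF that] nE[OF subsetD[OF sub2 that]] by simp
  have Vup: "Re (V z) \<le> 2 * exp (\<nu> * max 0 (Re z))" if "z \<in> strip p1 q1" for z
    using up[OF that] nE[OF that] by simp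
  \<comment> \<open>Discs of radius \<open>\<delta>\<close> around edge points with nonnegative real
    part stay in the transition sectors, where \<open>Re V\<close> is nonpositive.\<close>
  define \<delta> where "\<delta> = Min {1, \<eta> - p0, q1 - \<eta>, \<eta> - pi - p1, q0 - 2 * pi - (\<eta> - pi)}"
  have \<delta>: "0 < \<delta>" "\<delta> \<le> 1" "\<delta> \<le> \<eta> - p0" "\<delta> \<le> q1 - \<eta>" "\<delta> \<le> \<eta> - pi - p1" "\<delta> \<le> q0 - 2 * pi - (\<eta> - pi)"
    using \<eta> by (auto simp: \<delta>_def)
  have ball1: "ball (Complex u \<eta>) \<delta> \<subseteq> strip p0 q1" and ball2: "ball (Complex u (\<eta> - pi)) \<delta> \<subseteq> strip p1 (q0 - 2 * pi)"
    if "u \<ge> 0" for u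
    using that \<delta> by (intro ball_subset_strip; linarith)+
  \<comment> \<open>The fixed point \<open>Complex xp (\<eta> + \<tau>)\<close> has to lie inside
    the half plane and also in the strip of \<open>E\<close>, where a limit is available;
    \<open>xp\<close> makes the height of its image over the edge at least 4.\<close>
  define \<tau> where "\<tau> = min 1 ((q1 - \<eta>) / 2)"
  have \<tau>: "0 < \<tau>" "\<tau> < pi" "\<eta> + \<tau> < q1" using \<eta> pi_gt3 by (auto simp: \<tau>_def min_def field_simps)
  have sin: "sin \<tau> > 0" using \<tau> by (intro sin_gt_zero)
  define xp where "xp = max 0 (ln (4 / sin \<tau>))"
  have xp: "xp \<ge> 0" "exp xp * sin \<tau> \<ge> 4"
  proof -
    show "xp \<ge> 0" by (simp add: xp_def)
    have "exp (ln (4 / sin \<tau>)) \<le> exp xp" by (simp add: xp_def)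
    hence "4 / sin \<tau> \<le> exp xp" using sin by simp
    thus "exp xp * sin \<tau> \<ge> 4" using sin by (simp add: pos_divide_le_eq)
  qed
  have memp: "Complex xp (\<eta> + \<tau>) \<in> strip p1 q1" using \<tau> \<eta> xp pi_gt_zero by (auto simp: strip_def intro: less_trans)
  define vp where "vp = Re (V (Complex xp (\<eta> + \<tau>)))"
  have ptw: "(\<lambda>k. norm (g (exp (Complex xp (\<eta> + \<tau>) + of_real (x k)))) powr (1 / A k)) \<longlonglongrightarrow> exp vp"
    using lim1[OF memp] nE[OF memp] by (simp add: vp_def)
  have half: "eventually (\<lambda>k. \<forall>z. - 1 / 2 \<le> Re z \<longrightarrow> Re z \<le> X \<longrightarrow> \<eta> \<le> Im z \<longrightarrow> Im z \<le> \<eta> + pi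
        \<longrightarrow> norm (g (exp (z + of_real (x k)))) \<le> exp (e * A k)) sequentially" if "e > 0" for e X
  proof -
    have "cbox (Complex (- 1 / 2) \<eta>) (Complex X (\<eta> + pi)) \<subseteq> strip p0 q0"
      using \<eta> by (auto simp: strip_def in_cbox_complex_iff)
    from flat[OF compact_cbox this that] show ?thesis
      by eventually_elim (auto simp: in_cbox_complex_iff)
  qed
  \<comment> \<open>The summand \<open>ln 4\<close> yields the separation
    \<open>\<bar>t\<bar> \<ge> 4 * exp xp\<close> required of edge points.\<close>
  define x0 where "x0 = xp + ln 4"
  have x0: "x0 \<ge> 0" using xp by (simp add: x0_def)
  define C where "C = - (24 / \<delta> * vp)"
  have edge: "Re (V \<zeta>) \<ge> - C * exp u \<and> norm (deriv V \<zeta>) \<le> 2 / \<delta> * C * exp u"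
    if u: "u \<ge> x0" and S: "ball \<zeta> \<delta> \<subseteq> T" "T \<subseteq> strip p1 q1" "\<And>z. z \<in> T \<Longrightarrow> Re (V z) \<le> 0"
      and t: "exp \<zeta> = of_real t * cis \<eta>" "\<bar>t\<bar> = exp u" for u \<zeta> t T
  proof
    have sub: "ball \<zeta> \<delta> \<subseteq> strip p1 q1" using S by blast
    have neg: "Re (V z) \<le> 0" if "z \<in> ball \<zeta> \<delta>" for z using S that by blast
    have holV: "V holomorphic_on ball \<zeta> \<delta>" by (rule holomorphic_on_subset[OF V(1) sub])
    have K: "cball \<zeta> (\<delta> / 2) \<subseteq> strip p1 q1" using \<delta> by (intro order_trans[OF _ sub]) auto
    have "uniform_limit (cball \<zeta> (\<delta> / 2)) (\<lambda>k z. norm (g (exp (z + of_real (x k)))) powr (1 / A k)) (\<lambda>z. norm (E z)) sequentially"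
      using K by (intro lim) auto
    hence ul: "uniform_limit (cball \<zeta> (\<delta> / 2)) (\<lambda>k z. norm (g (exp (z + of_real (x k)))) powr (1 / A k)) (\<lambda>z. exp (Re (V z))) sequentially"
      by (rule uniform_limit_cong'[THEN iffD1, rotated -1]) (use K nE in auto)
    have "exp u \<ge> exp x0" using u by simp
    hence t4: "\<bar>t\<bar> \<ge> 4 * exp xp" using t(2) by (simp add: x0_def exp_add)
    show lo: "Re (V \<zeta>) \<ge> - C * exp u"
      using edge_lower_bound[OF hol A half ptw \<tau>(1,2) xp(2) holV neg \<delta>(1,2) ul t(1) t4] t(2)
      by (simp add: C_def)
    have "norm (deriv V \<zeta>) \<le> - (2 / \<delta>) * Re (V \<zeta>)" by (rule Harnack_disc(2)[OF holV neg \<delta>(1)])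
    also have "\<dots> \<le> - (2 / \<delta>) * (- C * exp u)" using lo \<delta> by (intro mult_left_mono_neg) auto
    finally show "norm (deriv V \<zeta>) \<le> 2 / \<delta> * C * exp u" by simp
  qed
  define B1 where "B1 = 2 / \<delta> * C"
  have edge1: "Re (V (Complex u \<eta>)) \<ge> - C * exp u" and dedge1: "norm (deriv V (Complex u \<eta>)) \<le> B1 * exp u"
    if u: "u \<ge> x0" for u
  proof -
    have "exp (Complex u \<eta>) = of_real (exp u) * cis \<eta>" by (simp add: exp_eq_polar)
    from edge[OF u ball1 sub1 V1 this] u x0
    show "Re (V (Complex u \<eta>)) \<ge> - C * exp u" "norm (deriv V (Complex u \<eta>)) \<le> B1 * exp u"
      by (simp_all add: B1_def)
  qed
  have dedge2: "norm (deriv V (Complex u (\<eta> - pi))) \<le> B1 * exp u" if u: "u \<ge> x0" for u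
  proof -
    have "exp (Complex u (\<eta> - pi)) = of_real (- exp u) * cis \<eta>" by (simp add: exp_eq_polar complex_eq_iff)
    from edge[OF u ball2 sub2 V2 this] u x0 show ?thesis by (simp add: B1_def)
  qed
  have C0: "C \<ge> 0"
  proof -
    have "Re (V (Complex x0 \<eta>)) \<le> 0" using V1 ball1[OF x0] \<delta> by (meson centre_in_ball subsetD)
    hence "0 \<le> C * exp x0" using edge1[of x0] by simp
    thus ?thesis by (simp add: zero_le_mult_iff)
  qed
  \<comment> \<open>The growth of \<open>E\<close> may exceed what the Phragmen-Lindelof principle permits in this sector, but
    \<open>deriv V\<close> has polynomial growth in \<open>exp z\<close>.\<close>
  define \<mu> where "\<mu> = max \<nu> 1"
  have \<mu>: "\<mu> > 0" "\<mu> \<ge> 1" "\<mu> \<ge> \<nu>" by (auto simp: \<mu>_def)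
  have up\<mu>: "Re (V z) \<le> 2 * exp (\<mu> * max 0 (Re z))" if "z \<in> strip p1 q1" for z
  proof -
    have "\<nu> * max 0 (Re z) \<le> \<mu> * max 0 (Re z)" using \<mu> by (intro mult_right_mono) auto
    hence "2 * exp (\<nu> * max 0 (Re z)) \<le> 2 * exp (\<mu> * max 0 (Re z))" by simp
    thus ?thesis using Vup[OF that] by linarith
  qed
  have lo\<mu>: "Re (V (Complex u \<eta>)) \<ge> - C * exp (\<mu> * u)" if "u \<ge> x0" for u
  proof -
    have "1 * u \<le> \<mu> * u" using \<mu> that x0 by (intro mult_right_mono) auto
    hence "C * exp u \<le> C * exp (\<mu> * u)" using C0 by (intro mult_left_mono) auto
    thus ?thesis using edge1[OF that] by linarith
  qed
  have p1\<eta>: "p1 < \<eta>" using \<eta> pi_gt_zero by linarith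
  obtain D where D: "D > 0" "\<And>u y. \<lbrakk>u \<ge> x0; \<eta> - pi \<le> y; y \<le> \<eta>\<rbrakk> \<Longrightarrow> norm (deriv V (Complex u y)) \<le> D * exp (\<mu> * u)"
    by (rule strip_log_derivative_bound[OF V(1) up\<mu> \<mu>(1) p1\<eta> \<eta>(2) x0 lo\<mu> \<eta>(3) \<eta>(2)]) auto
  define B where "B = max 1 (max B1 (D * exp (\<mu> * x0) * exp (- x0)))"
  define Y where "Y = (\<lambda>z. deriv V z * exp (- z))"
  have nY: "norm (Y z) = norm (deriv V z) * exp (- Re z)" for z by (simp add: Y_def norm_mult)
  \<comment> \<open>On both edges \<open>deriv V\<close> is of order \<open>exp u\<close>, so
    \<open>Y\<close> is bounded there. The strip has width \<open>pi\<close>, and small exponents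
    are available because polynomial growth in \<open>exp (Re w)\<close> is far below
    \<open>exp (C * exp (Re w / 4))\<close>; the constant comes from
    \<open>1 + x / 4 \<le> exp (x / 4)\<close>.\<close>
  have Ybound: "norm (Y z) \<le> B" if z: "x0 \<le> Re z" "\<eta> - pi \<le> Im z" "Im z \<le> \<eta>" for z
  proof (rule Phragmen_Lindelof_half_strip[OF _ strip_basic(1)[of p1 q1], where Y = Y and z = z and ?x0.0 = x0 and a = "\<eta> - pi" and b = \<eta> and s = "1/2" and m = "1/4" and C = "\<bar>ln D\<bar> + 4 * \<mu>"])
    show "Y holomorphic_on strip p1 q1" unfolding Y_def
      by (intro holomorphic_intros holomorphic_deriv V(1) strip_basic(1))
    show "{z. x0 \<le> Re z \<and> \<eta> - pi \<le> Im z \<and> Im z \<le> \<eta>} \<subseteq> strip p1 q1"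
      using \<eta> x0 by (auto simp: strip_def)
    show "1 / 2 * (\<eta> - (\<eta> - pi)) < pi" using pi_gt_zero by simp
    show "B > 0" by (simp add: B_def less_max_iff_disj)
  next
    fix w assume w: "x0 \<le> Re w" "\<eta> - pi \<le> Im w" "Im w \<le> \<eta>"
    have "norm (Y w) \<le> D * exp (\<mu> * Re w) * exp (- Re w)"
      unfolding nY using D(2)[OF w] by (intro mult_right_mono) auto
    also have "\<dots> \<le> D * exp (\<mu> * Re w) * 1" using w(1) x0 D(1) by (intro mult_left_mono) auto
    also have "\<dots> = exp (ln D + \<mu> * Re w)" using D(1) by (simp add: exp_add)
    also have "\<dots> \<le> exp ((\<bar>ln D\<bar> + 4 * \<mu>) * exp (1 / 4 * Re w))"
    proof -
      have "(\<bar>ln D\<bar> + 4 * \<mu>) * (1 + Re w / 4) \<le> (\<bar>ln D\<bar> + 4 * \<mu>) * exp (1 / 4 * Re w)"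
        using exp_ge_add_one_self[of "1 / 4 * Re w"] \<mu> by (intro mult_left_mono) auto
      moreover have "(\<bar>ln D\<bar> + 4 * \<mu>) * (1 + Re w / 4) = \<bar>ln D\<bar> + \<bar>ln D\<bar> * (Re w / 4) + 4 * \<mu> + \<mu> * Re w"
        by (simp add: algebra_simps)
      moreover have "\<bar>ln D\<bar> * (Re w / 4) \<ge> 0" using w(1) x0 by (intro mult_nonneg_nonneg) auto
      ultimately have "ln D + \<mu> * Re w \<le> (\<bar>ln D\<bar> + 4 * \<mu>) * exp (1 / 4 * Re w)" using \<mu> by linarith
      thus ?thesis by simp
    qed
    finally show "norm (Y w) \<le> exp ((\<bar>ln D\<bar> + 4 * \<mu>) * exp (1 / 4 * Re w))" .
    have side: "norm (Y w) \<le> B1" if "norm (deriv V w) \<le> B1 * exp (Re w)"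
    proof -
      have "norm (Y w) \<le> B1 * exp (Re w) * exp (- Re w)" unfolding nY using that by (intro mult_right_mono) auto
      thus ?thesis by (simp add: mult.assoc flip: exp_add)
    qed
    assume "Re w = x0 \<or> Im w = \<eta> - pi \<or> Im w = \<eta>"
    thus "norm (Y w) \<le> B"
    proof (elim disjE)
      assume "Re w = x0"
      moreover have "norm (deriv V w) \<le> D * exp (\<mu> * Re w)" using D(2)[OF w] by simp
      ultimately have "norm (Y w) \<le> D * exp (\<mu> * x0) * exp (- x0)" by (simp add: nY mult_right_mono)
      thus ?thesis by (simp add: B_def)
    next
      assume "Im w = \<eta> - pi"
      hence "norm (Y w) \<le> B1" using dedge2[OF w(1)] by (intro side) (metis complex.collapse)
      thus ?thesis by (simp add: B_def)
    next
      assume "Im w = \<eta>"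
      hence "norm (Y w) \<le> B1" using dedge1[OF w(1)] by (intro side) (metis complex.collapse)
      thus ?thesis by (simp add: B_def)
    qed
  qed (use z in auto)
  have B: "B \<ge> 1" by (simp add: B_def)
  have dVB: "norm (deriv V (Complex u y)) \<le> B * exp u" if "u \<ge> x0" "\<eta> - pi \<le> y" "y \<le> \<eta>" for u y
  proof -
    have "norm (deriv V (Complex u y)) * exp (- u) \<le> B" using Ybound[of "Complex u y"] that by (simp add: nY)
    hence "norm (deriv V (Complex u y)) * exp (- u) * exp u \<le> B * exp u" by (intro mult_right_mono) auto
    thus ?thesis by (simp add: mult.assoc flip: exp_add)
  qed
  have Vgrow: "Re (V (Complex u y)) \<le> 2 * exp (\<nu> * x0) + B * exp u * u" if u: "u \<ge> x0" and y: "\<eta> - pi \<le> y" "y \<le> \<eta>" for u y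
  proof -
    have mem: "Complex s y \<in> strip p1 q1" if "s \<ge> x0" for s using that x0 y \<eta> by (auto simp: strip_def)
    have "norm (Re (V (Complex u y)) - Re (V (Complex x0 y))) \<le> B * exp u * norm (u - x0)"
    proof (rule field_differentiable_bound[of "{x0..u}" "\<lambda>s. Re (V (Complex s y))" "\<lambda>s. Re (deriv V (Complex s y))"])
      fix s assume s: "s \<in> {x0..u}"
      show "((\<lambda>s. Re (V (Complex s y))) has_real_derivative Re (deriv V (Complex s y))) (at s within {x0..u})"
        using s by (intro has_field_derivative_at_within[OF Re_has_horizontal_derivative] dV mem) auto
      have "norm (Re (deriv V (Complex s y))) \<le> norm (deriv V (Complex s y))" by (simp add: abs_Re_le_cmod)
      also have "\<dots> \<le> B * exp s" using dVB[of s y] s y by simp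
      also have "\<dots> \<le> B * exp u" using s B by (intro mult_left_mono) auto
      finally show "norm (Re (deriv V (Complex s y))) \<le> B * exp u" .
    qed (use u in auto)
    moreover have "B * exp u * norm (u - x0) \<le> B * exp u * u"
      using u x0 B by (intro mult_left_mono) auto
    moreover have "Re (V (Complex x0 y)) \<le> 2 * exp (\<nu> * x0)" using Vup[OF mem[of x0]] x0 by simp
    ultimately show ?thesis by simp
  qed
  \<comment> \<open>A sector of angle less than \<open>pi\<close>, in which the new bound on \<open>V\<close> is of admissible growth for \<open>E\<close>.\<close>
  define \<eta>' where "\<eta>' = \<eta> - min 1 ((\<eta> - p0) / 2)"
  have \<eta>': "p0 < \<eta>'" "\<eta>' < \<eta>" "\<eta> - pi < \<eta>'" using \<eta> pi_gt3 by (auto simp: \<eta>'_def min_def field_simps)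
  define \<gamma> where "\<gamma> = \<eta>' - (\<eta> - pi)"
  have \<gamma>: "0 < \<gamma>" "\<gamma> < pi" using \<eta>' by (auto simp: \<gamma>_def)
  \<comment> \<open>\<open>Vgrow\<close> has order \<open>u * exp u\<close>, so the growth exponent
    \<open>m\<close> must exceed 1. There is room for \<open>1 < m < s < pi / \<gamma>\<close>
    because the angle \<open>\<gamma>\<close> is below \<open>pi\<close>.\<close>
  define s where "s = (1 + pi / \<gamma>) / 2"
  have s: "1 < s" "s * \<gamma> < pi" using \<gamma> by (auto simp: s_def field_simps)
  define m where "m = (1 + s) / 2"
  have m: "1 < m" "m < s" using s by (auto simp: m_def)
  define C3 where "C3 = 2 * exp (\<nu> * x0) * exp m + B / (m - 1)"
  \<comment> \<open>The left side is at \<open>- 1 / 2\<close> instead of 0, so that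
    \<open>Complex 0 y0\<close> becomes an interior point; on that side \<open>up0\<close> gives the
    bound \<open>exp 1\<close>.\<close>
  have Eb: "norm (E z) \<le> exp 1" if z: "- 1 / 2 \<le> Re z" "\<eta> - pi \<le> Im z" "Im z \<le> \<eta>'" for z
  proof (rule Phragmen_Lindelof_half_strip[OF E(1) strip_basic(1), where z = z and ?x0.0 = "- 1 / 2" and a = "\<eta> - pi" and b = \<eta>' and s = s and m = m and C = C3])
    show "{z. - 1 / 2 \<le> Re z \<and> \<eta> - pi \<le> Im z \<and> Im z \<le> \<eta>'} \<subseteq> strip p1 q1"
      using \<eta> \<eta>' by (auto simp: strip_def)
    show "s * (\<eta>' - (\<eta> - pi)) < pi" using s by (simp add: \<gamma>_def)
  next
    fix w assume w: "- 1 / 2 \<le> Re w" "\<eta> - pi \<le> Im w" "Im w \<le> \<eta>'"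
    have mem: "w \<in> strip p1 q1" using w \<eta> \<eta>' by (auto simp: strip_def)
    have em: "1 \<le> exp m * exp (m * Re w)"
    proof -
      have "0 \<le> m * (1 + Re w)" using m w by (intro mult_nonneg_nonneg) auto
      hence "1 \<le> exp (m * (1 + Re w))" by simp
      thus ?thesis by (simp add: exp_add distrib_left)
    qed
    have c1: "2 * exp (\<nu> * x0) \<le> 2 * exp (\<nu> * x0) * exp m * exp (m * Re w)"
      using mult_left_mono[OF em, of "2 * exp (\<nu> * x0)"] by (simp add: mult.assoc)
    have "Re (V w) \<le> C3 * exp (m * Re w)"
    proof (cases "Re w \<ge> x0")
      case True
      have "Re (V w) \<le> 2 * exp (\<nu> * x0) + B * exp (Re w) * Re w"
        using Vgrow[OF True w(2)] w \<eta>' by simp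
      also have "B * exp (Re w) * Re w \<le> B / (m - 1) * exp (m * Re w)"
      proof -
        have "(m - 1) * Re w \<le> exp ((m - 1) * Re w)" using exp_ge_add_one_self[of "(m - 1) * Re w"] by linarith
        hence "Re w \<le> exp ((m - 1) * Re w) / (m - 1)" using m by (simp add: pos_le_divide_eq mult.commute)
        hence "B * exp (Re w) * Re w \<le> B * exp (Re w) * (exp ((m - 1) * Re w) / (m - 1))"
          using B by (intro mult_left_mono) auto
        also have "\<dots> = B / (m - 1) * (exp (Re w) * exp ((m - 1) * Re w))" by simp
        also have "exp (Re w) * exp ((m - 1) * Re w) = exp (m * Re w)" by (simp add: exp_add[symmetric] algebra_simps)
        finally show ?thesis .
      qed
      finally show ?thesis using c1 unfolding C3_def distrib_right by linarith
    next
      case False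
      have "\<nu> * max 0 (Re w) \<le> \<nu> * x0" using False x0 \<nu> by (intro mult_left_mono) auto
      hence "2 * exp (\<nu> * max 0 (Re w)) \<le> 2 * exp (\<nu> * x0)" by simp
      hence "Re (V w) \<le> 2 * exp (\<nu> * x0) * exp m * exp (m * Re w)" using Vup[OF mem] c1 by linarith
      moreover have "0 \<le> B / (m - 1) * exp (m * Re w)" using B m by simp
      ultimately show ?thesis unfolding C3_def distrib_right by linarith
    qed
    thus "norm (E w) \<le> exp (C3 * exp (m * Re w))" using nE[OF mem] by simp
    assume "Re w = - 1 / 2 \<or> Im w = \<eta> - pi \<or> Im w = \<eta>'"
    thus "norm (E w) \<le> exp 1"
    proof (elim disjE)
      assume "Re w = - 1 / 2"
      thus ?thesis using up0[OF mem] by simp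
    next
      assume "Im w = \<eta> - pi"
      hence "w \<in> strip p1 (q0 - 2 * pi)" using w \<eta> by (auto simp: strip_def)
      from T2[OF this] show ?thesis by (rule order_trans) simp
    next
      assume "Im w = \<eta>'"
      hence "w \<in> strip p0 q1" using w \<eta> \<eta>' by (auto simp: strip_def)
      from T1[OF this] show ?thesis by (rule order_trans) simp
    qed
  qed (use z s m in auto)
  have notle: "\<not> norm (E (Complex 0 y0)) \<le> 1"
  proof -
    have "(1::real) < exp 1" by simp
    thus ?thesis using mx(3) by linarith
  qed
  have y1: "y0 < \<eta>'" 
  proof (rule ccontr)
    assume "\<not> ?thesis"
    hence "Complex 0 y0 \<in> strip p0 q1" using mx \<eta>' by (auto simp: strip_def)
    thus False using T1 notle by blast
  qed
  have y2: "\<eta> - pi < y0"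
  proof (rule ccontr)
    assume "\<not> ?thesis"
    hence "Complex 0 y0 \<in> strip p1 (q0 - 2 * pi)" using mx \<eta> by (auto simp: strip_def)
    thus False using T2 notle by blast
  qed
  define Q where "Q = {z. Re z > - 1 / 2} \<inter> {z. Im z > \<eta> - pi} \<inter> {z. Im z < \<eta>'}"
  have "E constant_on strip p1 q1"
  proof (rule maximum_modulus_principle[OF E(1) strip_basic(1,3), of Q "Complex 0 y0"])
    show "open Q" unfolding Q_def by (intro open_Int open_halfspace_Re_gt open_halfspace_Im_gt open_halfspace_Im_lt)
    show "Q \<subseteq> strip p1 q1" using \<eta> \<eta>' by (auto simp: Q_def strip_def)
    show "Complex 0 y0 \<in> Q" using y1 y2 by (simp add: Q_def)
    show "norm (E z) \<le> norm (E (Complex 0 y0))" if "z \<in> Q" for z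
      using Eb[of z] that mx(3) by (auto simp: Q_def)
  qed
  then obtain c where c: "\<And>z. z \<in> strip p1 q1 \<Longrightarrow> E z = c" by (auto simp: constant_on_def)
  have "Complex 0 y0 \<in> strip p1 q1" using mx by (simp add: strip_def)
  hence "E (Complex 0 y0) = E (Complex 0 \<eta>)" using c mem0 by metis
  moreover have "norm (E (Complex 0 \<eta>)) \<le> 1" using T1[of "Complex 0 \<eta>"] \<eta> by (simp add: strip_def)
  ultimately show False using notle by simp
qed

section \<open>Coordinates of the sectors and growth\<close>

lemma closed_sectorE:
  assumes "closed_sector S \<theta>"
  obtains \<alpha> \<beta> where "\<alpha> < \<beta>" "\<beta> - \<alpha> < 2 * pi" "\<theta> = \<beta> - \<alpha>"
    "\<And>z. z \<in> S \<longleftrightarrow> (\<exists>r t. z = of_real r * cis t \<and> 0 \<le> r \<and> \<alpha> \<le> t \<and> t \<le> \<beta>)"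
  using assms unfolding closed_sector_def by blast

lemma cis_shift: "cis (t + 2 * pi * of_int n) = cis t"
proof -
  have "cis (t + 2 * pi * of_int n) = cis t * cis (2 * pi * of_int n)" by (simp only: cis_mult)
  also have "cis (2 * pi * of_int n) = 1" by (simp add: complex_eq_iff)
  finally show ?thesis by simp
qed

lemma exp_notin_sector:
  assumes S: "\<And>z. z \<in> S \<longleftrightarrow> (\<exists>r t. z = of_real r * cis t \<and> 0 \<le> r \<and> \<alpha> \<le> t \<and> t \<le> \<beta>)"
    and z: "\<beta> < Im z" "Im z < \<alpha> + 2 * pi"
  shows "exp z \<notin> S"
proof
  assume "exp z \<in> S"
  then obtain r t where rt: "exp z = of_real r * cis t" "0 \<le> r" "\<alpha> \<le> t" "t \<le> \<beta>" using S by blast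
  have "r > 0" using rt(1,2) by (cases "r = 0") auto
  hence "exp z = exp (Complex (ln r) t)" using rt(1) by (simp add: exp_eq_polar)
  then obtain n :: int where "Im z = t + 2 * pi * n" by (auto simp: exp_eq)
  hence "2 * pi * n > 0" "2 * pi * n < 2 * pi * 1" using rt z by linarith+
  hence "n > 0" "n < 1" by (simp_all add: zero_less_mult_iff)
  thus False by simp
qed

lemma disjoint_sectors_coordinates:
  assumes S0: "closed_sector S0 \<theta>0" and S1: "closed_sector S1 \<theta>1" and disj: "S0 \<inter> S1 = {0}"
    and small: "\<theta>0 < pi" "\<theta>1 < pi"
  obtains p0 q1 p1 q0 c w where
    "p0 < q1" "q1 < p1 + 2 * pi" "p1 + 2 * pi < q0" "q0 < p0 + 2 * pi"
    "q0 - p0 = 2 * pi - \<theta>0" "q1 - p1 = 2 * pi - \<theta>1"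
    "\<And>z. p0 < Im z \<Longrightarrow> Im z < q0 \<Longrightarrow> exp z \<notin> S0" "\<And>z. p1 < Im z \<Longrightarrow> Im z < q1 \<Longrightarrow> exp z \<notin> S1"
    "c > 0" "\<And>z. z \<in> S0 \<Longrightarrow> Re (z * w) \<ge> c * norm z" "\<And>z. z \<in> S1 \<Longrightarrow> Re (z * w) \<le> - c * norm z"
proof -
  obtain \<alpha>0 \<beta>0 where 0: "\<alpha>0 < \<beta>0" "\<theta>0 = \<beta>0 - \<alpha>0"
    "\<And>z. z \<in> S0 \<longleftrightarrow> (\<exists>r t. z = of_real r * cis t \<and> 0 \<le> r \<and> \<alpha>0 \<le> t \<and> t \<le> \<beta>0)"
    using closed_sectorE[OF S0] by metis
  obtain a b where ab: "a < b" "\<theta>1 = b - a"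
    "\<And>z. z \<in> S1 \<longleftrightarrow> (\<exists>r t. z = of_real r * cis t \<and> 0 \<le> r \<and> a \<le> t \<and> t \<le> b)"
    using closed_sectorE[OF S1] by metis
  \<comment> \<open>Shifting the arguments of \<open>S1\<close> by \<open>2 * pi * n\<close> makes
    them start within one turn from \<open>\<alpha>0\<close>; disjointness then forces
    \<open>\<beta>0 < \<alpha>1\<close> and \<open>\<beta>1 < \<alpha>0 + 2 * pi\<close>.\<close>
  define n where "n = \<lceil>(\<alpha>0 - a) / (2 * pi)\<rceil>"
  have "(\<alpha>0 - a) / (2 * pi) \<le> n" "n < (\<alpha>0 - a) / (2 * pi) + 1" unfolding n_def by linarith+
  hence n: "\<alpha>0 \<le> a + 2 * pi * n" "a + 2 * pi * n < \<alpha>0 + 2 * pi" by (simp_all add: field_simps)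
  define \<alpha>1 \<beta>1 where "\<alpha>1 = a + 2 * pi * n" and "\<beta>1 = b + 2 * pi * n"
  have 1: "\<alpha>1 < \<beta>1" "\<theta>1 = \<beta>1 - \<alpha>1" using ab by (auto simp: \<alpha>1_def \<beta>1_def)
  have mem1: "z \<in> S1 \<longleftrightarrow> (\<exists>r t. z = of_real r * cis t \<and> 0 \<le> r \<and> \<alpha>1 \<le> t \<and> t \<le> \<beta>1)" for z
  proof -
    have "(\<exists>r t. z = of_real r * cis t \<and> 0 \<le> r \<and> a \<le> t \<and> t \<le> b) \<longleftrightarrow>
          (\<exists>r t. z = of_real r * cis t \<and> 0 \<le> r \<and> \<alpha>1 \<le> t \<and> t \<le> \<beta>1)" (is "?L \<longleftrightarrow> ?R")
    proof
      assume ?L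
      then obtain r t where "z = of_real r * cis t" "0 \<le> r" "a \<le> t" "t \<le> b" by blast
      thus ?R by (intro exI[of _ r] exI[of _ "t + 2 * pi * n"]) (simp add: cis_shift \<alpha>1_def \<beta>1_def)
    next
      assume ?R
      then obtain r t where rt: "z = of_real r * cis t" "0 \<le> r" "\<alpha>1 \<le> t" "t \<le> \<beta>1" by blast
      have "cis (t + 2 * pi * of_int (- n)) = cis t" by (rule cis_shift)
      thus ?L using rt by (intro exI[of _ r] exI[of _ "t + 2 * pi * of_int (- n)"]) (simp add: \<alpha>1_def \<beta>1_def)
    qed
    thus ?thesis using ab(3) by simp
  qed
  have unit0: "cis t \<in> S0" if "\<alpha>0 \<le> t" "t \<le> \<beta>0" for t
    unfolding 0(3) using that by (intro exI[of _ 1] exI[of _ t]) simp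
  have unit1: "cis t \<in> S1" if "\<alpha>1 \<le> t" "t \<le> \<beta>1" for t
    unfolding mem1 using that by (intro exI[of _ 1] exI[of _ t]) simp
  have nocommon: False if "cis t \<in> S0" "cis t \<in> S1" for t
  proof -
    have "cis t = 0" using that disj by blast
    thus False by simp
  qed
  have o1: "\<beta>0 < \<alpha>1"
  proof (rule ccontr)
    assume "\<not> ?thesis"
    thus False using nocommon unit0[of \<alpha>1] unit1[of \<alpha>1] n 1 by (simp add: \<alpha>1_def)
  qed
  have o2: "\<beta>1 < \<alpha>0 + 2 * pi"
  proof (rule ccontr)
    assume "\<not> ?thesis"
    hence "cis (\<alpha>0 + 2 * pi) \<in> S1" using n unit1[of "\<alpha>0 + 2 * pi"] by (simp add: \<alpha>1_def)
    moreover have "cis (\<alpha>0 + 2 * pi) = cis \<alpha>0" using cis_shift[of \<alpha>0 1] by simp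
    ultimately show False using nocommon[of \<alpha>0] unit0[of \<alpha>0] 0(1) by simp
  qed
  \<comment> \<open>The four constraints say that \<open>S0\<close> lies in the open half plane
    around direction \<open>\<psi>\<close> and \<open>S1\<close> in the opposite one, apart from the
    vertex. They are compatible because both openings are below \<open>pi\<close> and both gaps are
    positive; compactness of the arcs turns the strict signs into the constant
    \<open>c\<close>.\<close>
  define \<psi> where "\<psi> = (max (\<beta>0 - pi / 2) (\<beta>1 - 3 * pi / 2) + min (\<alpha>0 + pi / 2) (\<alpha>1 - pi / 2)) / 2"
  have \<psi>: "\<beta>0 - pi / 2 < \<psi>" "\<beta>1 - 3 * pi / 2 < \<psi>" "\<psi> < \<alpha>0 + pi / 2" "\<psi> < \<alpha>1 - pi / 2"
    using small 0 1 o1 o2 by (auto simp: \<psi>_def max_def min_def field_simps)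
  have cont: "continuous_on T (\<lambda>t. cos (t - \<psi>))" for T by (intro continuous_intros)
  obtain t0 where t0: "t0 \<in> {\<alpha>0..\<beta>0}" "\<And>t. t \<in> {\<alpha>0..\<beta>0} \<Longrightarrow> cos (t0 - \<psi>) \<le> cos (t - \<psi>)"
    using continuous_attains_inf[OF compact_Icc _ cont, of \<alpha>0 \<beta>0] 0(1) by auto
  obtain t1 where t1: "t1 \<in> {\<alpha>1..\<beta>1}" "\<And>t. t \<in> {\<alpha>1..\<beta>1} \<Longrightarrow> cos (t - \<psi>) \<le> cos (t1 - \<psi>)"
    using continuous_attains_sup[OF compact_Icc _ cont, of \<alpha>1 \<beta>1] 1(1) by auto
  have c0: "cos (t0 - \<psi>) > 0" using t0(1) \<psi> by (intro cos_gt_zero_pi) auto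
  have c1: "cos (t1 - \<psi>) < 0" using t1(1) \<psi> by (intro cos_lt_zero_pi) auto
  define c where "c = min (cos (t0 - \<psi>)) (- cos (t1 - \<psi>))"
  have Re: "Re (of_real r * cis t * cis (- \<psi>)) = r * cos (t - \<psi>)" for r t
    unfolding mult.assoc cis_mult by simp
  show ?thesis
  proof (rule that[of \<beta>0 \<alpha>1 "\<beta>1 - 2 * pi" "\<alpha>0 + 2 * pi" c "cis (- \<psi>)"])
    show "exp z \<notin> S0" if "\<beta>0 < Im z" "Im z < \<alpha>0 + 2 * pi" for z
      by (rule exp_notin_sector[OF 0(3) that])
    show "exp z \<notin> S1" if "\<beta>1 - 2 * pi < Im z" "Im z < \<alpha>1" for z
    proof -
      have "exp (z + 2 * pi * \<i>) \<notin> S1"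
        by (rule exp_notin_sector[OF mem1]) (use that in auto)
      thus ?thesis by (simp add: exp_add)
    qed
    show "c > 0" using c0 c1 by (simp add: c_def)
    show "Re (z * cis (- \<psi>)) \<ge> c * norm z" if zS: "z \<in> S0" for z
    proof -
      obtain r t where rt: "z = of_real r * cis t" "0 \<le> r" "\<alpha>0 \<le> t" "t \<le> \<beta>0" using 0(3)[THEN iffD1, OF zS] by blast
      have "c \<le> cos (t - \<psi>)" using t0(2)[of t] rt by (simp add: c_def)
      hence "c * r \<le> cos (t - \<psi>) * r" using rt(2) by (rule mult_right_mono)
      thus ?thesis unfolding rt(1) Re using rt(2) by (simp add: norm_mult mult.commute)
    qed
    show "Re (z * cis (- \<psi>)) \<le> - c * norm z" if zS: "z \<in> S1" for z
    proof -
      obtain r t where rt: "z = of_real r * cis t" "0 \<le> r" "\<alpha>1 \<le> t" "t \<le> \<beta>1" using mem1[THEN iffD1, OF zS] by blast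
      have "cos (t - \<psi>) \<le> - c" using t1(2)[of t] rt by (simp add: c_def)
      hence "cos (t - \<psi>) * r \<le> - c * r" using rt(2) by (rule mult_right_mono)
      thus ?thesis unfolding rt(1) Re using rt(2) by (simp add: norm_mult mult.commute)
    qed
  qed (use o1 o2 0 1 in auto)
qed

section \<open>Maximum modulus and Polya peaks\<close>

lemma max_modulus_props:
  assumes hol: "f holomorphic_on UNIV"
  shows norm_le_max_modulus: "norm (f z) \<le> max_modulus f (norm z)"
    and max_modulus_attained: "r \<ge> 0 \<Longrightarrow> \<exists>z. norm z = r \<and> norm (f z) = max_modulus f r"
    and max_modulus_mono: "0 \<le> r \<Longrightarrow> r \<le> s \<Longrightarrow> max_modulus f r \<le> max_modulus f s"
proof -
  have cont: "continuous_on A (\<lambda>z. norm (f z))" for A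
    using holomorphic_on_imp_continuous_on[OF hol] continuous_on_subset by (blast intro: continuous_on_norm)
  have att: "\<exists>z. norm z = r \<and> norm (f z) = max_modulus f r \<and> (\<forall>w. norm w = r \<longrightarrow> norm (f w) \<le> norm (f z))"
    if r: "r \<ge> 0" for r
  proof -
    have "sphere (0::complex) r \<noteq> {}" using r by (auto intro!: exI[of _ "of_real r"])
    then obtain z where z: "z \<in> sphere 0 r" "\<And>w. w \<in> sphere 0 r \<Longrightarrow> norm (f w) \<le> norm (f z)"
      using continuous_attains_sup[OF compact_sphere _ cont] by metis
    have "max_modulus f r = norm (f z)" unfolding max_modulus_def
      by (rule cSup_eq_maximum) (use z in auto)
    thus ?thesis using z by auto
  qed
  show le: "norm (f z) \<le> max_modulus f (norm z)" for z
    using att[of "norm z"] by auto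
  show "r \<ge> 0 \<Longrightarrow> \<exists>z. norm z = r \<and> norm (f z) = max_modulus f r" using att by blast
  assume r: "0 \<le> r" "r \<le> s"
  obtain z where z: "norm z = r" "norm (f z) = max_modulus f r" using att[OF r(1)] by blast
  have "norm (f z) \<le> max_modulus f s"
  proof (cases "s = 0")
    case True thus ?thesis using r z le by (metis order_antisym)
  next
    case False
    show ?thesis
    proof (rule maximum_modulus_frontier[of f "cball 0 s"])
      show "norm (f w) \<le> max_modulus f s" if "w \<in> frontier (cball 0 s)" for w
        using that le[of w] False by simp
    qed (use z r hol holomorphic_on_subset[OF hol] holomorphic_on_imp_continuous_on[OF hol] in
          \<open>auto intro: continuous_on_subset\<close>)
  qed
  thus "max_modulus f r \<le> max_modulus f s" using z by simp
qed

text \<open>\<open>x\<close> nearly maximises \<open>a y * exp (- (\<mu> + 1) * y)\<close> over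
  \<open>y \<ge> X\<close>; the supremum need not be attained, hence the factor 2. Only
  \<open>s \<ge> 0\<close> is controlled; to the left of a peak the monotonicity of the maximum
  modulus serves instead.\<close>

lemma growth_peak:
  fixes a :: "real \<Rightarrow> real"
  assumes pos: "\<And>y. y \<ge> X \<Longrightarrow> a y > 0" and up: "\<And>y. y \<ge> X \<Longrightarrow> a y \<le> exp (\<mu> * y)"
  shows "\<exists>x\<ge>X. \<forall>s\<ge>0. a (x + s) \<le> 2 * exp ((\<mu> + 1) * s) * a x"
proof -
  define b where "b = (\<lambda>y. a y * exp (- (\<mu> + 1) * y))"
  have bb: "b y \<le> exp (- X)" if y: "y \<ge> X" for y
  proof -
    have "b y \<le> exp (\<mu> * y) * exp (- (\<mu> + 1) * y)" unfolding b_def using up[OF y] by (intro mult_right_mono) auto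
    also have "\<dots> = exp (- y)" by (simp add: exp_add[symmetric] algebra_simps)
    finally show ?thesis using y by (meson exp_le_cancel_iff neg_le_iff_le order_trans)
  qed
  have bpos: "b y > 0" if "y \<ge> X" for y using pos[OF that] by (simp add: b_def)
  have bdd: "bdd_above (b ` {X..})" using bb by (intro bdd_aboveI[of _ "exp (- X)"]) auto
  define B where "B = Sup (b ` {X..})"
  have le: "b y \<le> B" if "y \<ge> X" for y unfolding B_def using bdd that by (intro cSup_upper) auto
  have "B > 0" using le[of X] bpos[of X] by simp
  hence "B / 2 < Sup (b ` {X..})" by (simp add: B_def)
  moreover have "b ` {X..} \<noteq> {}" by auto
  ultimately obtain x where x: "x \<ge> X" "B / 2 < b x"
    using less_cSup_iff[OF _ bdd, of "B / 2"] by auto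
  have "a (x + s) \<le> 2 * exp ((\<mu> + 1) * s) * a x" if s: "s \<ge> 0" for s
  proof -
    have "b (x + s) \<le> 2 * b x" using le[of "x + s"] x s by simp
    hence "b (x + s) * exp ((\<mu> + 1) * (x + s)) \<le> 2 * b x * exp ((\<mu> + 1) * (x + s))" by (intro mult_right_mono) auto
    also have "b (x + s) * exp ((\<mu> + 1) * (x + s)) = a (x + s)"
    proof -
      have "exp (- (\<mu> + 1) * (x + s)) * exp ((\<mu> + 1) * (x + s)) = 1"
        by (simp only: exp_add[symmetric]) (simp add: algebra_simps)
      thus ?thesis by (simp only: b_def mult.assoc mult_1_right)
    qed
    also have "2 * b x * exp ((\<mu> + 1) * (x + s)) = 2 * exp ((\<mu> + 1) * s) * a x"
    proof -
      have "exp (- (\<mu> + 1) * x) * exp ((\<mu> + 1) * (x + s)) = exp ((\<mu> + 1) * s)" 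
        by (simp add: algebra_simps flip: exp_add)
      thus ?thesis by (simp only: b_def mult.assoc) simp
    qed
    finally show ?thesis .
  qed
  thus ?thesis using x by blast
qed

section \<open>Comparison of the limits belonging to the values 0 and 1\<close>

lemma two_root_limit:
  fixes A :: "nat \<Rightarrow> real"
  assumes "filterlim A at_top sequentially"
  shows "(\<lambda>k. 2 powr (1 / A k)) \<longlonglongrightarrow> 1"
proof -
  have "(\<lambda>k. 1 / A k) \<longlonglongrightarrow> 0" using assms by (intro tendsto_divide_0[OF tendsto_const] filterlim_at_top_imp_at_infinity)
  hence "(\<lambda>k. 2 powr (1 / A k)) \<longlonglongrightarrow> 2 powr 0" by (intro tendsto_powr tendsto_const) auto
  thus ?thesis by simp
qed

text \<open>The moduli of \<open>v k\<close> and \<open>v k - 1\<close> differ by at most 1, so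
  after the root of order \<open>A k\<close> each limit is at most the maximum of the other and 1.
  Two limits below 1 would make both moduli less than 1/2 for some \<open>k\<close>.\<close>

lemma root_limits_zero_one:
  fixes A :: "nat \<Rightarrow> real" and v :: "nat \<Rightarrow> complex"
  assumes A: "filterlim A at_top sequentially" "\<And>k. A k > 0"
    and e0: "(\<lambda>k. norm (v k) powr (1 / A k)) \<longlonglongrightarrow> e0" and e1: "(\<lambda>k. norm (v k - 1) powr (1 / A k)) \<longlonglongrightarrow> e1"
  shows "e1 \<le> max e0 1" "e0 \<le> max e1 1" "e0 \<ge> 1 \<or> e1 \<ge> 1"
proof -
  have comp: "l1 \<le> max l0 1" if l: "(\<lambda>k. norm (v0 k) powr (1 / A k)) \<longlonglongrightarrow> l0" "(\<lambda>k. norm (v1 k) powr (1 / A k)) \<longlonglongrightarrow> l1"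
    and tri: "\<And>k. norm (v1 k) \<le> norm (v0 k) + 1" for v0 v1 :: "nat \<Rightarrow> complex" and l0 l1
  proof (rule tendsto_le)
    show "(\<lambda>k. 2 powr (1 / A k) * max (norm (v0 k) powr (1 / A k)) 1) \<longlonglongrightarrow> max l0 1"
      using tendsto_mult[OF two_root_limit[OF A(1)] tendsto_max[OF l(1) tendsto_const]] by simp
    show "\<forall>\<^sub>F k in sequentially. norm (v1 k) powr (1 / A k) \<le> 2 powr (1 / A k) * max (norm (v0 k) powr (1 / A k)) 1"
    proof (rule always_eventually, rule allI)
      fix k
      have "norm (v1 k) \<le> 2 * max (norm (v0 k)) 1" using tri[of k] by (simp add: max_def)
      hence "norm (v1 k) powr (1 / A k) \<le> (2 * max (norm (v0 k)) 1) powr (1 / A k)"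
        using A(2)[of k] by (intro powr_mono2) auto
      also have "\<dots> = 2 powr (1 / A k) * max (norm (v0 k)) 1 powr (1 / A k)" by (intro powr_mult) 
      also have "max (norm (v0 k)) 1 powr (1 / A k) \<le> max (norm (v0 k) powr (1 / A k)) 1"
        by (simp add: max_def)
      finally show "norm (v1 k) powr (1 / A k) \<le> 2 powr (1 / A k) * max (norm (v0 k) powr (1 / A k)) 1" by simp
    qed
  qed (use l in auto)
  have t1: "norm (v k - 1) \<le> norm (v k) + 1" for k using norm_triangle_ineq4[of "v k" 1] by simp
  have t2: "norm (v k) \<le> norm (v k - 1) + 1" for k using norm_triangle_ineq[of "v k - 1" 1] by simp
  show "e1 \<le> max e0 1" by (rule comp[OF e0 e1 t1])
  show "e0 \<le> max e1 1" by (rule comp[OF e1 e0 t2])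
  show "e0 \<ge> 1 \<or> e1 \<ge> 1"
  proof (rule ccontr)
    assume "\<not> ?thesis"
    define c where "c = max (1/2) ((max e0 e1 + 1) / 2)"
    have c: "e0 < c" "e1 < c" "0 < c" "c < 1" using \<open>\<not> _\<close> by (auto simp: c_def max_def field_simps)
    have "filterlim (\<lambda>k. - ln c * A k) at_top sequentially"
      using c by (intro filterlim_tendsto_pos_mult_at_top[OF tendsto_const _ A(1)]) auto
    hence "eventually (\<lambda>k. - ln c * A k > ln 2) sequentially" by (simp add: filterlim_at_top_dense)
    from eventually_conj[OF this eventually_conj[OF order_tendstoD(2)[OF e0 c(1)] order_tendstoD(2)[OF e1 c(2)]]]
    obtain k where k: "- ln c * A k > ln 2" "norm (v k) powr (1 / A k) < c" "norm (v k - 1) powr (1 / A k) < c"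
      using eventually_happens'[OF sequentially_bot] by blast
    have half: "b < 1 / 2" if "b powr (1 / A k) < c" "b \<ge> 0" for b
    proof (cases "b = 0")
      case False
      have "b = (b powr (1 / A k)) powr (A k)" using False that(2) A(2)[of k] by (simp add: powr_powr)
      also have "\<dots> < c powr (A k)" using that c A(2)[of k] by (intro powr_less_mono2) auto
      also have "\<dots> = exp (ln c * A k)" using c by (simp add: powr_def mult.commute)
      also have "\<dots> < exp (- ln 2)" using k(1) by simp
      finally show ?thesis by (simp add: exp_minus)
    qed simp
    have "norm (v k) < 1 / 2" "norm (v k - 1) < 1 / 2" using half k by auto
    thus False using norm_triangle_ineq4[of "v k" "v k - 1"] by simp
  qed
qed

text \<open>Where \<open>norm (G0 z) > 1\<close>, \<open>rel\<close> forces equal moduli; this set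
  is open, so by the maximum principle \<open>G0 / G1\<close> is a unimodular constant on all of
  \<open>S\<close>. If \<open>norm (G0 z) \<le> 1\<close> throughout, either 1 is attained and
  \<open>G0\<close> is constant, or \<open>rel\<close> forces
  \<open>norm (G1 z) = 1\<close>.\<close>

lemma transition_trichotomy:
  fixes G0 G1 :: "complex \<Rightarrow> complex"
  assumes S: "open S" "connected S" and hol: "G0 holomorphic_on S" "G1 holomorphic_on S"
    and nz: "\<And>z. z \<in> S \<Longrightarrow> G1 z \<noteq> 0"
    and rel: "\<And>z. z \<in> S \<Longrightarrow> norm (G1 z) \<le> max (norm (G0 z)) 1" "\<And>z. z \<in> S \<Longrightarrow> norm (G0 z) \<le> max (norm (G1 z)) 1"
      "\<And>z. z \<in> S \<Longrightarrow> norm (G0 z) \<ge> 1 \<or> norm (G1 z) \<ge> 1"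
  shows "(\<forall>z\<in>S. norm (G0 z) = norm (G1 z) \<and> norm (G0 z) \<ge> 1) \<or> (\<forall>z\<in>S. norm (G0 z) = 1) \<or> (\<forall>z\<in>S. norm (G1 z) = 1)"
proof (cases "\<exists>p\<in>S. norm (G0 p) > 1")
  case True
  then obtain p where p: "p \<in> S" "norm (G0 p) > 1" by blast
  have cont: "continuous_on S (\<lambda>z. norm (G0 z))"
    by (intro continuous_on_norm holomorphic_on_imp_continuous_on hol)
  have eq: "norm (G0 z) = norm (G1 z)" if "z \<in> S" "norm (G0 z) > 1" for z
    using rel(1,2)[OF that(1)] that(2) by (auto simp: max_def split: if_splits)
  define T where "T = {z \<in> S. norm (G0 z) > 1}"
  have "open T"
    using continuous_open_preimage[OF cont S(1) open_greaterThan[of 1]] by (simp add: T_def vimage_def Collect_conj_eq)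
  moreover have "(\<lambda>z. G0 z / G1 z) holomorphic_on S" using nz by (intro holomorphic_intros hol)
  moreover have one: "norm (G0 z / G1 z) = 1" if "z \<in> T" for z
    using that eq[of z] nz[of z] by (simp add: T_def norm_divide)
  ultimately have "(\<lambda>z. G0 z / G1 z) constant_on S"
    by (intro maximum_modulus_principle[of _ S T p] S) (use p in \<open>auto simp: T_def\<close>)
  then obtain c where c: "\<And>z. z \<in> S \<Longrightarrow> G0 z / G1 z = c" by (auto simp: constant_on_def)
  have "norm c = 1" using one[of p] c[OF p(1)] p by (simp add: T_def)
  hence "norm (G0 z) = norm (G1 z)" if "z \<in> S" for z
    using c[OF that] nz[OF that] by (auto simp: norm_divide)
  thus ?thesis using rel(3) by fastforce
next
  case False
  hence le0: "norm (G0 z) \<le> 1" if "z \<in> S" for z using that by force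
  show ?thesis
  proof (cases "\<exists>p\<in>S. norm (G0 p) = 1")
    case True
    then obtain p where p: "p \<in> S" "norm (G0 p) = 1" by blast
    have "G0 constant_on S"
      by (rule maximum_modulus_principle[OF hol(1) S S(1) order_refl p(1)]) (use le0 p in auto)
    hence "\<forall>z\<in>S. norm (G0 z) = 1" using p by (auto simp: constant_on_def)
    thus ?thesis by blast
  next
    case False
    have "norm (G1 z) = 1" if "z \<in> S" for z
    proof -
      have "norm (G0 z) < 1" using le0[OF that] False that by (meson order_le_imp_less_or_eq)
      thus ?thesis using rel(1,3)[OF that] by (auto simp: max_def)
    qed
    thus ?thesis by blast
  qed
qed

lemma norm_one_extends:
  assumes "E holomorphic_on S" "open S" "connected S" "open T" "T \<subseteq> S" "T \<noteq> {}" "\<And>z. z \<in> T \<Longrightarrow> norm (E z) = 1"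
    and "z \<in> S"
  shows "norm (E z) = 1"
proof -
  obtain p where p: "p \<in> T" using assms by blast
  have "E constant_on S" by (rule maximum_modulus_principle[of E S T p]) (use assms p in auto)
  thus ?thesis using assms(5,7,8) p unfolding constant_on_def by (metis subsetD)
qed

text \<open>The logarithm of the maximum modulus is measured along \<open>r = exp x\<close>; the points \<open>x k\<close> are
  one-sided Polya peaks.\<close>

lemma peak_sequence:
  assumes hol: "f holomorphic_on UNIV" and np: "\<nexists>p. f = poly p" and ord: "entire_order f < \<infinity>"
  obtains \<nu> :: real and x A :: "nat \<Rightarrow> real" where "\<nu> > 0" "\<forall>k. x k \<ge> X + real k" "\<forall>k. A k \<ge> 1"
    "filterlim A at_top sequentially" "\<forall>N::nat. eventually (\<lambda>k. N * x k \<le> A k) sequentially"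
    "\<forall>k z. Re z \<ge> - 1 \<longrightarrow> norm (f (exp (z + of_real (x k)))) \<le> exp (A k * (2 * exp (\<nu> * max 0 (Re z))))"
    "\<forall>k z. Re z \<ge> - 1 \<longrightarrow> Re z \<le> 0 \<longrightarrow> norm (f (exp (z + of_real (x k)))) \<le> exp (A k)"
    "\<forall>k t. t \<ge> 0 \<longrightarrow> (\<exists>z. Re z = t \<and> norm (f (exp (z + of_real (x k)))) \<ge> exp (A k))"
proof -
  define M where "M = max_modulus f"
  define a where "a = (\<lambda>y. ln (M (exp y)))"
  have growth: "eventually (\<lambda>r. r ^ N \<le> M r) at_top" for N
    by (rule transcendental_growth[OF hol np]) (simp add: M_def norm_le_max_modulus[OF hol])
  have growth': "eventually (\<lambda>y. exp y ^ N \<le> M (exp y)) at_top" for N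
    by (rule eventually_compose_filterlim[OF growth exp_at_top])
  have aN: "eventually (\<lambda>y::real. N * y \<le> a y) at_top" for N :: nat
    using growth'[of N]
  proof eventually_elim
    case (elim y)
    hence "exp (N * y) \<le> M (exp y)" by (simp add: exp_of_nat_mult)
    hence "ln (exp (N * y)) \<le> ln (M (exp y))" by (subst ln_le_cancel_iff) (auto intro: less_le_trans[OF exp_gt_zero])
    thus ?case by (simp add: a_def)
  qed
  obtain n :: nat where "entire_order f < ereal (real n)"
    using ord less_PInf_Ex_of_nat by auto
  hence "eventually (\<lambda>r. ereal (ln (ln (M r)) / ln r) < ereal (real n)) at_top"
    unfolding entire_order_def M_def by (rule Limsup_lessD)
  hence "eventually (\<lambda>r. ln (ln (M r)) / ln r < n) at_top" by simp
  hence "eventually (\<lambda>y. ln (a y) / y < n) at_top"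
    unfolding a_def using eventually_compose_filterlim[OF _ exp_at_top] by fastforce
  with aN[of 1] eventually_gt_at_top[of 0]
  have aup: "eventually (\<lambda>y::real. a y \<le> exp (n * y)) at_top"
  proof eventually_elim
    case (elim y)
    hence "a y > 0" by simp
    moreover have "ln (a y) < n * y" using elim by (simp add: pos_divide_less_eq)
    ultimately show ?case by (metis exp_le_cancel_iff exp_ln less_imp_le)
  qed
  from eventually_conj[OF growth'[of 1] eventually_conj[OF aN[of 1] aup]]
  obtain Y where Y: "\<And>y. y \<ge> Y \<Longrightarrow> exp y \<le> M (exp y)" "\<And>y. y \<ge> Y \<Longrightarrow> y \<le> a y" "\<And>y::real. y \<ge> Y \<Longrightarrow> a y \<le> exp (n * y)"
    unfolding eventually_at_top_linorder by auto
  \<comment> \<open>The summand 1 in \<open>Y + 1\<close> leaves room for points with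
    \<open>Re z \<ge> - 1\<close>, to the left of the peak.\<close>
  define Z where "Z = max 1 (max X (Y + 1))"
  have Mpos: "M (exp y) > 0" if "y \<ge> Y" for y using Y(1)[OF that] by (meson exp_gt_zero less_le_trans)
  have "\<exists>x\<ge>Z + real k. \<forall>s\<ge>0. a (x + s) \<le> 2 * exp ((real n + 1) * s) * a x" for k
  proof (rule growth_peak)
    fix y :: real assume "y \<ge> Z + real k"
    hence y: "y \<ge> Y" "y \<ge> 1" by (auto simp: Z_def)
    show "a y > 0" using Y(2)[OF y(1)] y(2) by linarith
    show "a y \<le> exp (real n * y)" by (rule Y(3)[OF y(1)])
  qed
  then obtain x where x: "\<And>k. x k \<ge> Z + real k"
    "\<And>k s. s \<ge> 0 \<Longrightarrow> a (x k + s) \<le> 2 * exp ((real n + 1) * s) * a (x k)" by metis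
  define A where "A = (\<lambda>k. a (x k))"
  have xY: "x k \<ge> Y + 1" "x k \<ge> 1" "x k \<ge> X + real k" "x k \<ge> real k" for k using x(1)[of k] by (auto simp: Z_def)
  have A1: "A k \<ge> x k" for k unfolding A_def using Y(2)[of "x k"] xY(1)[of k] by simp
  have xlim: "filterlim x at_top sequentially"
    by (rule filterlim_at_top_mono[OF filterlim_real_sequentially]) (use xY(4) in auto)
  have nf: "norm (f (exp (z + of_real (x k)))) \<le> exp (a (x k + t))" if "Re z \<le> t" "- 1 \<le> t" for z k t
  proof -
    have "norm (f (exp (z + of_real (x k)))) \<le> M (norm (exp (z + of_real (x k))))"
      unfolding M_def by (rule norm_le_max_modulus[OF hol])
    also have "\<dots> \<le> M (exp (x k + t))" unfolding M_def
      by (rule max_modulus_mono[OF hol]) (use that in auto)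
    also have "\<dots> = exp (a (x k + t))" unfolding a_def using Mpos[of "x k + t"] xY(1)[of k] that by simp
    finally show ?thesis .
  qed
  show ?thesis
  proof (rule that[of "real n + 1" x A]; (intro allI impI)?)
    show "x k \<ge> X + real k" for k by (rule xY(3))
    show "A k \<ge> 1" for k using A1[of k] xY(2)[of k] by linarith
    show "filterlim A at_top sequentially"
      by (rule filterlim_at_top_mono[OF xlim]) (use A1 in auto)
    show "eventually (\<lambda>k. N * x k \<le> A k) sequentially" for N :: nat
      unfolding A_def using eventually_compose_filterlim[OF aN xlim] .
    show "norm (f (exp (z + of_real (x k)))) \<le> exp (A k)" if "Re z \<ge> - 1" "Re z \<le> 0" for k z
      using nf[of z 0 k] that by (simp add: A_def)
    show "norm (f (exp (z + of_real (x k)))) \<le> exp (A k * (2 * exp ((real n + 1) * max 0 (Re z))))" if "Re z \<ge> - 1" for k z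
    proof -
      have "a (x k + max 0 (Re z)) \<le> A k * (2 * exp ((real n + 1) * max 0 (Re z)))"
        using x(2)[of "max 0 (Re z)" k] by (simp add: A_def mult_ac)
      thus ?thesis using nf[of z "max 0 (Re z)" k] by (meson exp_le_cancel_iff max.cobounded1 max.cobounded2 order_trans neg_le_0_iff_le zero_le_one)
    qed
    show "\<exists>z. Re z = t \<and> norm (f (exp (z + of_real (x k)))) \<ge> exp (A k)" if t: "t \<ge> 0" for k t
    proof -
      obtain w where w: "norm w = exp (x k + t)" "norm (f w) = M (exp (x k + t))"
        using max_modulus_attained[OF hol, of "exp (x k + t)"] by (auto simp: M_def)
      have w0: "w \<noteq> 0" using w(1) by auto
      define z where "z = Ln w - of_real (x k)"
      have "exp (z + of_real (x k)) = w" using w0 by (simp add: z_def)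
      moreover have "Re z = t" using w0 w(1) by (simp add: z_def)
      moreover have "exp (A k) \<le> norm (f w)"
      proof -
        have "exp (A k) = M (exp (x k))" using Mpos[of "x k"] xY(1)[of k] by (simp add: A_def a_def)
        also have "\<dots> \<le> M (exp (x k + t))" unfolding M_def by (rule max_modulus_mono[OF hol]) (use t in auto)
        finally show ?thesis using w(2) by simp
      qed
      ultimately show ?thesis by (intro exI[of _ z]) simp
    qed
  qed simp
qed

text \<open>Carries flatness from \<open>f\<close> to \<open>f - 1\<close> or back: the limit of the
  roots costs \<open>e / 2\<close>, and the other \<open>e / 2\<close> absorbs the factor 2 caused
  by the summand 1.\<close>

lemma eventually_le_exp_of_root_limit_one:
  fixes v w :: "nat \<Rightarrow> complex \<Rightarrow> complex"
  assumes A: "filterlim A at_top sequentially" "\<And>k. A k > 0"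
    and ul: "uniform_limit K (\<lambda>k z. norm (v k z) powr (1 / A k)) (\<lambda>z. 1) sequentially"
    and tri: "\<And>k z. norm (w k z) \<le> norm (v k z) + 1" and e: "e > 0"
  shows "eventually (\<lambda>k. \<forall>z\<in>K. norm (w k z) \<le> exp (e * A k)) sequentially"
proof -
  have e': "exp (e / 2) - 1 > 0" using e by simp
  have "filterlim (\<lambda>k. (e / 2) * A k) at_top sequentially"
    using e by (intro filterlim_tendsto_pos_mult_at_top[OF tendsto_const _ A(1)]) auto
  hence "eventually (\<lambda>k. (e / 2) * A k \<ge> ln 2) sequentially" by (simp add: filterlim_at_top)
  with uniform_limit_normD[OF ul e'] show ?thesis
  proof eventually_elim
    case (elim k)
    show ?case
    proof
      fix z assume z: "z \<in> K"
      have "norm (v k z) powr (1 / A k) \<le> exp (e / 2)" using elim(1) z by force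
      hence "(norm (v k z) powr (1 / A k)) powr (A k) \<le> exp (e / 2) powr (A k)"
        using A(2)[of k] by (intro powr_mono2) auto
      hence "norm (v k z) \<le> exp (e / 2 * A k)" using A(2)[of k] by (simp add: powr_powr powr_def[of "exp _"] mult.commute)
      moreover have "1 \<le> exp (e / 2 * A k)" using e A(2)[of k] by simp
      ultimately have "norm (w k z) \<le> 2 * exp (e / 2 * A k)" using tri[of k z] by linarith
      also have "\<dots> \<le> exp (e / 2 * A k) * exp (e / 2 * A k)"
      proof (rule mult_right_mono)
        have "exp (ln 2) \<le> exp (e / 2 * A k)" using elim(2) by (simp only: exp_le_cancel_iff)
        thus "2 \<le> exp (e / 2 * A k)" by simp
      qed simp
      also have "\<dots> = exp (e * A k)" by (simp flip: exp_add)
      finally show "norm (w k z) \<le> exp (e * A k)" .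
    qed
  qed
qed

section \<open>Existence of large circles\<close>

lemma powr_root_le_iff:
  fixes A b c :: real
  assumes "A > 0" "b \<ge> 0"
  shows "b powr (1 / A) \<le> exp c \<longleftrightarrow> b \<le> exp (A * c)"
proof (cases "b = 0")
  case False
  hence b: "b > 0" using assms by simp
  have "b powr (1 / A) \<le> exp c \<longleftrightarrow> ln b / A \<le> c" using b by (simp add: powr_def)
  also have "\<dots> \<longleftrightarrow> ln b \<le> A * c" using assms by (simp add: pos_divide_le_eq mult.commute)
  also have "\<dots> \<longleftrightarrow> exp (ln b) \<le> exp (A * c)" by simp
  finally show ?thesis using b by simp
qed simp

lemma no_separated_zeros_and_ones:
  fixes f :: "complex \<Rightarrow> complex"
  assumes hol: "f holomorphic_on UNIV" and np: "\<nexists>p. f = poly p" and fin_order: "entire_order f < \<infinity>"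
    and ord: "p0 < q1" "q1 < p1 + 2 * pi" "p1 + 2 * pi < q0" "q0 < p0 + 2 * pi"
    and wide: "q0 - p0 > pi" "q1 - p1 > pi" "max (q0 - p0) (q1 - p1) > 3 * pi / 2"
    and nz: "\<And>z. Re z > X \<Longrightarrow> p0 < Im z \<Longrightarrow> Im z < q0 \<Longrightarrow> f (exp z) \<noteq> 0"
      "\<And>z. Re z > X \<Longrightarrow> p1 < Im z \<Longrightarrow> Im z < q1 \<Longrightarrow> f (exp z) \<noteq> 1"
  shows "\<exists>R\<ge>N. \<forall>z. norm z = R \<longrightarrow> norm (f z) \<ge> R + 2"
proof -
  \<comment> \<open>The offset 2 ensures \<open>x k > X + 1\<close>, as the limits of roots
    require.\<close>
  obtain \<nu> :: real and x A :: "nat \<Rightarrow> real" where \<nu>: "\<nu> > 0"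
    and x': "\<forall>k. x k \<ge> (X + 2) + real k" and A1': "\<forall>k. A k \<ge> 1"
    and Alim: "filterlim A at_top sequentially" and Ax': "\<forall>N::nat. eventually (\<lambda>k. N * x k \<le> A k) sequentially"
    and up': "\<forall>k z. Re z \<ge> - 1 \<longrightarrow> norm (f (exp (z + of_real (x k)))) \<le> exp (A k * (2 * exp (\<nu> * max 0 (Re z))))"
    and up0': "\<forall>k z. Re z \<ge> - 1 \<longrightarrow> Re z \<le> 0 \<longrightarrow> norm (f (exp (z + of_real (x k)))) \<le> exp (A k)"
    and mx': "\<forall>k t. t \<ge> 0 \<longrightarrow> (\<exists>z. Re z = t \<and> norm (f (exp (z + of_real (x k)))) \<ge> exp (A k))"
    by (rule peak_sequence[OF hol np fin_order, of "X + 2"])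
  note x = x'[rule_format] and A1 = A1'[rule_format] and Ax = Ax'[rule_format]
    and up = up'[rule_format] and up0 = up0'[rule_format] and mx = mx'[rule_format]
  have Apos: "A k > 0" for k using A1[of k] by linarith
  define \<Phi> where "\<Phi> = (\<lambda>z. f (exp z))"
  have hol\<Phi>: "\<Phi> holomorphic_on UNIV" "(\<lambda>z. \<Phi> z - 1) holomorphic_on UNIV"
    unfolding \<Phi>_def by (intro holomorphic_intros holomorphic_on_compose_gen[OF _ hol, unfolded o_def]; simp)+
  define \<beta> where "\<beta> = (\<lambda>z::complex. 2 * exp (\<nu> * max 0 (Re z)))"
  have \<beta>bd: "\<exists>B. \<forall>z\<in>K. \<beta> z \<le> B" if cK: "compact K" for K
  proof -
    obtain B where B: "\<And>z. z \<in> K \<Longrightarrow> norm z \<le> B" using compact_imp_bounded[OF cK] by (auto simp: bounded_iff)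
    have "\<beta> z \<le> 2 * exp (\<nu> * max 0 B)" if "z \<in> K" for z
    proof -
      have "Re z \<le> B" using B[OF that] complex_Re_le_cmod[of z] by linarith
      thus ?thesis using \<nu> by (simp add: \<beta>_def max.coboundedI2 mult_left_mono)
    qed
    thus ?thesis by blast
  qed
  have two: "2 \<le> exp (A k)" for k using exp_ge_add_one_self[of "A k"] A1[of k] by linarith
  have up1: "norm (\<Phi> (z + of_real (x k)) - 1) \<le> 2 * exp (A k * b)"
    if "norm (\<Phi> (z + of_real (x k))) \<le> exp (A k * b)" "b \<ge> 0" for z k b
  proof -
    have "norm (\<Phi> (z + of_real (x k)) - 1) \<le> norm (\<Phi> (z + of_real (x k))) + 1"
      using norm_triangle_ineq4[of "\<Phi> (z + of_real (x k))" 1] by simp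
    moreover have "1 \<le> exp (A k * b)" using that(2) Apos[of k] by simp
    ultimately show ?thesis using that(1) by linarith
  qed
  have \<beta>0: "\<beta> z \<ge> 0" for z by (simp add: \<beta>_def)
  have bd\<Phi>: "norm (\<Phi> (z + of_real (x k))) \<le> exp (A k * \<beta> z)" if "Re z \<ge> - 1" for z k
    using up[OF that, of k] by (simp add: \<Phi>_def \<beta>_def)
  obtain E0 r1 where r1: "strict_mono (r1 :: nat \<Rightarrow> nat)" and E0: "E0 holomorphic_on strip p0 q0"
    "(\<forall>z\<in>strip p0 q0. E0 z = 0) \<or> (\<forall>z\<in>strip p0 q0. E0 z \<noteq> 0)"
    and lim0: "\<And>K. \<lbrakk>compact K; K \<subseteq> strip p0 q0\<rbrakk> \<Longrightarrow>
       uniform_limit K (\<lambda>n z. norm (\<Phi> (z + of_real (x (r1 n)))) powr (1 / A (r1 n))) (\<lambda>z. norm (E0 z)) sequentially"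
  proof (rule root_limit[of p0 q0 \<Phi> X x A])
    show "x n > X + 1" for n using x[of n] by simp
    fix K assume K: "compact K" "K \<subseteq> strip p0 q0"
    obtain B where "\<forall>z\<in>K. \<beta> z \<le> B" using \<beta>bd[OF K(1)] by (elim exE)
    hence B: "\<beta> z \<le> B" if "z \<in> K" for z using that by (rule bspec)
    have "norm (\<Phi> (z + of_real (x n))) \<le> exp (A n * B)" if "z \<in> K" for n z
    proof -
      have "Re z \<ge> - 1" using that K(2) by (auto simp: strip_def)
      from bd\<Phi>[OF this] show ?thesis
        by (rule order_trans) (use B[OF that] Apos[of n] in simp)
    qed
    thus "\<exists>B. \<forall>n. \<forall>z\<in>K. norm (\<Phi> (z + of_real (x n))) \<le> exp (A n * B)" by blast
  qed (use ord hol\<Phi> nz Apos in \<open>auto simp: \<Phi>_def\<close>)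
  \<comment> \<open>The second subsequence is extracted from the first, so that along
    \<open>r\<close> both limits hold at the same scales \<open>y n\<close>.\<close>
  obtain E1 r2 where r2: "strict_mono (r2 :: nat \<Rightarrow> nat)" and E1: "E1 holomorphic_on strip p1 q1"
    "(\<forall>z\<in>strip p1 q1. E1 z = 0) \<or> (\<forall>z\<in>strip p1 q1. E1 z \<noteq> 0)"
    and lim1': "\<And>K. \<lbrakk>compact K; K \<subseteq> strip p1 q1\<rbrakk> \<Longrightarrow>
       uniform_limit K (\<lambda>n z. norm (\<Phi> (z + of_real (x (r1 (r2 n)))) - 1) powr (1 / A (r1 (r2 n)))) (\<lambda>z. norm (E1 z)) sequentially"
  proof (rule root_limit[of p1 q1 "\<lambda>z. \<Phi> z - 1" X "\<lambda>n. x (r1 n)" "\<lambda>n. A (r1 n)"])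
    show "p1 < q1" using wide pi_gt_zero by linarith
    show "x (r1 n) > X + 1" for n using x[of "r1 n"] by simp
    fix K assume K: "compact K" "K \<subseteq> strip p1 q1"
    obtain B where "\<forall>z\<in>K. \<beta> z \<le> B" using \<beta>bd[OF K(1)] by (elim exE)
    hence B: "\<beta> z \<le> B" if "z \<in> K" for z using that by (rule bspec)
    have "norm (\<Phi> (z + of_real (x (r1 n))) - 1) \<le> exp (A (r1 n) * (B + 1))" if "z \<in> K" for n z
    proof -
      have "Re z \<ge> - 1" using that K(2) by (auto simp: strip_def)
      have "norm (\<Phi> (z + of_real (x (r1 n))) - 1) \<le> 2 * exp (A (r1 n) * \<beta> z)"
        by (rule up1[OF bd\<Phi>[OF \<open>Re z \<ge> - 1\<close>] \<beta>0])
      also have "\<dots> \<le> exp (A (r1 n)) * exp (A (r1 n) * B)"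
        using two[of "r1 n"] B[OF that] Apos[of "r1 n"] by (intro mult_mono) auto
      also have "\<dots> = exp (A (r1 n) * (B + 1))" by (simp add: distrib_left exp_add mult.commute)
      finally show ?thesis .
    qed
    thus "\<exists>B. \<forall>n. \<forall>z\<in>K. norm (\<Phi> (z + of_real (x (r1 n))) - 1) \<le> exp (A (r1 n) * B)" by blast
  qed (use hol\<Phi> nz Apos in \<open>auto simp: \<Phi>_def\<close>)
  define r where "r = (\<lambda>n. r1 (r2 n))"
  have r: "filterlim r sequentially sequentially"
    using strict_mono_o[OF r1 r2] filterlim_subseq by (auto simp: r_def o_def)
  define y B where "y = (\<lambda>n. x (r n))" and "B = (\<lambda>n. A (r n))"
  have Bpos: "B n > 0" for n using Apos by (simp add: B_def)
  have Blim: "filterlim B at_top sequentially" unfolding B_def by (rule filterlim_compose[OF Alim r])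
  have By: "eventually (\<lambda>k. N * y k \<le> B k) sequentially" for N :: nat
    using eventually_compose_filterlim[OF Ax r] by (simp add: y_def B_def)
  have ylim: "filterlim y at_top sequentially"
  proof -
    have "filterlim (\<lambda>k. (X + 2) + real k) at_top sequentially"
      by (intro filterlim_tendsto_add_at_top[OF tendsto_const] filterlim_real_sequentially)
    hence "filterlim x at_top sequentially" by (rule filterlim_at_top_mono) (use x in auto)
    thus ?thesis unfolding y_def by (rule filterlim_compose[OF _ r])
  qed
  define v where "v = (\<lambda>n z. \<Phi> (z + of_real (y n)))"
  have lim0: "uniform_limit K (\<lambda>n z. norm (v n z) powr (1 / B n)) (\<lambda>z. norm (E0 z)) sequentially"
    if "compact K" "K \<subseteq> strip p0 q0" for K
    using filterlim_compose[OF lim0[OF that] filterlim_subseq[OF r2]] by (simp add: v_def y_def B_def r_def)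
  have lim1: "uniform_limit K (\<lambda>n z. norm (v n z - 1) powr (1 / B n)) (\<lambda>z. norm (E1 z)) sequentially"
    if "compact K" "K \<subseteq> strip p1 q1" for K
    using lim1'[OF that] by (simp add: v_def y_def B_def r_def)
  have pt0: "(\<lambda>n. norm (v n z) powr (1 / B n)) \<longlonglongrightarrow> norm (E0 z)" if "z \<in> strip p0 q0" for z
    using tendsto_uniform_limitI[OF lim0[of "{z}"]] that by auto
  have pt1: "(\<lambda>n. norm (v n z - 1) powr (1 / B n)) \<longlonglongrightarrow> norm (E1 z)" if "z \<in> strip p1 q1" for z
    using tendsto_uniform_limitI[OF lim1[of "{z}"]] that by auto
  have per: "v n (z - 2 * pi * \<i>) = v n z" for n z
  proof -
    have "exp (z - 2 * pi * \<i> + of_real (y n)) = exp (z + of_real (y n))"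
      by (simp add: exp_diff exp_add)
    thus ?thesis by (simp add: v_def \<Phi>_def)
  qed
  have root0: "norm (E0 z) \<le> exp b" if z: "z \<in> strip p0 q0" and b: "\<And>n. norm (v n z) \<le> exp (B n * b)" for z b
    by (rule tendsto_upperbound[OF pt0[OF z]])
       (use powr_root_le_iff[OF Bpos] b in \<open>auto intro!: always_eventually\<close>)
  have root1: "norm (E1 z) \<le> exp b" if z: "z \<in> strip p1 q1" and b: "\<And>n. norm (v n z) \<le> exp (B n * b)" "b \<ge> 0" for z b
  proof (rule tendsto_le[OF _ _ pt1[OF z]])
    show "(\<lambda>n. 2 powr (1 / B n) * exp b) \<longlonglongrightarrow> exp b"
      using tendsto_mult[OF two_root_limit[OF Blim] tendsto_const] by simp
    have "norm (v n z - 1) powr (1 / B n) \<le> 2 powr (1 / B n) * exp b" for n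
    proof -
      have "norm (v n z - 1) \<le> 2 * exp (B n * b)"
        using up1[of z "r n" b] b(1)[of n] b(2) by (simp add: v_def y_def B_def)
      hence "norm (v n z - 1) powr (1 / B n) \<le> (2 * exp (B n * b)) powr (1 / B n)"
        using Bpos[of n] by (intro powr_mono2) auto
      also have "\<dots> = 2 powr (1 / B n) * exp (B n * b) powr (1 / B n)" by (intro powr_mult)
      also have "exp (B n * b) powr (1 / B n) = exp b" using Bpos[of n] by (simp add: powr_def)
      finally show ?thesis .
    qed
    thus "\<forall>\<^sub>F n in sequentially. norm (v n z - 1) powr (1 / B n) \<le> 2 powr (1 / B n) * exp b" by simp
  qed simp
  have upv: "norm (v n z) \<le> exp (B n * \<beta> z)" if "Re z \<ge> - 1" for n z
    using bd\<Phi>[OF that] by (simp add: v_def y_def B_def)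
  have upv0: "norm (v n z) \<le> exp (B n * 1)" if "Re z \<ge> - 1" "Re z \<le> 0" for n z
    using up0[OF that] by (simp add: v_def \<Phi>_def y_def B_def)
  have up_E0: "norm (E0 z) \<le> exp (2 * exp (\<nu> * max 0 (Re z)))" if "z \<in> strip p0 q0" for z
    using root0[OF that, of "\<beta> z"] upv[of z] that by (simp add: \<beta>_def strip_def)
  have up_E1: "norm (E1 z) \<le> exp (2 * exp (\<nu> * max 0 (Re z)))" if "z \<in> strip p1 q1" for z
    using root1[OF that, of "\<beta> z"] upv[of z] that by (simp add: \<beta>_def strip_def)
  have up0_E0: "norm (E0 z) \<le> exp 1" if "z \<in> strip p0 q0" "Re z \<le> 0" for z
    using root0[OF that(1), of 1] upv0[of z] that by (simp add: strip_def)
  have up0_E1: "norm (E1 z) \<le> exp 1" if "z \<in> strip p1 q1" "Re z \<le> 0" for z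
    using root1[OF that(1), of 1] upv0[of z] that by (simp add: strip_def)
  \<comment> \<open>Cutting the circle along the midlines of the transition sectors gives segments
    \<open>K0 t\<close> and \<open>K1 t\<close> that are compact in the open strips and together
    cover the circle; uniform convergence on them controls \<open>f\<close> in all
    directions.\<close>
  define a b where "a = (p0 + q1) / 2" and "b = (p1 + 2 * pi + q0) / 2"
  have ab: "p0 < a" "a < q1" "p1 + 2 * pi < b" "b < q0" "a < b" "b < a + 2 * pi"
    using ord by (auto simp: a_def b_def field_simps)
  define K0 K1 where "K0 = (\<lambda>t. cbox (Complex t a) (Complex t b))" and "K1 = (\<lambda>t. cbox (Complex t (b - 2 * pi)) (Complex t a))"
  have K0: "compact (K0 t)" "K0 t \<subseteq> strip p0 q0" and K1: "compact (K1 t)" "K1 t \<subseteq> strip p1 q1" if "t \<ge> 0" for t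
    using that ab by (auto simp: K0_def K1_def strip_def in_cbox_complex_iff)
  have Kne: "K0 t \<noteq> {}" "K1 t \<noteq> {}" for t
    using ab by (auto simp: K0_def K1_def box_ne_empty Basis_complex_def)
  have cover: "\<exists>w. (w \<in> K0 (Re z) \<or> w \<in> K1 (Re z)) \<and> (\<forall>n. v n w = v n z)" for z
  proof -
    have ex: "v n (Complex (Re z) (Im z + 2 * pi * m)) = v n z" for n and m :: int
    proof -
      have "exp (Complex (Re z) (Im z + 2 * pi * m) + of_real (y n)) = exp (z + of_real (y n))"
        unfolding exp_eq by (rule exI[of _ m]) (simp add: complex_eq_iff)
      thus ?thesis by (simp add: v_def \<Phi>_def)
    qed
    from circle_cover[OF ab(5,6), of "Im z"] show ?thesis
    proof cases
      case (1 m)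
      thus ?thesis using ex[of _ m]
        by (intro exI[of _ "Complex (Re z) (Im z + 2 * pi * m)"]) (simp add: K0_def in_cbox_complex_iff)
    next
      case (2 m)
      thus ?thesis using ex[of _ m]
        by (intro exI[of _ "Complex (Re z) (Im z + 2 * pi * m)"]) (simp add: K1_def in_cbox_complex_iff)
    qed
  qed
  have contE0: "continuous_on (strip p0 q0) (\<lambda>z. norm (E0 z))" and contE1: "continuous_on (strip p1 q1) (\<lambda>z. norm (E1 z))"
    using E0(1) E1(1) by (auto intro: continuous_on_norm holomorphic_on_imp_continuous_on)
  \<comment> \<open>If both limits stayed below \<open>exp 1\<close> on the two segments, uniform
    convergence would contradict the point where \<open>norm f\<close> reaches
    \<open>exp (B k)\<close>. For \<open>f - 1\<close> a factor 2 is lost, but its root tends to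
    1.\<close>
  have big: "\<exists>s. (p0 < s \<and> s < q0 \<and> norm (E0 (Complex t s)) \<ge> exp 1) \<or> (p1 < s \<and> s < q1 \<and> norm (E1 (Complex t s)) \<ge> exp 1)"
    if t: "t \<ge> 0" for t
  proof (rule ccontr)
    assume no: "\<not> ?thesis"
    obtain z0 where z0: "z0 \<in> K0 t" "\<And>z. z \<in> K0 t \<Longrightarrow> norm (E0 z) \<le> norm (E0 z0)"
      using continuous_attains_sup[OF K0(1)[OF t] Kne(1) continuous_on_subset[OF contE0 K0(2)[OF t]]] by auto
    obtain z1 where z1: "z1 \<in> K1 t" "\<And>z. z \<in> K1 t \<Longrightarrow> norm (E1 z) \<le> norm (E1 z1)"
      using continuous_attains_sup[OF K1(1)[OF t] Kne(2) continuous_on_subset[OF contE1 K1(2)[OF t]]] by auto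
    have zz: "Complex t (Im z0) = z0" "Complex t (Im z1) = z1"
      using z0(1) z1(1) by (auto simp: K0_def K1_def in_cbox_complex_iff complex_eq_iff)
    have "z0 \<in> strip p0 q0" "z1 \<in> strip p1 q1" using z0(1) z1(1) K0(2)[OF t] K1(2)[OF t] by auto
    hence lt: "norm (E0 z0) < exp 1" "norm (E1 z1) < exp 1"
      using no zz by (auto simp: strip_def not_le)
    define m where "m = max (norm (E0 z0)) (norm (E1 z1))"
    have m: "m < exp 1" "m \<ge> 0" using lt by (auto simp: m_def le_max_iff_disj)
    define d where "d = (exp 1 - m) / 2"
    have d: "d > 0" "m + d < exp 1" using m by (auto simp: d_def field_simps)
    have "(\<lambda>k. 2 powr (1 / B k) * (m + d)) \<longlonglongrightarrow> 1 * (m + d)"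
      by (intro tendsto_mult two_root_limit[OF Blim] tendsto_const)
    hence ev3: "eventually (\<lambda>k. 2 powr (1 / B k) * (m + d) < exp 1) sequentially"
      using d by (intro order_tendstoD(2)) auto
    from eventually_conj[OF uniform_limit_normD[OF lim0[OF K0[OF t]] d(1)]
         eventually_conj[OF uniform_limit_normD[OF lim1[OF K1[OF t]] d(1)] ev3]]
    obtain k where k: "\<forall>z\<in>K0 t. \<bar>norm (v k z) powr (1 / B k) - norm (E0 z)\<bar> < d"
      "\<forall>z\<in>K1 t. \<bar>norm (v k z - 1) powr (1 / B k) - norm (E1 z)\<bar> < d" "2 powr (1 / B k) * (m + d) < exp 1"
      using eventually_happens'[OF sequentially_bot] by blast
    obtain z where z: "Re z = t" "norm (v k z) \<ge> exp (B k)"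
      using mx[OF t, of "r k"] by (auto simp: v_def \<Phi>_def y_def B_def)
    obtain w where w: "w \<in> K0 t \<or> w \<in> K1 t" "v k w = v k z" using cover[of z] z(1) by auto
    have big_powr: "exp 1 \<le> c powr (1 / B k)" if "exp (B k) \<le> c" for c
    proof -
      have "exp (B k) powr (1 / B k) \<le> c powr (1 / B k)" using that Bpos[of k] by (intro powr_mono2) auto
      thus ?thesis using Bpos[of k] by (simp add: powr_def)
    qed
    from w(1) show False
    proof
      assume wK: "w \<in> K0 t"
      have "norm (v k w) powr (1 / B k) < m + d" using k(1)[rule_format, OF wK] z0(2)[OF wK] by (simp add: m_def)
      moreover have "exp 1 \<le> norm (v k w) powr (1 / B k)" using big_powr z(2) w(2) by simp
      ultimately show False using d(2) by linarith
    next
      assume wK: "w \<in> K1 t"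
      have 1: "norm (v k w - 1) powr (1 / B k) < m + d" using k(2)[rule_format, OF wK] z1(2)[OF wK] by (simp add: m_def)
      have "2 \<le> exp (B k)" using two[of "r k"] by (simp add: B_def)
      moreover have "norm (v k w) \<le> norm (v k w - 1) + 1" using norm_triangle_ineq[of "v k w - 1" 1] by simp
      ultimately have "exp (B k) \<le> 2 * norm (v k w - 1)" using z(2) w(2) by simp
      hence "exp 1 \<le> (2 * norm (v k w - 1)) powr (1 / B k)" by (rule big_powr)
      also have "\<dots> = 2 powr (1 / B k) * norm (v k w - 1) powr (1 / B k)" by (intro powr_mult)
      also have "\<dots> \<le> 2 powr (1 / B k) * (m + d)" using 1 by (intro mult_left_mono) auto
      finally show False using k(3) by linarith
    qed
  qed
  have rel1: "norm (E1 z) \<le> max (norm (E0 z)) 1" "norm (E0 z) \<le> max (norm (E1 z)) 1" "norm (E0 z) \<ge> 1 \<or> norm (E1 z) \<ge> 1"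
    if "z \<in> strip p0 q1" for z
  proof -
    have "z \<in> strip p0 q0" "z \<in> strip p1 q1" using that ord by (auto simp: strip_def)
    from root_limits_zero_one[OF Blim Bpos pt0[OF this(1)] pt1[OF this(2)]]
    show "norm (E1 z) \<le> max (norm (E0 z)) 1" "norm (E0 z) \<le> max (norm (E1 z)) 1" "norm (E0 z) \<ge> 1 \<or> norm (E1 z) \<ge> 1" .
  qed
  define F1 where "F1 = (\<lambda>z. E1 (z - 2 * pi * \<i>))"
  have shift: "z - 2 * pi * \<i> \<in> strip p1 q1" if "z \<in> strip (p1 + 2 * pi) q0" for z
    using that ord by (auto simp: strip_def)
  have rel2: "norm (F1 z) \<le> max (norm (E0 z)) 1" "norm (E0 z) \<le> max (norm (F1 z)) 1" "norm (E0 z) \<ge> 1 \<or> norm (F1 z) \<ge> 1"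
    if z: "z \<in> strip (p1 + 2 * pi) q0" for z
  proof -
    have "z \<in> strip p0 q0" using z ord by (auto simp: strip_def)
    from root_limits_zero_one[OF Blim Bpos pt0[OF this] pt1[OF shift[OF z], unfolded per]]
    show "norm (F1 z) \<le> max (norm (E0 z)) 1" "norm (E0 z) \<le> max (norm (F1 z)) 1" "norm (E0 z) \<ge> 1 \<or> norm (F1 z) \<ge> 1"
      unfolding F1_def .
  qed
  have sub1: "strip p0 q1 \<subseteq> strip p0 q0" "strip p0 q1 \<subseteq> strip p1 q1" and sub2: "strip (p1 + 2 * pi) q0 \<subseteq> strip p0 q0"
    and sub3: "strip p1 (q0 - 2 * pi) \<subseteq> strip p1 q1"
    using ord by (auto simp: strip_def)
  have ne1: "strip p0 q1 \<noteq> {}"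
    using ab by (auto simp: strip_def intro!: exI[of _ "Complex 0 a"])
  have ne2: "strip (p1 + 2 * pi) q0 \<noteq> {}"
    using ab by (auto simp: strip_def intro!: exI[of _ "Complex 0 b"])
  have ne3: "strip p1 (q0 - 2 * pi) \<noteq> {}"
    using ab by (auto simp: strip_def intro!: exI[of _ "Complex 0 (b - 2 * pi)"])
  have ext0: "\<forall>z\<in>strip p0 q0. norm (E0 z) = 1" if "T \<in> {strip p0 q1, strip (p1 + 2 * pi) q0}" "\<forall>z\<in>T. norm (E0 z) = 1" for T
    using norm_one_extends[OF E0(1) strip_basic(1,3), of T] that sub1(1) sub2 ne1 ne2 strip_basic(1) by blast
  have ext1: "\<forall>z\<in>strip p1 q1. norm (E1 z) = 1" if "T \<in> {strip p0 q1, strip p1 (q0 - 2 * pi)}" "\<forall>z\<in>T. norm (E1 z) = 1" for T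
    using norm_one_extends[OF E1(1) strip_basic(1,3), of T] that sub1(2) sub3 ne1 ne3 strip_basic(1) by blast
  have e1: "\<not> exp (1::real) \<le> 1" by simp
  have big1: "\<exists>s. p1 < s \<and> s < q1 \<and> norm (E1 (Complex 0 s)) \<ge> exp 1" if "\<forall>z\<in>strip p0 q0. norm (E0 z) \<le> 1"
  proof (rule ccontr)
    assume "\<not> ?thesis"
    then obtain s where s: "p0 < s" "s < q0" "norm (E0 (Complex 0 s)) \<ge> exp 1" using big[of 0] by auto
    hence "Complex 0 s \<in> strip p0 q0" by (simp add: strip_def)
    thus False using that s(3) e1 by (meson order_trans)
  qed
  have big0: "\<exists>s. p0 < s \<and> s < q0 \<and> norm (E0 (Complex 0 s)) \<ge> exp 1" if "\<forall>z\<in>strip p1 q1. norm (E1 z) \<le> 1"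
  proof (rule ccontr)
    assume "\<not> ?thesis"
    then obtain s where s: "p1 < s" "s < q1" "norm (E1 (Complex 0 s)) \<ge> exp 1" using big[of 0] by auto
    hence "Complex 0 s \<in> strip p1 q1" by (simp add: strip_def)
    thus False using that s(3) e1 by (meson order_trans)
  qed
  have not_both: False if le: "\<forall>z\<in>strip p0 q0. norm (E0 z) \<le> 1" "\<forall>z\<in>strip p1 q1. norm (E1 z) \<le> 1"
  proof -
    obtain s where s: "p1 < s" "s < q1" "norm (E1 (Complex 0 s)) \<ge> exp 1" using big1[OF le(1)] by auto
    hence "Complex 0 s \<in> strip p1 q1" by (simp add: strip_def)
    thus False using le(2) s(3) e1 by (meson order_trans)
  qed
  \<comment> \<open>If \<open>E0\<close> vanished identically, \<open>rel1\<close> would give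
    \<open>norm (E1 z) = 1\<close> in a transition sector, hence in its whole strip, and nothing
    would be left to attain \<open>exp 1\<close>.\<close>
  have nz0: "\<forall>z\<in>strip p0 q0. E0 z \<noteq> 0"
  proof (rule ccontr)
    assume "\<not> ?thesis"
    hence z: "\<forall>z\<in>strip p0 q0. E0 z = 0" using E0(2) by blast
    have "norm (E1 w) = 1" if w: "w \<in> strip p0 q1" for w
      using rel1(1,3)[OF w] bspec[OF z subsetD[OF sub1(1) w]] by auto
    hence "\<forall>z\<in>strip p1 q1. norm (E1 z) = 1" using ext1[of "strip p0 q1"] by blast
    thus False using not_both z by simp
  qed
  have nz1: "\<forall>z\<in>strip p1 q1. E1 z \<noteq> 0"
  proof (rule ccontr)
    assume "\<not> ?thesis"
    hence z: "\<forall>z\<in>strip p1 q1. E1 z = 0" using E1(2) by blast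
    have "norm (E0 w) = 1" if w: "w \<in> strip p0 q1" for w
      using rel1(2,3)[OF w] bspec[OF z subsetD[OF sub1(2) w]] by auto
    hence "\<forall>z\<in>strip p0 q0. norm (E0 z) = 1" using ext0[of "strip p0 q1"] by blast
    thus False using not_both z by simp
  qed
  have not0: "\<not> (\<forall>z\<in>strip p0 q0. norm (E0 z) = 1)"
  proof
    assume one: "\<forall>z\<in>strip p0 q0. norm (E0 z) = 1"
    obtain s where s: "p1 < s" "s < q1" "norm (E1 (Complex 0 s)) \<ge> exp 1" using big1 one by auto
    show False
    proof (rule no_flat_complement[OF ord wide(1,2), of "\<lambda>z. f z - 1" B E1 y \<nu> s])
      show "(\<lambda>z. f z - 1) holomorphic_on UNIV" by (intro holomorphic_intros hol)
      show "uniform_limit K (\<lambda>k z. norm (f (exp (z + of_real (y k))) - 1) powr (1 / B k)) (\<lambda>z. norm (E1 z)) sequentially"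
        if "compact K" "K \<subseteq> strip p1 q1" for K
        using lim1[OF that] by (simp add: v_def \<Phi>_def)
      show "\<forall>\<^sub>F k in sequentially. \<forall>z\<in>K. norm (f (exp (z + of_real (y k))) - 1) \<le> exp (e * B k)"
        if K: "compact K" "K \<subseteq> strip p0 q0" and e: "e > 0" for K e
      proof (rule eventually_le_exp_of_root_limit_one[OF Blim Bpos _ _ e, where v = v])
        show "uniform_limit K (\<lambda>k z. norm (v k z) powr (1 / B k)) (\<lambda>z. 1) sequentially"
          by (rule uniform_limit_cong'[THEN iffD1, OF _ _ lim0[OF K]]) (use K one in auto)
        show "norm (f (exp (z + of_real (y k))) - 1) \<le> norm (v k z) + 1" for k z
          using norm_triangle_ineq4[of "v k z" 1] by (simp add: v_def \<Phi>_def)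
      qed
    qed (use E1 nz1 Bpos up_E1 up0_E1 \<nu> s in auto)
  qed
  have not1: "\<not> (\<forall>z\<in>strip p1 q1. norm (E1 z) = 1)"
  proof
    assume one: "\<forall>z\<in>strip p1 q1. norm (E1 z) = 1"
    obtain s where s: "p0 < s" "s < q0" "norm (E0 (Complex 0 s)) \<ge> exp 1" using big0 one by auto
    \<comment> \<open>The symmetric case: the strip of \<open>E1\<close>, shifted by
      \<open>2 * pi\<close>, takes the place of the flat strip, and the order of the edges is
      preserved by this cyclic change of names.\<close>
    show False
    proof (rule no_flat_complement[of "p1 + 2 * pi" q0 p0 "q1 + 2 * pi" f B E0 y \<nu> s])
      show "uniform_limit K (\<lambda>k z. norm (f (exp (z + of_real (y k)))) powr (1 / B k)) (\<lambda>z. norm (E0 z)) sequentially"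
        if "compact K" "K \<subseteq> strip p0 q0" for K
        using lim0[OF that] by (simp add: v_def \<Phi>_def)
      show "\<forall>\<^sub>F k in sequentially. \<forall>z\<in>K. norm (f (exp (z + of_real (y k)))) \<le> exp (e * B k)"
        if K: "compact K" "K \<subseteq> strip (p1 + 2 * pi) (q1 + 2 * pi)" and e: "e > 0" for K e
      proof -
        define K' where "K' = (\<lambda>z. z - 2 * pi * \<i>) ` K"
        have K': "compact K'" "K' \<subseteq> strip p1 q1"
          using K by (auto simp: K'_def strip_def intro!: compact_continuous_image continuous_intros)
        have "uniform_limit K' (\<lambda>k z. norm (v k z - 1) powr (1 / B k)) (\<lambda>z. 1) sequentially"
          by (rule uniform_limit_cong'[THEN iffD1, OF _ _ lim1[OF K']]) (use K' one in auto)
        moreover have "norm (v k z) \<le> norm (v k z - 1) + 1" for k z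
          using norm_triangle_ineq[of "v k z - 1" 1] by simp
        ultimately have "\<forall>\<^sub>F k in sequentially. \<forall>z\<in>K'. norm (v k z) \<le> exp (e * B k)"
          by (intro eventually_le_exp_of_root_limit_one[OF Blim Bpos _ _ e, where v = "\<lambda>k z. v k z - 1"])
        hence "\<forall>\<^sub>F k in sequentially. \<forall>z\<in>K. norm (v k z) \<le> exp (e * B k)"
          unfolding K'_def ball_simps per .
        thus ?thesis unfolding v_def \<Phi>_def .
      qed
    qed (use ord wide E0 nz0 Bpos up_E0 up0_E0 \<nu> s hol in auto)
  qed
  have hol1: "E0 holomorphic_on strip p0 q1" "E1 holomorphic_on strip p0 q1"
    using E0(1) E1(1) sub1 holomorphic_on_subset by blast+
  have hol2: "E0 holomorphic_on strip (p1 + 2 * pi) q0" "F1 holomorphic_on strip (p1 + 2 * pi) q0"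
  proof -
    show "E0 holomorphic_on strip (p1 + 2 * pi) q0" using E0(1) sub2 holomorphic_on_subset by blast
    show "F1 holomorphic_on strip (p1 + 2 * pi) q0" unfolding F1_def
      by (rule holomorphic_on_compose_gen[OF _ E1(1), unfolded o_def]) (use shift in \<open>auto intro!: holomorphic_intros\<close>)
  qed
  have T1: "\<forall>z\<in>strip p0 q1. norm (E0 z) = norm (E1 z) \<and> norm (E0 z) \<ge> 1"
    using transition_trichotomy[OF strip_basic(1,3) hol1 _ rel1] nz1 sub1(2) ext0[of "strip p0 q1"] ext1[of "strip p0 q1"] not0 not1
    by blast
  have T2: "\<forall>z\<in>strip (p1 + 2 * pi) q0. norm (E0 z) = norm (F1 z) \<and> norm (E0 z) \<ge> 1"
  proof -
    have "norm (E1 z) = 1" if one: "\<forall>z\<in>strip (p1 + 2 * pi) q0. norm (F1 z) = 1" and z: "z \<in> strip p1 (q0 - 2 * pi)" for z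
    proof -
      have "z + 2 * pi * \<i> \<in> strip (p1 + 2 * pi) q0" using z by (auto simp: strip_def)
      thus ?thesis using one by (force simp: F1_def)
    qed
    hence "\<not> (\<forall>z\<in>strip (p1 + 2 * pi) q0. norm (F1 z) = 1)" using ext1[of "strip p1 (q0 - 2 * pi)"] not1 by blast
    moreover have "F1 z \<noteq> 0" if "z \<in> strip (p1 + 2 * pi) q0" for z using nz1 shift[OF that] by (simp add: F1_def)
    ultimately show ?thesis
      using transition_trichotomy[OF strip_basic(1,3) hol2 _ rel2] ext0[of "strip (p1 + 2 * pi) q0"] not0 by blast
  qed

  \<comment> \<open>From the limits back to a circle on which \<open>f\<close> is large\<close>
  have "\<exists>t\<ge>0. (\<forall>s. p0 < s \<longrightarrow> s < q0 \<longrightarrow> norm (E0 (Complex t s)) > 1) \<and> (\<forall>s. p1 < s \<longrightarrow> s < q1 \<longrightarrow> norm (E1 (Complex t s)) > 1)"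
    by (rule positive_transition_sectors[OF ord wide E0(1) E1(1) _ _ _ _ up_E0 up_E1 \<nu> big])
       (use nz0 nz1 T1 T2 in \<open>auto simp: F1_def\<close>)
  then obtain t where t: "t \<ge> 0" "\<And>s. p0 < s \<Longrightarrow> s < q0 \<Longrightarrow> norm (E0 (Complex t s)) > 1"
    "\<And>s. p1 < s \<Longrightarrow> s < q1 \<Longrightarrow> norm (E1 (Complex t s)) > 1" by blast
  obtain z0 where z0: "z0 \<in> K0 t" "\<And>z. z \<in> K0 t \<Longrightarrow> norm (E0 z0) \<le> norm (E0 z)"
    using continuous_attains_inf[OF K0(1)[OF t(1)] Kne(1) continuous_on_subset[OF contE0 K0(2)[OF t(1)]]] by auto
  obtain z1 where z1: "z1 \<in> K1 t" "\<And>z. z \<in> K1 t \<Longrightarrow> norm (E1 z1) \<le> norm (E1 z)"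
    using continuous_attains_inf[OF K1(1)[OF t(1)] Kne(2) continuous_on_subset[OF contE1 K1(2)[OF t(1)]]] by auto
  have zz: "Complex t (Im z0) = z0" "Complex t (Im z1) = z1"
    using z0(1) z1(1) by (auto simp: K0_def K1_def in_cbox_complex_iff complex_eq_iff)
  have "z0 \<in> strip p0 q0" "z1 \<in> strip p1 q1" using z0(1) z1(1) K0(2)[OF t(1)] K1(2)[OF t(1)] by auto
  hence gt: "norm (E0 z0) > 1" "norm (E1 z1) > 1"
    using t(2)[of "Im z0"] t(3)[of "Im z1"] zz by (auto simp: strip_def)
  define c where "c = (1 + min (norm (E0 z0)) (norm (E1 z1))) / 2"
  have c: "c > 1" "c < norm (E0 z0)" "c < norm (E1 z1)" using gt by (auto simp: c_def min_def field_simps)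
  define d where "d = min (norm (E0 z0)) (norm (E1 z1)) - c"
  have d: "d > 0" using c by (simp add: d_def)
  \<comment> \<open>\<open>B k\<close> eventually exceeds every multiple of \<open>y k\<close>; this
    multiple gives \<open>c powr (B k) \<ge> exp (2 * y k)\<close>, which dominates
    \<open>R + 3\<close> since \<open>R\<close> is \<open>exp t\<close> times
    \<open>exp (y k)\<close>. The 3 in place of 2 pays for the step from \<open>f - 1\<close> to
    \<open>f\<close>.\<close>
  define n where "n = nat \<lceil>2 / ln c\<rceil>"
  have n: "n * ln c \<ge> 2"
  proof -
    have "2 / ln c \<le> n" unfolding n_def by linarith
    thus ?thesis using c by (simp add: pos_divide_le_eq)
  qed
  have "eventually (\<lambda>k. y k \<ge> max (max 0 N) (ln (exp t + 3))) sequentially"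
    using ylim unfolding filterlim_at_top by (rule spec)
  from eventually_conj[OF uniform_limit_normD[OF lim0[OF K0[OF t(1)]] d]
       eventually_conj[OF uniform_limit_normD[OF lim1[OF K1[OF t(1)]] d] eventually_conj[OF By[of n] this]]]
  obtain k where k: "\<forall>z\<in>K0 t. \<bar>norm (v k z) powr (1 / B k) - norm (E0 z)\<bar> < d"
    "\<forall>z\<in>K1 t. \<bar>norm (v k z - 1) powr (1 / B k) - norm (E1 z)\<bar> < d" "n * y k \<le> B k" "y k \<ge> max (max 0 N) (ln (exp t + 3))"
    using eventually_happens'[OF sequentially_bot] by blast
  define R where "R = exp (y k + t)"
  have R: "R \<ge> N"
  proof -
    have "R \<ge> exp (y k)" using t by (simp add: R_def)
    moreover have "exp (y k) \<ge> y k" using exp_ge_add_one_self[of "y k"] by linarith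
    ultimately show ?thesis using k(4) by simp
  qed
  have pow: "c powr (B k) \<ge> R + 3"
  proof -
    have yk: "exp (y k) \<ge> exp t + 3" "exp (y k) \<ge> 1"
    proof -
      have "exp (y k) \<ge> exp (ln (exp t + 3))" using k(4) by simp
      thus "exp (y k) \<ge> exp t + 3" by (simp add: add_pos_pos)
      show "exp (y k) \<ge> 1" using k(4) by simp
    qed
    have "2 * y k \<le> (n * ln c) * y k" using n k(4) by (intro mult_right_mono) auto
    also have "\<dots> = ln c * (n * y k)" by simp
    also have "\<dots> \<le> ln c * B k" using k(3) c(1) by (intro mult_left_mono) auto
    finally have "exp (2 * y k) \<le> c powr (B k)" using c(1) by (simp add: powr_def mult.commute)
    moreover have "exp (2 * y k) = exp (y k) * exp (y k)" by (simp flip: exp_add)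
    moreover have "exp (y k) * exp (y k) \<ge> exp (y k) * (exp t + 3)" using yk(1) by (intro mult_left_mono) auto
    moreover have "exp (y k) * (exp t + 3) \<ge> R + 3" using yk(2) by (simp add: R_def distrib_left exp_add)
    ultimately show ?thesis by linarith
  qed
  have root: "b \<ge> R + 3" if "b powr (1 / B k) \<ge> c" "b \<ge> 0" for b
  proof -
    have "b \<noteq> 0" using that c by auto
    have "c powr (B k) \<le> (b powr (1 / B k)) powr (B k)" using that c Bpos[of k] by (intro powr_mono2) auto
    also have "\<dots> = b" using that(2) Bpos[of k] \<open>b \<noteq> 0\<close> by (simp add: powr_powr)
    finally show ?thesis using pow by linarith
  qed
  have "norm (f u) \<ge> R + 2" if u: "norm u = R" for u
  proof -
    have u0: "u \<noteq> 0" using u by (auto simp: R_def)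
    define z where "z = Ln u - of_real (y k)"
    have z: "Re z = t" "v k z = f u" using u0 u by (simp_all add: z_def v_def \<Phi>_def R_def)
    obtain w where w: "w \<in> K0 t \<or> w \<in> K1 t" "v k w = v k z" using cover[of z] z(1) by auto
    from w(1) show ?thesis
    proof
      assume wK: "w \<in> K0 t"
      have "norm (v k w) powr (1 / B k) \<ge> c" using k(1)[rule_format, OF wK] z0(2)[OF wK] by (simp add: d_def)
      from root[OF this] show ?thesis using w(2) z(2) by simp
    next
      assume wK: "w \<in> K1 t"
      have "norm (v k w - 1) powr (1 / B k) \<ge> c" using k(2)[rule_format, OF wK] z1(2)[OF wK] by (simp add: d_def)
      from root[OF this] have "norm (f u - 1) \<ge> R + 3" using w(2) z(2) by simp
      thus ?thesis using norm_triangle_ineq4[of "f u" 1] by simp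
    qed
  qed
  thus ?thesis using R by blast
qed

theorem theorem1p1:
  fixes S\<^sub>0 S\<^sub>1 :: "complex set" and \<theta>\<^sub>0 \<theta>\<^sub>1 :: real
  assumes "closed_sector S\<^sub>0 \<theta>\<^sub>0" and "closed_sector S\<^sub>1 \<theta>\<^sub>1"
    and "S\<^sub>0 \<inter> S\<^sub>1 = {0}"
    and "min \<theta>\<^sub>0 \<theta>\<^sub>1 < pi / 2" and "max \<theta>\<^sub>0 \<theta>\<^sub>1 < pi"
  shows "\<not> (\<exists>f. transcendental_entire f \<and> entire_order f < \<infinity> \<and>
              finite {z. f z = 0 \<and> z \<notin> S\<^sub>0} \<and>
              finite {z. f z = 1 \<and> z \<notin> S\<^sub>1})"
proof (rule notI, elim exE conjE)
  fix f assume tr: "transcendental_entire f" and ord: "entire_order f < \<infinity>"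
    and fin: "finite {z. f z = 0 \<and> z \<notin> S\<^sub>0}" "finite {z. f z = 1 \<and> z \<notin> S\<^sub>1}"
  have hol: "f holomorphic_on UNIV" and np: "\<nexists>p. f = poly p"
    using tr by (auto simp: transcendental_entire_def)
  have small: "\<theta>\<^sub>0 < pi" "\<theta>\<^sub>1 < pi" using assms(5) by auto
  obtain p0 q1 p1 q0 c w where
    o: "p0 < q1" "q1 < p1 + 2 * pi" "p1 + 2 * pi < q0" "q0 < p0 + 2 * pi"
    and wd: "q0 - p0 = 2 * pi - \<theta>\<^sub>0" "q1 - p1 = 2 * pi - \<theta>\<^sub>1"
    and out: "\<And>z. p0 < Im z \<Longrightarrow> Im z < q0 \<Longrightarrow> exp z \<notin> S\<^sub>0" "\<And>z. p1 < Im z \<Longrightarrow> Im z < q1 \<Longrightarrow> exp z \<notin> S\<^sub>1"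
    and cw: "c > 0" "\<And>z. z \<in> S\<^sub>0 \<Longrightarrow> Re (z * w) \<ge> c * norm z" "\<And>z. z \<in> S\<^sub>1 \<Longrightarrow> Re (z * w) \<le> - c * norm z"
    by (rule disjoint_sectors_coordinates[OF assms(1-3) small], rule that; blast)
  \<comment> \<open>The finitely many exceptional points lie in a disc, so for large
    \<open>Re z\<close> the images of the two strips contain neither these nor, by
    \<open>out\<close>, the points inside the respective sector.\<close>
  define Z where "Z = {z. f z = 0 \<and> z \<notin> S\<^sub>0} \<union> {z. f z = 1 \<and> z \<notin> S\<^sub>1}"
  have "finite (norm ` Z)" using fin by (simp add: Z_def)
  then obtain C where C: "\<And>z. z \<in> Z \<Longrightarrow> norm z \<le> C"
    using bdd_above_finite[of "norm ` Z"] by (auto simp: bdd_above_def)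
  have far: "exp z \<notin> Z" if "Re z > max 0 C" for z
  proof
    assume "exp z \<in> Z"
    hence "exp (Re z) \<le> C" using C by force
    moreover have "1 + Re z \<le> exp (Re z)" by (rule exp_ge_add_one_self)
    ultimately show False using that unfolding max_less_iff_conj by linarith
  qed
  have big: "\<exists>R\<ge>N. \<forall>z. norm z = R \<longrightarrow> norm (f z) \<ge> R + 2" for N
  proof (rule no_separated_zeros_and_ones[OF hol np ord o])
    show "q0 - p0 > pi" "q1 - p1 > pi" "max (q0 - p0) (q1 - p1) > 3 * pi / 2"
      using assms(4) small unfolding wd by (auto simp: max_def min_def split: if_splits)
    show "f (exp z) \<noteq> 0" if "Re z > max 0 C" "p0 < Im z" "Im z < q0" for z
      using far[OF that(1)] out(1)[OF that(2,3)] by (auto simp: Z_def)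
    show "f (exp z) \<noteq> 1" if "Re z > max 0 C" "p1 < Im z" "Im z < q1" for z
      using far[OF that(1)] out(2)[OF that(2,3)] by (auto simp: Z_def)
  qed
  have "finite {z. f z = 0}" "finite {z. f z = 1}"
    using separated_moments_imp_finite[OF hol fin cw big] by blast+
  hence "\<exists>p. f = poly p" by (rule finite_zeros_ones_imp_poly[OF hol])
  thus False using np by blast
qed

end
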